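(* Let $h$ be a fixed constant integer and let $G$ be an $n$-vertex graph (undirected or directed) containing $t\ge1$ copies of an $h$-cycle, let $x$ be the number of vertices of $G$ participating in at least one $h$-cycle, and let $\delta$ be defined by $x^{h-\delta}=2ht$ if $G$ is undirected and $x^{h-\delta}=ht$ if $G$ is directed. There exists a randomized Congested Clique algorithm that detects an $h$-cycle in $\tilde O\big(\mathrm{MM}(n/x,n/x,n/x;x^{\delta})\big)$ rounds with high probability, with one-sided error.
   Context: Congested Clique model: the $n$ vertices of $G$ ($V(G)=[n]$) are the machines, each initially knowing its incident edges; synchronous rounds, each vertex may send a possibly different $O(\log n)$-bit message to every other vertex per round; local computation is free. One-sided error: never outputs True if $G$ has no $h$-cycle; if $G$ has one, some vertex outputs True with high probability ($\ge 1-1/n^c$). $\mathrm{MM}(k,k,k;s)$ denotes the Congested Clique round complexity (with $n$ vertices) of the following problem: given $s$ pairs $(S_i,T_i)_{i\in[s]}$ of $k\times k$ matrices with $sk^2\le n^2$, each vertex has a label $(i,x',y')$ with $i\in[s]$, $x',y'\in[\sqrt{n/s}]$, receives the blocks $S_i[*x'*,*y'*],T_i[*x'*,*y'*]$ and must output $(S_iT_i)[*x'*,*y'*]$; here, for a $k\times k$ matrix $A$, writing each index $v\in[k]$ in mixed radix as $v_1v_2v_3$ with $v_2\in[\sqrt{n/s}]$, $A[*x'*,*y'*]$ is the submatrix of rows with $v_2=x'$ and columns with $v_2=y'$. (It is known that $\mathrm{MM}(k,k,k;s)=O(n^{\rho-2}k^2s^{1-\rho})$, where $\rho$ is the Congested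 Clique matrix multiplication exponent.) $\tilde O$ hides polylogarithmic factors in $n$. *)

theory Defs
  imports "HOL-Probability.Product_PMF" "Jordan_Normal_Form.Matrix"
begin

section \<open>Graphs and cycles\<close>

text \<open>
  A graph on the vertex set \<open>{..<n}\<close> is given by its set of ordered edges; an undirected graph is
  one whose edge set is symmetric.
\<close>

definition directed_graph :: "nat \<Rightarrow> (nat \<times> nat) set \<Rightarrow> bool" where
  "directed_graph n E \<longleftrightarrow> E \<subseteq> {..<n} \<times> {..<n} \<and> irrefl E"

definition undirected_graph :: "nat \<Rightarrow> (nat \<times> nat) set \<Rightarrow> bool" where
  "undirected_graph n E \<longleftrightarrow> directed_graph n E \<and> sym E"

definition closed_walk_edges :: "nat list \<Rightarrow> (nat \<times> nat) set" where
  "closed_walk_edges vs = {(vs ! i, vs ! (Suc i mod length vs)) | i. i < length vs}"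

text \<open>
  A copy of an \<open>h\<close>-cycle is a subgraph, identified with its edge set, and not a vertex sequence.
  A copy comes from \<open>h\<close> vertex sequences in the directed case and from \<open>2 * h\<close> of them in the
  undirected case. Copies are meant for \<open>h \<ge> 2\<close> (directed) and \<open>h \<ge> 3\<close> (undirected) only.
\<close>

definition directed_cycles :: "nat \<Rightarrow> (nat \<times> nat) set \<Rightarrow> (nat \<times> nat) set set" where
  "directed_cycles h E =
     {closed_walk_edges vs | vs. length vs = h \<and> distinct vs \<and> closed_walk_edges vs \<subseteq> E}"

definition undirected_cycles :: "nat \<Rightarrow> (nat \<times> nat) set \<Rightarrow> (nat \<times> nat) set set" where
  "undirected_cycles h E =
     {closed_walk_edges vs \<union> (closed_walk_edges vs)\<inverse> | vs.
        length vs = h \<and> distinct vs \<and> closed_walk_edges vs \<subseteq> E}"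

definition covered_vertices :: "(nat \<times> nat) set set \<Rightarrow> nat set" where
  "covered_vertices \<C> = (\<Union>C\<in>\<C>. Field C)"


section \<open>The Congested Clique\<close>

text \<open>
  Local computation is free, so the state of a vertex can be taken to be its input together with
  everything it has received: the \<open>r\<close>-th entry of a view maps every vertex to the message received
  from it in round \<open>r\<close>. The length of the view is the number of elapsed rounds.
\<close>

type_synonym message = "bool list"
type_synonym view = "(nat \<Rightarrow> message) list"

text \<open>
  \<open>send P u i w v\<close> is the message that vertex \<open>u\<close> with input \<open>i\<close> and view \<open>w\<close> sends to \<open>v\<close> in the
  next round. \<open>decide P u i w\<close> is its output, or \<open>None\<close> as long as it continues to run.
\<close>

record ('i, 'o) protocol =
  send :: "nat \<Rightarrow> 'i \<Rightarrow> view \<Rightarrow> nat \<Rightarrow> message"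
  decide :: "nat \<Rightarrow> 'i \<Rightarrow> view \<Rightarrow> 'o option"

primrec view_after ::
    "nat \<Rightarrow> ('i, 'o) protocol \<Rightarrow> (nat \<Rightarrow> 'i) \<Rightarrow> nat \<Rightarrow> nat \<Rightarrow> view" where
  "view_after n P inp 0 v = []"
| "view_after n P inp (Suc r) v =
     view_after n P inp r v @
       [\<lambda>u. if u < n \<and> u \<noteq> v then send P u (inp u) (view_after n P inp r u) v else []]"

text \<open>The constant \<open>\<beta>\<close> is the one hidden in ``\<open>O(log n)\<close> bits per message''.\<close>

definition bandwidth_bounded :: "nat \<Rightarrow> nat \<Rightarrow> ('i, 'o) protocol \<Rightarrow> bool" where
  "bandwidth_bounded \<beta> n P \<longleftrightarrow>
     (\<forall>u<n. \<forall>v<n. \<forall>i w. length (send P u i w v) \<le> \<beta> * nat \<lceil>log 2 (real n)\<rceil>)"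

text \<open>The first output of a vertex is the one that counts.\<close>

definition outputs_within ::
    "nat \<Rightarrow> ('i, 'o) protocol \<Rightarrow> (nat \<Rightarrow> 'i) \<Rightarrow> nat \<Rightarrow> nat \<Rightarrow> 'o \<Rightarrow> bool" where
  "outputs_within n P inp R v y \<longleftrightarrow>
     (\<exists>r\<le>R. decide P v (inp v) (view_after n P inp r v) = Some y \<and>
            (\<forall>r'<r. decide P v (inp v) (view_after n P inp r' v) = None))"

definition terminates_within ::
    "nat \<Rightarrow> ('i, 'o) protocol \<Rightarrow> (nat \<Rightarrow> 'i) \<Rightarrow> nat \<Rightarrow> bool" where
  "terminates_within n P inp R \<longleftrightarrow> (\<forall>v<n. \<exists>y. outputs_within n P inp R v y)"


section \<open>Many small matrix products\<close>

text \<open>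
  The index \<open>v < k\<close> is written as \<open>v\<^sub>1 v\<^sub>2 v\<^sub>3\<close> in mixed radix, where \<open>v\<^sub>2 < q\<close> and \<open>v\<^sub>3 < d\<close>.
\<close>

definition middle_digit :: "nat \<Rightarrow> nat \<Rightarrow> nat \<Rightarrow> nat" where
  "middle_digit q d v = (v div d) mod q"

type_synonym block = "nat \<times> nat \<Rightarrow> int option"

definition matrix_block :: "nat \<Rightarrow> nat \<Rightarrow> int mat \<Rightarrow> nat \<Rightarrow> nat \<Rightarrow> block" where
  "matrix_block q d A x' y' =
     (\<lambda>(u, w). if u < dim_row A \<and> w < dim_col A \<and>
                  middle_digit q d u = x' \<and> middle_digit q d w = y'
               then Some (A $$ (u, w)) else None)"

text \<open>
  The number of block rows is \<open>sqrt (n / s)\<close>, rounded down to an integer so that at most \<open>n\<close> labels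
  are used. For \<open>s > n\<close> there is a single block per matrix, and the vertices hold several labels
  each, distributed evenly.
\<close>

definition block_rows :: "nat \<Rightarrow> nat \<Rightarrow> nat" where
  "block_rows n s = max 1 (nat \<lfloor>sqrt (real n / real s)\<rfloor>)"

type_synonym label = "nat \<times> nat \<times> nat"

definition labels_of :: "nat \<Rightarrow> nat \<Rightarrow> nat \<Rightarrow> label set" where
  "labels_of n s v =
     (let q = block_rows n s in
      {(i, x', y'). i < s \<and> x' < q \<and> y' < q \<and> ((i * q + x') * q + y') mod n = v})"

definition product_input ::
    "nat \<Rightarrow> nat \<Rightarrow> nat \<Rightarrow> (nat \<Rightarrow> int mat) \<Rightarrow> (nat \<Rightarrow> int mat) \<Rightarrow> nat \<Rightarrow> label \<Rightarrow>
     (block \<times> block) option" where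
  "product_input n s d S T v =
     (\<lambda>(i, x', y').
        if (i, x', y') \<in> labels_of n s v
        then Some (matrix_block (block_rows n s) d (S i) x' y',
                   matrix_block (block_rows n s) d (T i) x' y')
        else None)"

definition product_output ::
    "nat \<Rightarrow> nat \<Rightarrow> nat \<Rightarrow> (nat \<Rightarrow> int mat) \<Rightarrow> (nat \<Rightarrow> int mat) \<Rightarrow> nat \<Rightarrow> label \<Rightarrow> block option" where
  "product_output n s d S T v =
     (\<lambda>(i, x', y').
        if (i, x', y') \<in> labels_of n s v
        then Some (matrix_block (block_rows n s) d (S i * T i) x' y')
        else None)"

text \<open>Matrix entries are integers of \<open>O(log n)\<close> bits, that is, of absolute value at most \<open>n ^ \<alpha>\<close>.\<close>

definition small_matrix :: "nat \<Rightarrow> nat \<Rightarrow> nat \<Rightarrow> int mat \<Rightarrow> bool" where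
  "small_matrix \<alpha> n k A \<longleftrightarrow>
     A \<in> carrier_mat k k \<and> (\<forall>u<k. \<forall>w<k. \<bar>A $$ (u, w)\<bar> \<le> int n ^ \<alpha>)"

text \<open>
  The radix \<open>d\<close> of the last digit may be chosen freely, subject to \<open>d * q \<le> k\<close> (and \<open>d = 1\<close> if
  \<open>k < q\<close>). If \<open>d * q\<close> divides \<open>k\<close>, the choice only amounts to a renumbering of the rows and columns;
  in general the condition keeps the blocks of balanced size.
\<close>

definition products_computable :: "nat \<Rightarrow> nat \<Rightarrow> nat \<Rightarrow> nat \<Rightarrow> nat \<Rightarrow> nat \<Rightarrow> bool" where
  "products_computable \<beta> \<alpha> n k s R \<longleftrightarrow>
     (\<exists>d P. 1 \<le> d \<and> d \<le> max 1 (k div block_rows n s) \<and>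
        bandwidth_bounded \<beta> n P \<and>
        (\<forall>S T. (\<forall>i<s. small_matrix \<alpha> n k (S i) \<and> small_matrix \<alpha> n k (T i)) \<longrightarrow>
           (\<forall>v<n. outputs_within n P (product_input n s d S T) R v (product_output n s d S T v))))"

text \<open>
  \<open>MM \<beta> \<alpha> n k s\<close> is the round complexity \<open>MM(k,k,k;s)\<close> on \<open>n\<close> vertices. Real parameters are
  rounded up. For \<open>s * k\<^sup>2 \<le> n\<^sup>2\<close>, the range in which the problem is posed, the first argument of
  \<open>max\<close> is \<open>1\<close>: it only excludes a complexity of \<open>0\<close> rounds, which the definition would give, for
  instance, for \<open>k = 1\<close>. For larger \<open>s\<close> the inputs exceed \<open>n\<close> entries per vertex, and
  \<open>s * k\<^sup>2 / n\<^sup>2\<close> accounts for the rounds needed to receive \<open>s * k\<^sup>2 / n\<close> entries.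
  Without this term the value would be \<open>0\<close> for all \<open>s > n\<close>, whatever \<open>k\<close> is.
\<close>

definition MM :: "nat \<Rightarrow> nat \<Rightarrow> nat \<Rightarrow> real \<Rightarrow> real \<Rightarrow> nat" where
  "MM \<beta> \<alpha> n k s =
     max (nat \<lceil>s * k\<^sup>2 / (real n)\<^sup>2\<rceil>)
         (LEAST R. products_computable \<beta> \<alpha> n (nat \<lceil>k\<rceil>) (nat \<lceil>s\<rceil>) R)"


section \<open>Randomized cycle detection\<close>

text \<open>
  In a randomized protocol for \<open>n\<close> vertices every vertex has a private string of \<open>m\<close> independent
  fair coin flips as an additional input.
\<close>

definition coins :: "nat \<Rightarrow> nat \<Rightarrow> (nat \<Rightarrow> bool list) pmf" where
  "coins n m = Pi_pmf {..<n} [] (\<lambda>_. pmf_of_set {bs. length bs = m})"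

definition incident_edges :: "(nat \<times> nat) set \<Rightarrow> nat \<Rightarrow> (nat \<times> nat) set" where
  "incident_edges E v = {e \<in> E. fst e = v \<or> snd e = v}"

definition graph_input ::
    "(nat \<times> nat) set \<Rightarrow> (nat \<Rightarrow> bool list) \<Rightarrow> nat \<Rightarrow> (nat \<times> nat) set \<times> bool list" where
  "graph_input E \<omega> v = (incident_edges E v, \<omega> v)"

type_synonym graph_algorithm = "nat \<Rightarrow> ((nat \<times> nat) set \<times> bool list, bool) protocol"

text \<open>
  A randomized algorithm for a class of graphs consists of a protocol and a number of coin flips for
  every \<open>n\<close>. It always terminates, possibly after a number of rounds that depends on \<open>n\<close> only.
\<close>

definition randomized_algorithm ::
    "nat \<Rightarrow> (nat \<Rightarrow> (nat \<times> nat) set \<Rightarrow> bool) \<Rightarrow> graph_algorithm \<Rightarrow> (nat \<Rightarrow> nat) \<Rightarrow> bool" where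
  "randomized_algorithm \<beta> graph A m \<longleftrightarrow>
     (\<forall>n. bandwidth_bounded \<beta> n (A n) \<and>
          (\<exists>R. \<forall>E. graph n E \<longrightarrow>
             (\<forall>\<omega>\<in>set_pmf (coins n (m n)). terminates_within n (A n) (graph_input E \<omega>) R)))"

definition never_outputs_True ::
    "graph_algorithm \<Rightarrow> (nat \<Rightarrow> nat) \<Rightarrow> nat \<Rightarrow> (nat \<times> nat) set \<Rightarrow> bool" where
  "never_outputs_True A m n E \<longleftrightarrow>
     (\<forall>\<omega>\<in>set_pmf (coins n (m n)). \<forall>v<n. \<forall>R.
        \<not> outputs_within n (A n) (graph_input E \<omega>) R v True)"

definition detection_probability ::
    "graph_algorithm \<Rightarrow> (nat \<Rightarrow> nat) \<Rightarrow> nat \<Rightarrow> (nat \<times> nat) set \<Rightarrow> nat \<Rightarrow> real" where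
  "detection_probability A m n E R =
     measure_pmf.prob (coins n (m n))
       {\<omega>. terminates_within n (A n) (graph_input E \<omega>) R \<and>
           (\<exists>v<n. outputs_within n (A n) (graph_input E \<omega>) R v True)}"

end

theory Submission
  imports Defs
begin

text \<open>
  A sample consists of a colouring of the vertices with \<open>h\<close> colours and of \<open>k\<close>, about \<open>n / x\<close>,
  random vertices for each colour. It contains a properly coloured \<open>h\<close>-cycle with probability at
  least \<open>(10 h)^{- h}\<close> times the fraction of the \<open>x^h\<close> vertex sequences that are cycles, that is,
  of order \<open>x^{- \<delta>}\<close>. So \<open>O(log n)\<close> batches of \<open>s\<close>, about \<open>x^\<delta>\<close>, samples suffice. Cycles in a batch
  are found by \<open>h - 2\<close> successive sets of \<open>s\<close> Boolean products of adjacency matrices between consecutive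
  colours. The samples are functions of a short shared seed (Newman's argument), so all vertices know
  in advance who needs which matrix entry, and the entries are routed along an edge colouring of the
  demands. Since \<open>x\<close> and \<open>\<delta>\<close> are not known, the algorithm tries the pairs \<open>(k, s)\<close> up to factors
  of \<open>2\<close> in the order of their costs.
\<close>

section \<open>Composing protocols\<close>

text \<open>Edge colouring needs demands that all vertices know beforehand, but a batch may involve
  far more random choices than can be announced in the allowed time. A seed of O(log n) bits
  resolves this: vertex 0 sends it bit by bit, and the table from seeds to samples is part of the
  algorithm. For the same reason the demands must not depend on the graph, so absent edges are
  transmitted too. Routing is fast only if no vertex is sampled too often; an overloaded seed is
  recognised by everyone and counts as a failure. The product protocols are given and dictate where
  the matrix entries have to be; the balance of their blocks bounds what a vertex receives. Sorting
  the phases by cost makes the total time at most the number of phases times the cost of the right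
  one, although \<open>MM\<close> is not known to be monotone. Everything is counted for vertex
  sequences instead of copies of cycles, which treats directed and undirected graphs alike. It is
  enough that t is at most the number of sequences: the remaining factor of at most 2h only enters
  the number of batches.\<close>

lemma length_view_after [simp]: "length (view_after n P inp r v) = r"
  by (induction r) auto

lemma take_view_after: "r \<le> r' \<Longrightarrow> take r (view_after n P inp r' v) = view_after n P inp r v"
  by (induction r') (auto simp: le_Suc_eq)

text \<open>Only the sent messages enter a view, so views carry over between protocols that differ
  in \<open>decide\<close> or in the type of their inputs.\<close>

lemma view_after_cong:
  assumes "\<And>u v r'. u < n \<Longrightarrow> r' < r \<Longrightarrow>
    send P u (inp u) (view_after n P inp r' u) v = send Q u (inp' u) (view_after n P inp r' u) v"
  shows "view_after n P inp r v = view_after n Q inp' r v"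
  using assms
proof (induction r arbitrary: v)
  case (Suc r)
  then have "view_after n P inp r u = view_after n Q inp' r u" for u
    by auto
  with Suc.prems[of _ r] show ?case by (simp add: fun_eq_iff)
qed auto

text \<open>A world \<open>w\<close> is whatever one protocol has to cope with, such as a graph with
  coins; \<open>f w v\<close> is what vertex \<open>v\<close> knows at the start and
  \<open>g w v\<close> what it can compute after \<open>r\<close> rounds. The result is read off the
  view by \<open>out\<close> instead of being announced by \<open>decide\<close>, so that steps can
  be chained before any vertex answers.\<close>

definition reaches ::
    "nat \<Rightarrow> nat \<Rightarrow> nat \<Rightarrow> ('w \<Rightarrow> nat \<Rightarrow> 'a) \<Rightarrow> ('w \<Rightarrow> nat \<Rightarrow> 'b) \<Rightarrow> bool" where
  "reaches \<beta> n r f g \<longleftrightarrow>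
     (\<exists>(P :: ('a, unit) protocol) out. bandwidth_bounded \<beta> n P \<and>
        (\<forall>w. \<forall>v<n. out v (f w v) (view_after n P (f w) r v) = g w v))"

lemma reachesE:
  fixes f :: "'w \<Rightarrow> nat \<Rightarrow> 'a"
  assumes "reaches \<beta> n r f g"
  obtains P :: "('a, unit) protocol" and out where "bandwidth_bounded \<beta> n P"
    and "\<And>w v. v < n \<Longrightarrow> out v (f w v) (view_after n P (f w) r v) = g w v"
  using assms unfolding reaches_def by blast

text \<open>The second protocol sees the view without its first \<open>r\<close> entries. Its input
  is recomputed from these entries whenever it is needed, since a view forgets nothing.\<close>

definition sequential ::
    "nat \<Rightarrow> (nat \<Rightarrow> 'a \<Rightarrow> view \<Rightarrow> 'b) \<Rightarrow> ('a, 'o) protocol \<Rightarrow> ('b, 'p) protocol \<Rightarrow> ('a, 'p) protocol" where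
  "sequential r out P Q = \<lparr>
     send = (\<lambda>u i w. if length w < r then send P u i w
                      else send Q u (out u i (take r w)) (drop r w)),
     decide = (\<lambda>u i w. if length w < r then None
                        else decide Q u (out u i (take r w)) (drop r w))\<rparr>"

lemma bandwidth_sequential:
  "bandwidth_bounded \<beta> n P \<Longrightarrow> bandwidth_bounded \<beta> n Q \<Longrightarrow> bandwidth_bounded \<beta> n (sequential r out P Q)"
  by (auto simp: bandwidth_bounded_def sequential_def)

lemma view_sequential_first:
  "r' \<le> r \<Longrightarrow> view_after n (sequential r out P Q) inp r' v = view_after n P inp r' v"
  by (rule view_after_cong) (auto simp: sequential_def)

lemma view_sequential:
  assumes "\<And>u. u < n \<Longrightarrow> out u (inp u) (view_after n P inp r u) = inp' u"
  shows "view_after n (sequential r out P Q) inp (r + r') v =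
    view_after n P inp r v @ view_after n Q inp' r' v"
proof (induction r' arbitrary: v)
  case 0
  show ?case by (simp add: view_sequential_first)
next
  case (Suc r')
  have "send (sequential r out P Q) u (inp u) (view_after n (sequential r out P Q) inp (r + r') u) v =
      send Q u (inp' u) (view_after n Q inp' r' u) v" if "u < n" for u
    unfolding Suc using assms[OF that] by (simp add: sequential_def)
  then show ?case
    by (simp add: Suc fun_eq_iff)
qed

lemma outputs_within_mono:
  "outputs_within n P inp R v y \<Longrightarrow> R \<le> R' \<Longrightarrow> outputs_within n P inp R' v y"
  by (auto simp: outputs_within_def intro: order_trans)

lemma outputs_within_unique:
  assumes "outputs_within n P inp R v y" "outputs_within n P inp R' v y'"
  shows "y = y'"
proof -
  from assms obtain r r' where
    r: "decide P v (inp v) (view_after n P inp r v) = Some y"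
       "\<forall>i<r. decide P v (inp v) (view_after n P inp i v) = None" and
    r': "decide P v (inp v) (view_after n P inp r' v) = Some y'"
       "\<forall>i<r'. decide P v (inp v) (view_after n P inp i v) = None"
    unfolding outputs_within_def by blast
  then have "r = r'" by (metis linorder_neqE_nat option.distinct(1))
  with r r' show ?thesis by simp
qed

lemma outputs_sequential:
  assumes inp': "\<And>u. u < n \<Longrightarrow> out u (inp u) (view_after n P inp r u) = inp' u"
    and Q: "outputs_within n Q inp' R v y" and "v < n"
  shows "outputs_within n (sequential r out P Q) inp (r + R) v y"
proof -
  let ?S = "sequential r out P Q"
  from Q obtain r' where r': "r' \<le> R" "decide Q v (inp' v) (view_after n Q inp' r' v) = Some y"
     "\<And>i. i < r' \<Longrightarrow> decide Q v (inp' v) (view_after n Q inp' i v) = None"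
    unfolding outputs_within_def by blast
  have late: "decide ?S v (inp v) (view_after n ?S inp (r + i) v) =
      decide Q v (inp' v) (view_after n Q inp' i v)" for i
    using inp'[OF \<open>v < n\<close>] view_sequential[of n out inp P r inp' Q i v] inp'
    by (simp add: sequential_def)
  have "decide ?S v (inp v) (view_after n ?S inp i v) = None" if "i < r + r'" for i
  proof (cases "i < r")
    case True
    then show ?thesis by (simp add: sequential_def)
  next
    case False
    with that have "i = r + (i - r)" "i - r < r'" by auto
    then show ?thesis using late r'(3) by metis
  qed
  with late[of r'] r' show ?thesis
    unfolding outputs_within_def by (intro exI[of _ "r + r'"]) auto
qed

lemma reaches_local:
  assumes "reaches \<beta> n r f g" and "\<And>w v. v < n \<Longrightarrow> g' w v = \<phi> v (f w v) (g w v)"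
  shows "reaches \<beta> n r f g'"
proof -
  from assms(1) obtain P :: "(_, unit) protocol" and out where
    P: "bandwidth_bounded \<beta> n P" "\<And>w v. v < n \<Longrightarrow> out v (f w v) (view_after n P (f w) r v) = g w v"
    by (rule reachesE) (rule that)
  show ?thesis unfolding reaches_def
    by (rule exI[of _ P], rule exI[of _ "\<lambda>v i w. \<phi> v i (out v i w)"]) (use P assms(2) in auto)
qed

lemma reaches_idle: "reaches \<beta> n r f f"
  unfolding reaches_def
  by (rule exI[of _ "\<lparr>send = \<lambda>_ _ _ _. [], decide = \<lambda>_ _ _. None\<rparr>"], rule exI[of _ "\<lambda>v i w. i"])
     (auto simp: bandwidth_bounded_def)

lemma reaches_trans:
  assumes "reaches \<beta> n r f g" and "reaches \<beta> n r' g g'"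
  shows "reaches \<beta> n (r + r') f g'"
proof -
  from assms(1) obtain P :: "(_, unit) protocol" and out where
    P: "bandwidth_bounded \<beta> n P" "\<And>w v. v < n \<Longrightarrow> out v (f w v) (view_after n P (f w) r v) = g w v"
    by (rule reachesE) (rule that)
  from assms(2) obtain Q :: "(_, unit) protocol" and out' where
    Q: "bandwidth_bounded \<beta> n Q" "\<And>w v. v < n \<Longrightarrow> out' v (g w v) (view_after n Q (g w) r' v) = g' w v"
    by (rule reachesE) (rule that)
  show ?thesis unfolding reaches_def
  proof (rule exI[of _ "sequential r out P Q"],
      rule exI[of _ "\<lambda>v i w. out' v (out v i (take r w)) (drop r w)"], intro conjI allI impI)
    fix w v assume v: "v < n"
    have "view_after n (sequential r out P Q) (f w) (r + r') v =
        view_after n P (f w) r v @ view_after n Q (g w) r' v"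
      by (rule view_sequential) (use P in auto)
    then show "out' v (out v (f w v) (take r (view_after n (sequential r out P Q) (f w) (r + r') v)))
        (drop r (view_after n (sequential r out P Q) (f w) (r + r') v)) = g' w v"
      using P Q v by simp
  qed (use P Q in \<open>simp add: bandwidth_sequential\<close>)
qed

lemma reaches_keep: "reaches \<beta> n r f g \<Longrightarrow> reaches \<beta> n r f (\<lambda>w v. (f w v, g w v))"
  by (erule reaches_local[where \<phi> = "\<lambda>v. Pair"]) simp

lemma reaches_mono: "reaches \<beta> n r f g \<Longrightarrow> r \<le> r' \<Longrightarrow> reaches \<beta> n r' f g"
  using reaches_trans[OF _ reaches_idle, of \<beta> n r f g "r' - r"] by simp

lemma reaches_compose:
  assumes "reaches \<beta> n r f g" and "\<And>w v. v < n \<Longrightarrow> f w v = \<phi> v (f' w v)"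
  shows "reaches \<beta> n r f' g"
proof -
  have "reaches \<beta> n 0 f' f"
    using assms(2) by (intro reaches_local[OF reaches_idle, where \<phi> = "\<lambda>v i _. \<phi> v i"]) auto
  from reaches_trans[OF this assms(1)] show ?thesis by simp
qed

lemma reaches_pair:
  assumes "reaches \<beta> n r f g" and "reaches \<beta> n r' f g'"
  shows "reaches \<beta> n (r + r') f (\<lambda>w v. (g w v, g' w v))"
proof -
  have "reaches \<beta> n r' (\<lambda>w v. (f w v, g w v)) g'"
    by (rule reaches_compose[OF assms(2), where \<phi> = "\<lambda>v. fst"]) simp
  then have "reaches \<beta> n r' (\<lambda>w v. (f w v, g w v)) (\<lambda>w v. (g w v, g' w v))"
    by (rule reaches_local[where \<phi> = "\<lambda>v i x. (snd i, x)"]) simp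
  with reaches_keep[OF assms(1)] show ?thesis by (rule reaches_trans)
qed

text \<open>Every vertex holds the same \<open>\<sigma>\<close>, so all of them agree on which
  protocol to run. This is how a shared seed turns into publicly known demands.\<close>

lemma reaches_public:
  fixes f :: "'w \<Rightarrow> nat \<Rightarrow> 'a" and g :: "'s \<Rightarrow> 'w \<Rightarrow> nat \<Rightarrow> 'b"
  assumes "\<And>\<sigma>. reaches \<beta> n r f (g \<sigma>)"
  shows "reaches \<beta> n r (\<lambda>(w, \<sigma>) v. (f w v, \<sigma>)) (\<lambda>(w, \<sigma>). g \<sigma> w)"
proof -
  from assms have "\<exists>X. \<forall>\<sigma>. bandwidth_bounded \<beta> n (fst (X \<sigma>) :: ('a, unit) protocol) \<and>
        (\<forall>w. \<forall>v<n. snd (X \<sigma>) v (f w v) (view_after n (fst (X \<sigma>)) (f w) r v) = g \<sigma> w v)"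
    unfolding reaches_def by (intro choice allI) (metis fst_conv snd_conv)
  then obtain X where X: "\<forall>\<sigma>. bandwidth_bounded \<beta> n (fst (X \<sigma>) :: ('a, unit) protocol) \<and>
        (\<forall>w. \<forall>v<n. snd (X \<sigma>) v (f w v) (view_after n (fst (X \<sigma>)) (f w) r v) = g \<sigma> w v)" ..
  define P where "P \<sigma> = fst (X \<sigma>)" for \<sigma>
  define out where "out \<sigma> = snd (X \<sigma>)" for \<sigma>
  have P: "bandwidth_bounded \<beta> n (P \<sigma>)"
    "v < n \<Longrightarrow> out \<sigma> v (f w v) (view_after n (P \<sigma>) (f w) r v) = g \<sigma> w v" for \<sigma> w v
    using X by (auto simp: P_def out_def)
  define Q :: "('a \<times> 's, unit) protocol" where
    "Q = \<lparr>send = \<lambda>u (i, \<sigma>) w. send (P \<sigma>) u i w, decide = \<lambda>_ _ _. None\<rparr>"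
  have "view_after n Q (\<lambda>v. (f w v, \<sigma>)) r v = view_after n (P \<sigma>) (f w) r v" for w \<sigma> v
    by (rule view_after_cong) (simp add: Q_def)
  then show ?thesis unfolding reaches_def
    by (intro exI[of _ Q] exI[of _ "\<lambda>v (i, \<sigma>). out \<sigma> v i"])
       (use P in \<open>auto simp: bandwidth_bounded_def Q_def\<close>)
qed

text \<open>All communication except that of the given product protocols is built from this exchange
  of one bit per ordered pair and round. By \<open>n \<ge> 2\<close> the logarithm is at least 1, so
  that one bit fits into a message.\<close>

lemma reaches_exchange:
  fixes f :: "'w \<Rightarrow> nat \<Rightarrow> 'b"
  assumes "\<beta> \<ge> 1" "n \<ge> 2"
  shows "reaches \<beta> n T f (\<lambda>w v r u. r < T \<and> u < n \<and> B r u (f w u) v)"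
proof -
  define P :: "('b, unit) protocol" where
    "P = \<lparr>send = \<lambda>u i w v. [B (length w) u i v], decide = \<lambda>_ _ _. None\<rparr>"
  have "1 \<le> log 2 (real n)" using assms by (simp add: le_log_iff)
  then have "\<beta> * nat \<lceil>log 2 (real n)\<rceil> \<ge> 1 * 1"
    using assms by (intro mult_mono) linarith+
  then have bw: "bandwidth_bounded \<beta> n P" by (auto simp: bandwidth_bounded_def P_def)
  have view: "view_after n P inp r v =
      map (\<lambda>r u. if u < n \<and> u \<noteq> v then [B r u (inp u) v] else []) [0..<r]" for inp r v
    by (induction r) (auto simp: P_def fun_eq_iff)
  \<comment> \<open>A view contains nothing that a vertex sends to itself; that bit is recomputed
    from the input.\<close>
  show ?thesis unfolding reaches_def
    by (rule exI[of _ P],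
        rule exI[of _ "\<lambda>v i w r u. r < T \<and> u < n \<and> (if u = v then B r v i v else (w ! r) u = [True])"])
       (use bw in \<open>auto simp: view fun_eq_iff\<close>)
qed

lemma reaches_broadcast_any:
  assumes "\<beta> \<ge> 1" "n \<ge> 2" and "reaches \<beta> n r f b"
  shows "reaches \<beta> n (Suc r) f (\<lambda>w v. \<exists>u<n. b w u)"
proof -
  have "reaches \<beta> n 1 b (\<lambda>w v. \<exists>u<n. b w u)"
    by (rule reaches_local[OF reaches_exchange[OF assms(1,2), of 1 b "\<lambda>_ _ i _. i"],
          where \<phi> = "\<lambda>v i x. \<exists>u. x 0 u"]) auto
  from reaches_trans[OF assms(3) this] show ?thesis by simp
qed

text \<open>After each phase all vertices know whether it succeeded, so that they stop simultaneously.\<close>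

lemma phases_protocol:
  fixes f :: "'w \<Rightarrow> nat \<Rightarrow> 'a"
  assumes "\<forall>z\<in>set zs. reaches \<beta> n (\<tau> z) f (\<lambda>w v. b z w)" and "sorted (map \<tau> zs)"
  shows "\<exists>P :: ('a, bool) protocol. bandwidth_bounded \<beta> n P \<and> (\<forall>w. \<forall>v<n.
     (\<forall>z\<in>set zs. b z w \<longrightarrow> outputs_within n P (f w) (length zs * \<tau> z) v True) \<and>
     ((\<forall>z\<in>set zs. \<not> b z w) \<longrightarrow> outputs_within n P (f w) (sum_list (map \<tau> zs)) v False))"
  using assms
proof (induction zs)
  case Nil
  show ?case
    by (rule exI[of _ "\<lparr>send = \<lambda>_ _ _ _. [], decide = \<lambda>_ _ _. Some False\<rparr>"])
       (auto simp: bandwidth_bounded_def outputs_within_def)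
next
  case (Cons y ys)
  then obtain Q :: "('a, bool) protocol" where Q: "bandwidth_bounded \<beta> n Q" "\<And>w v z. v < n \<Longrightarrow> z \<in> set ys \<Longrightarrow>
      b z w \<Longrightarrow> outputs_within n Q (f w) (length ys * \<tau> z) v True"
    "\<And>w v. v < n \<Longrightarrow> (\<forall>z\<in>set ys. \<not> b z w) \<Longrightarrow> outputs_within n Q (f w) (sum_list (map \<tau> ys)) v False"
    by (auto 4 4)
  \<comment> \<open>The flag says whether the phase before has succeeded; a vertex carrying it
    answers at once, without further rounds.\<close>
  define Q' where "Q' = \<lparr>send = \<lambda>u (i, _). send Q u i,
     decide = \<lambda>u (i, found) w. if found then Some True else decide Q u i w\<rparr>"
  let ?g = "\<lambda>w v. (f w v, b y w)"
  from Cons.prems have "reaches \<beta> n (\<tau> y) f ?g" by (auto intro: reaches_keep)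
  then obtain P :: "(_, unit) protocol" and out where P: "bandwidth_bounded \<beta> n P"
    "\<And>w v. v < n \<Longrightarrow> out v (f w v) (view_after n (P :: ('a, unit) protocol) (f w) (\<tau> y) v) = ?g w v"
    by (rule reachesE) (rule that)
  have view: "view_after n Q' (?g w) r v = view_after n Q (f w) r v" for w r v
    by (rule view_after_cong) (simp add: Q'_def)
  have found: "outputs_within n Q' (?g w) 0 v True" if "b y w" for w v
    using that by (simp add: outputs_within_def Q'_def)
  have missed: "outputs_within n Q' (?g w) R v a = outputs_within n Q (f w) R v a" if "\<not> b y w" for w v R a
    using that unfolding outputs_within_def view by (simp add: Q'_def)
  have seq: "outputs_within n (sequential (\<tau> y) out P Q') (f w) (\<tau> y + R) v a"
    if "outputs_within n Q' (?g w) R v a" "v < n" for w v R a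
    by (rule outputs_sequential[where inp' = "?g w"]) (use that P in auto)
  show ?case
  proof (intro exI[of _ "sequential (\<tau> y) out P Q'"] conjI allI impI ballI)
    show "bandwidth_bounded \<beta> n (sequential (\<tau> y) out P Q')"
      using P Q by (intro bandwidth_sequential) (auto simp: bandwidth_bounded_def Q'_def)
  next
    fix w v z assume *: "v < n" "z \<in> set (y # ys)" "b z w"
    \<comment> \<open>The phases are sorted by cost, so the first one costs at most
      \<open>\<tau> z\<close> and pays for the additional term of
      \<open>length (y # ys) * \<tau> z\<close>.\<close>
    have le: "\<tau> y \<le> \<tau> z" using * Cons.prems(2) by auto
    have "\<exists>R. outputs_within n Q' (?g w) R v True \<and> R \<le> length ys * \<tau> z"
    proof (cases "b y w")
      case False
      with * Q missed show ?thesis by auto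
    qed (use found in auto)
    then obtain R where "outputs_within n Q' (?g w) R v True" "R \<le> length ys * \<tau> z" by blast
    then show "outputs_within n (sequential (\<tau> y) out P Q') (f w) (length (y # ys) * \<tau> z) v True"
      using seq[of w R v True] * le by (auto elim: outputs_within_mono)
  next
    fix w v assume *: "v < n" "\<forall>z\<in>set (y # ys). \<not> b z w"
    with Q missed have "outputs_within n Q' (?g w) (sum_list (map \<tau> ys)) v False" by auto
    then show "outputs_within n (sequential (\<tau> y) out P Q') (f w) (sum_list (map \<tau> (y # ys))) v False"
      using seq[of w _ v False] * by auto
  qed
qed

section \<open>Routing with publicly known demands\<close>

text \<open>Elements are coloured one after another; fewer than \<open>D\<close> conflicts always
  leave one of the \<open>D\<close> colours free.\<close>

lemma greedy_colouring:
  fixes conflict :: "'a \<Rightarrow> 'a \<Rightarrow> bool"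
  assumes "finite J" and sym: "\<And>i j. conflict i j \<Longrightarrow> conflict j i" and irr: "\<And>i. \<not> conflict i i"
    and deg: "\<And>j. j \<in> J \<Longrightarrow> card {i \<in> J. conflict i j} < D"
  shows "\<exists>\<kappa>. (\<forall>j\<in>J. \<kappa> j < D) \<and> (\<forall>i\<in>J. \<forall>j\<in>J. conflict i j \<longrightarrow> \<kappa> i \<noteq> (\<kappa> j :: nat))"
  using assms(1) deg
proof (induction J)
  case (insert x F)
  have "card {i \<in> F. conflict i j} < D" if "j \<in> F" for j
    by (rule le_less_trans[OF card_mono insert.prems[of j]]) (use insert.hyps that in auto)
  from insert.IH[OF this] obtain \<kappa> where \<kappa>: "\<forall>j\<in>F. \<kappa> j < D"
    "\<forall>i\<in>F. \<forall>j\<in>F. conflict i j \<longrightarrow> \<kappa> i \<noteq> (\<kappa> j :: nat)" by blast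
  let ?N = "{i \<in> F. conflict i x}"
  have "card (\<kappa> ` ?N) \<le> card {i \<in> insert x F. conflict i x}"
    by (rule order_trans[OF card_image_le card_mono]) (use insert.hyps in auto)
  also have "\<dots> < card {..<D}" using insert.prems[of x] by simp
  finally have "\<not> {..<D} \<subseteq> \<kappa> ` ?N"
    using card_mono[of "\<kappa> ` ?N" "{..<D}"] insert.hyps by fastforce
  then obtain c where c: "c < D" "c \<notin> \<kappa> ` ?N" by auto
  show ?case
  proof (intro exI[of _ "\<kappa>(x := c)"] conjI ballI impI)
    fix i j assume "i \<in> insert x F" "j \<in> insert x F" "conflict i j"
    then consider "i = x" "j \<in> F" "conflict j x" | "j = x" "i \<in> F" "conflict i x" |
        "i \<in> F" "j \<in> F" "conflict i j"
      using irr sym by blast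
    then show "(\<kappa>(x := c)) i \<noteq> (\<kappa>(x := c)) j"
    proof cases
      case 3
      with \<kappa> insert.hyps show ?thesis by auto
    qed (use c insert.hyps in auto)
  qed (use \<kappa> c in auto)
qed simp

text \<open>
  Messages sharing a source or a destination get different colours. A message of colour
  \<open>r * n + m\<close> travels via the intermediate vertex \<open>m\<close> and is sent in round \<open>r\<close> of both halves.
\<close>

lemma reaches_route:
  fixes src dst :: "'j \<Rightarrow> nat"
  assumes "\<beta> \<ge> 1" "n \<ge> 2" "finite J" and src: "\<And>j. j \<in> J \<Longrightarrow> src j < n"
    and out: "\<And>u. u < n \<Longrightarrow> card {j \<in> J. src j = u} \<le> \<Delta>"
    and "in": "\<And>v. v < n \<Longrightarrow> card {j \<in> J. dst j = v} \<le> \<Delta>"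
    and dst: "\<And>j. j \<in> J \<Longrightarrow> dst j < n"
    and T: "2 * \<Delta> \<le> n * T"
    and val: "\<And>w j. j \<in> J \<Longrightarrow> val w j = \<phi> j (f w (src j))"
  shows "reaches \<beta> n (2 * T) f (\<lambda>w v j. j \<in> J \<and> dst j = v \<and> val w j)"
proof -
  define conflict where "conflict i j \<longleftrightarrow> i \<noteq> j \<and> (src i = src j \<or> dst i = dst j)" for i j
  have "card {i \<in> J. conflict i j} < 2 * \<Delta>" if j: "j \<in> J" for j
  proof -
    let ?S = "{i \<in> J. src i = src j}" and ?D = "{i \<in> J. dst i = dst j}"
    have fin: "finite ?S" "finite ?D" using \<open>finite J\<close> by auto
    \<comment> \<open>Leaving out \<open>j\<close> itself on both sides makes the bound strict, as a
      colouring with \<open>2 * \<Delta>\<close> colours requires.\<close>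
    have "card {i \<in> J. conflict i j} \<le> card ((?S - {j}) \<union> (?D - {j}))"
      by (rule card_mono) (use fin in \<open>auto simp: conflict_def\<close>)
    also have "\<dots> \<le> card (?S - {j}) + card (?D - {j})" by (rule card_Un_le)
    also have "\<dots> < card ?S + card ?D"
      using j fin by (intro add_strict_mono psubset_card_mono) auto
    finally show ?thesis using out[OF src[OF j]] "in"[OF dst[OF j]] by linarith
  qed
  then have "\<exists>\<kappa>. (\<forall>j\<in>J. \<kappa> j < 2 * \<Delta>) \<and> (\<forall>i\<in>J. \<forall>j\<in>J. conflict i j \<longrightarrow> \<kappa> i \<noteq> (\<kappa> j :: nat))"
    by (intro greedy_colouring \<open>finite J\<close>) (auto simp: conflict_def)
  then obtain \<kappa> :: "'j \<Rightarrow> nat" where \<kappa>: "\<And>j. j \<in> J \<Longrightarrow> \<kappa> j < 2 * \<Delta>"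
    and "\<And>i j. i \<in> J \<Longrightarrow> j \<in> J \<Longrightarrow> conflict i j \<Longrightarrow> \<kappa> i \<noteq> \<kappa> j" by auto
  then have proper: "i = j" if "i \<in> J" "j \<in> J" "src i = src j \<or> dst i = dst j" "\<kappa> i = \<kappa> j" for i j
    using that unfolding conflict_def by blast
  have round: "\<kappa> j div n < T" if "j \<in> J" for j
    using \<kappa>[OF that] T by (simp add: less_mult_imp_div_less mult.commute)
  have colour: "\<kappa> j = \<kappa> j div n * n + \<kappa> j mod n" for j by simp
  \<comment> \<open>\<open>g1\<close> is the bit that \<open>m\<close> gets from \<open>u\<close> in
    round \<open>r\<close> of the first half, \<open>g2\<close> the bit that \<open>v\<close> gets
    from \<open>m\<close> in round \<open>r\<close> of the second half. Both are stated
    existentially; by properness at most one message is meant.\<close>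
  define g1 where "g1 w m r u \<longleftrightarrow> r < T \<and> u < n \<and>
    (\<exists>j\<in>J. src j = u \<and> \<kappa> j = r * n + m \<and> val w j)" for w m r u
  define g2 where "g2 w v r m \<longleftrightarrow> r < T \<and> m < n \<and>
    (\<exists>j\<in>J. dst j = v \<and> \<kappa> j = r * n + m \<and> g1 w m r (src j))" for w v r m
  have g2: "j \<in> J \<and> dst j = v \<and> val w j \<longleftrightarrow>
      j \<in> J \<and> dst j = v \<and> g2 w v (\<kappa> j div n) (\<kappa> j mod n)" for w v j
  proof -
    have "val w j \<longleftrightarrow> g2 w (dst j) (\<kappa> j div n) (\<kappa> j mod n)" if j: "j \<in> J"
    proof -
      have "\<kappa> j mod n < n" using \<open>n \<ge> 2\<close> by simp
      then have "g2 w (dst j) (\<kappa> j div n) (\<kappa> j mod n) \<longleftrightarrow>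
          (\<exists>i\<in>J. dst i = dst j \<and> \<kappa> i = \<kappa> j \<and> (\<exists>i'\<in>J. src i' = src i \<and> \<kappa> i' = \<kappa> j \<and> val w i'))"
        using round[OF j] src unfolding g1_def g2_def colour[symmetric] by blast
      also have "\<dots> \<longleftrightarrow> val w j" using j proper by blast
      finally show ?thesis ..
    qed
    then show ?thesis by auto
  qed
  have "reaches \<beta> n T f g1"
    by (rule reaches_local[OF reaches_exchange[OF assms(1,2), of T f
            "\<lambda>r u i m. \<exists>j\<in>J. src j = u \<and> \<kappa> j = r * n + m \<and> \<phi> j i"], where \<phi> = "\<lambda>_ _ x. x"])
       (auto simp: g1_def fun_eq_iff val)
  moreover have "reaches \<beta> n T g1 g2"
    by (rule reaches_local[OF reaches_exchange[OF assms(1,2), of T g1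
            "\<lambda>r m i v. \<exists>j\<in>J. dst j = v \<and> \<kappa> j = r * n + m \<and> i r (src j)"], where \<phi> = "\<lambda>_ _ x. x"])
       (auto simp: g2_def fun_eq_iff)
  ultimately have "reaches \<beta> n (T + T) f g2" by (rule reaches_trans)
  then show ?thesis
    unfolding mult_2
    by (rule reaches_local[where
          \<phi> = "\<lambda>v _ x j. j \<in> J \<and> dst j = v \<and> x (\<kappa> j div n) (\<kappa> j mod n)"])
       (use g2 in \<open>auto simp: fun_eq_iff\<close>)
qed

section \<open>Matrix products\<close>

definition owner :: "nat \<Rightarrow> nat \<Rightarrow> nat \<Rightarrow> nat \<Rightarrow> nat \<Rightarrow> nat \<Rightarrow> nat" where
  "owner n s d i a b = (let q = block_rows n s in
     ((i * q + middle_digit q d a) * q + middle_digit q d b) mod n)"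

lemma block_rows_pos: "block_rows n s > 0"
  by (simp add: block_rows_def)

lemma owner_label:
  assumes "i < s"
  shows "(i, middle_digit (block_rows n s) d a, middle_digit (block_rows n s) d b) \<in>
    labels_of n s v \<longleftrightarrow> owner n s d i a b = v"
  using assms block_rows_pos[of n s]
  by (auto simp: labels_of_def owner_def Let_def middle_digit_def)

lemma owner_less: "n > 0 \<Longrightarrow> owner n s d i a b < n"
  by (simp add: owner_def Let_def)

lemma product_input_cong:
  assumes "\<And>i. i < s \<Longrightarrow> S i = S' i \<and> T i = T' i"
  shows "product_input n s d S T v = product_input n s d S' T' v"
  using assms by (auto simp: product_input_def fun_eq_iff labels_of_def Let_def)

lemma product_output_cong:
  assumes "\<And>i. i < s \<Longrightarrow> S i = S' i \<and> T i = T' i"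
  shows "product_output n s d S T v = product_output n s d S' T' v"
  using assms by (auto simp: product_output_def fun_eq_iff labels_of_def Let_def)

text \<open>Each entry lies in a block of its owner, so all inputs together determine the matrices.
  After a full exchange of inputs every vertex can therefore compute the products by itself.\<close>

lemma product_input_inject:
  assumes "\<And>v. v < n \<Longrightarrow> product_input n s d S T v = product_input n s d S' T' v"
    and "S i \<in> carrier_mat k k" "T i \<in> carrier_mat k k" "S' i \<in> carrier_mat k k" "T' i \<in> carrier_mat k k"
    and "i < s" "n > 0"
  shows "S i = S' i \<and> T i = T' i"
proof -
  let ?q = "block_rows n s"
  have "S i $$ (a, b) = S' i $$ (a, b) \<and> T i $$ (a, b) = T' i $$ (a, b)" if "a < k" "b < k" for a b
  proof -
    let ?l = "(i, middle_digit ?q d a, middle_digit ?q d b)" and ?v = "owner n s d i a b"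
    have "?l \<in> labels_of n s ?v" using owner_label[OF \<open>i < s\<close>] by simp
    moreover have "product_input n s d S T ?v ?l = product_input n s d S' T' ?v ?l"
      using assms(1)[OF owner_less[OF \<open>n > 0\<close>]] by simp
    ultimately have "matrix_block ?q d (S i) (middle_digit ?q d a) (middle_digit ?q d b) (a, b) =
        matrix_block ?q d (S' i) (middle_digit ?q d a) (middle_digit ?q d b) (a, b) \<and>
        matrix_block ?q d (T i) (middle_digit ?q d a) (middle_digit ?q d b) (a, b) =
        matrix_block ?q d (T' i) (middle_digit ?q d a) (middle_digit ?q d b) (a, b)"
      by (simp add: product_input_def)
    then show ?thesis using assms(2-5) that by (simp add: matrix_block_def)
  qed
  then show ?thesis using assms(2-5) by (auto intro!: eq_matI)
qed

text \<open>Every vertex announces its input in unary.\<close>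

lemma reaches_all_inputs:
  fixes f :: "'w \<Rightarrow> nat \<Rightarrow> 'a"
  assumes "\<beta> \<ge> 1" "n \<ge> 2" and fin: "finite {f w u | w u. u < n}"
  shows "\<exists>R. reaches \<beta> n R f (\<lambda>w v u. if u < n then f w u else undefined)"
proof -
  from finite_imp_inj_to_nat_seg[OF fin] obtain T code where
    code: "code ` {f w u | w u. u < n} = {i :: nat. i < T}" "inj_on code {f w u | w u. u < n}"
    by blast
  then have T: "code (f w u) < T" if "u < n" for w u using that by blast
  have decode: "inv_into {f w u | w u. u < n} code (code (f w u)) = f w u" if "u < n" for w u
    by (rule inv_into_f_f) (use that code in auto)
  have the_code: "(THE r. r < T \<and> r = code (f w u)) = code (f w u)" if "u < n" for w u
    by (rule the_equality) (use T that in auto)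
  have "reaches \<beta> n T f (\<lambda>w v u. if u < n then f w u else undefined)"
    by (rule reaches_local[OF reaches_exchange[OF assms(1,2), of T f "\<lambda>r u i v. r = code i"],
          where \<phi> = "\<lambda>v _ x u. if u < n then inv_into {f w u | w u. u < n} code (THE r. x r u) else undefined"])
       (simp add: fun_eq_iff decode the_code)
  then show ?thesis by blast
qed

text \<open>Only the first \<open>s\<close> matrices occur in an input and their entries are
  bounded, so a finite table of integers describes them. Announcing inputs in unary relies on
  this.\<close>

lemma finite_product_inputs:
  "finite {product_input n s d S T v | S T v.
     v < n \<and> (\<forall>i. small_matrix \<alpha> n k (S i) \<and> small_matrix \<alpha> n k (T i))}" (is "finite ?I")
proof -
  define A where "A = ({..<s} \<times> {..<k} \<times> {..<k}) \<rightarrow>\<^sub>E {x. \<bar>x\<bar> \<le> int n ^ \<alpha>}"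
  define M where "M e i = mat k k (\<lambda>(a, b). e (i, a, b))" for e :: "nat \<times> nat \<times> nat \<Rightarrow> int" and i
  have M: "\<exists>e\<in>A. \<forall>i<s. M e i = S i" if S: "\<forall>i. small_matrix \<alpha> n k (S i)" for S
  proof
    let ?e = "restrict (\<lambda>(i, a, b). S i $$ (a, b)) ({..<s} \<times> {..<k} \<times> {..<k})"
    have "dim_row (S i) = k" "dim_col (S i) = k" for i
      using S by (auto simp: small_matrix_def)
    then show "\<forall>i<s. M ?e i = S i"
      by (auto simp: M_def intro!: eq_matI)
    show "?e \<in> A"
      using S by (auto simp: A_def small_matrix_def )
  qed
  have "?I \<subseteq> (\<lambda>(e, e', v). product_input n s d (M e) (M e') v) ` (A \<times> A \<times> {..<n})"
  proof
    fix x assume "x \<in> ?I"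
    then obtain S T v where x: "x = product_input n s d S T v" "v < n"
      and small: "\<forall>i. small_matrix \<alpha> n k (S i)" "\<forall>i. small_matrix \<alpha> n k (T i)" by blast
    from M[OF small(1)] M[OF small(2)] obtain e e' where
      e: "e \<in> A" "e' \<in> A" "\<forall>i<s. M e i = S i" "\<forall>i<s. M e' i = T i" by blast
    then have "x = product_input n s d (M e) (M e') v"
      unfolding x by (intro product_input_cong) auto
    then show "x \<in> (\<lambda>(e, e', v). product_input n s d (M e) (M e') v) ` (A \<times> A \<times> {..<n})"
      using e x(2) by (intro image_eqI[of _ _ "(e, e', v)"]) auto
  qed
  moreover have "finite {x. \<bar>x\<bar> \<le> int n ^ \<alpha>}"
    by (rule finite_subset[of _ "{- (int n ^ \<alpha>)..int n ^ \<alpha>}"]) auto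
  then have "finite (A \<times> A \<times> {..<n})"
    unfolding A_def by (intro finite_cartesian_product finite_PiE) auto
  ultimately show ?thesis by (meson finite_imageI finite_subset)
qed

text \<open>Ensures that the \<open>LEAST\<close> in \<open>MM\<close> is attained: every vertex
  learns all inputs, however slowly.\<close>

lemma products_computable_exists:
  assumes "\<beta> \<ge> 1" "n \<ge> 2"
  shows "\<exists>R. products_computable \<beta> \<alpha> n k s R"
proof -
  \<comment> \<open>\<open>reaches\<close> speaks about all worlds, so matrices out of range are
    replaced by the zero matrix; those in range are unchanged.\<close>
  define clamp where "clamp S i = (if small_matrix \<alpha> n k (S i) then S i else 0\<^sub>m k k)"
    for S :: "nat \<Rightarrow> int mat" and i
  have small: "small_matrix \<alpha> n k (clamp S i)" for S i
    by (auto simp: clamp_def small_matrix_def)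
  define f where "f = (\<lambda>(S, T). product_input n s 1 (clamp S) (clamp T))"
  define g where "g = (\<lambda>(S, T). product_output n s 1 (clamp S) (clamp T))"
  have "{f w u | w u. u < n} \<subseteq> {product_input n s 1 S T v | S T v.
     v < n \<and> (\<forall>i. small_matrix \<alpha> n k (S i) \<and> small_matrix \<alpha> n k (T i))}"
    using small by (auto simp: f_def split: prod.splits) blast
  then have "finite {f w u | w u. u < n}"
    using finite_product_inputs by (rule finite_subset)
  from reaches_all_inputs[OF assms this] obtain R where
    R: "reaches \<beta> n R f (\<lambda>w v u. if u < n then f w u else undefined)" (is "reaches _ _ _ _ ?k") by blast
  \<comment> \<open>The output can be computed from any world compatible with the received inputs,
    because these determine the matrices.\<close>
  have "g w v = g (SOME w'. ?k w' v = ?k w v) v" for w v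
  proof -
    define w' where "w' = (SOME w'. ?k w' v = ?k w v)"
    have "?k w' v = ?k w v" unfolding w'_def by (rule someI) (rule refl)
    then have eq: "f w' u = f w u" if "u < n" for u using that by (metis (no_types, lifting))
    obtain S T S' T' where ST: "w = (S, T)" "w' = (S', T')" by (meson surj_pair)
    have "product_output n s 1 (clamp S) (clamp T) v = product_output n s 1 (clamp S') (clamp T') v"
    proof (rule product_output_cong, rule product_input_inject)
      show "product_input n s 1 (clamp S) (clamp T) v = product_input n s 1 (clamp S') (clamp T') v"
        if "v < n" for v using eq[OF that] by (simp add: f_def ST)
    qed (use small assms(2) in \<open>auto simp: small_matrix_def\<close>)
    then have "g w v = g w' v" unfolding ST by (simp add: g_def)
    then show ?thesis unfolding w'_def .
  qed
  then have "reaches \<beta> n R f g"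
    by (intro reaches_local[OF R, where \<phi> = "\<lambda>v _ x. g (SOME w'. ?k w' v = x) v"]) auto
  then obtain P :: "(_, unit) protocol" and out where P: "bandwidth_bounded \<beta> n P"
    "\<And>w v. v < n \<Longrightarrow> out v (f w v) (view_after n P (f w) R v) = g w v"
    by (rule reachesE) (rule that)
  let ?P = "\<lparr>send = send P, decide = \<lambda>v i w. if length w = R then Some (out v i w) else None\<rparr>"
  have view: "view_after n ?P inp r v = view_after n P inp r v" for inp r v
    by (rule view_after_cong) simp
  show ?thesis unfolding products_computable_def
  proof (rule exI[of _ R], rule exI[of _ 1], rule exI[of _ ?P], intro conjI allI impI)
    show "bandwidth_bounded \<beta> n ?P" using P(1) by (simp add: bandwidth_bounded_def)
  next
    fix S T v assume "\<forall>i<s. small_matrix \<alpha> n k (S i) \<and> small_matrix \<alpha> n k (T i)" and "v < n"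
    then have clamp: "\<And>i. i < s \<Longrightarrow> S i = clamp S i \<and> T i = clamp T i" by (simp add: clamp_def)
    have f: "product_input n s 1 S T = f (S, T)"
      unfolding f_def using product_input_cong[OF clamp] by auto
    have g: "product_output n s 1 S T = g (S, T)"
      unfolding g_def using product_output_cong[OF clamp] by auto
    show "outputs_within n ?P (product_input n s 1 S T) R v (product_output n s 1 S T v)"
      unfolding outputs_within_def view f g using P(2)[OF \<open>v < n\<close>, of "(S, T)"]
      by (intro exI[of _ R]) auto
  qed auto
qed

text \<open>What \<open>v\<close> holds of a family of Boolean matrices, extended by False to the
  positions of other owners; the knowledge of a vertex is then a plain predicate on
  positions.\<close>

definition share ::
    "nat \<Rightarrow> nat \<Rightarrow> nat \<Rightarrow> nat \<Rightarrow> (nat \<Rightarrow> nat \<Rightarrow> nat \<Rightarrow> bool) \<Rightarrow> nat \<Rightarrow> nat \<Rightarrow> nat \<Rightarrow> nat \<Rightarrow> bool" where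
  "share n k s d M v i a b \<longleftrightarrow> i < s \<and> a < k \<and> b < k \<and> owner n s d i a b = v \<and> M i a b"

definition products_within :: "nat \<Rightarrow> nat \<Rightarrow> nat \<Rightarrow> nat \<Rightarrow> nat \<Rightarrow> nat \<Rightarrow> bool" where
  "products_within \<beta> n k s d R \<longleftrightarrow> (\<forall>M M' :: (nat \<times> nat) set \<Rightarrow> nat \<Rightarrow> nat \<Rightarrow> nat \<Rightarrow> bool.
     reaches \<beta> n R (\<lambda>w v. (share n k s d (M w) v, share n k s d (M' w) v))
       (\<lambda>w. share n k s d (\<lambda>i a b. \<exists>c<k. M w i a c \<and> M' w i c b)))"

text \<open>An integer product of 0-1 matrices counts the indices \<open>c\<close>, so it is nonzero
  exactly where the Boolean product holds. Entries 0 and 1 respect the size bound for every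
  \<open>\<alpha>\<close>.\<close>

lemma products_within:
  assumes "products_computable \<beta> \<alpha> n k s R" "n > 0"
  obtains d where "1 \<le> d" "d \<le> max 1 (k div block_rows n s)" "products_within \<beta> n k s d R"
proof -
  from assms(1) obtain d and P :: "(label \<Rightarrow> (block \<times> block) option, label \<Rightarrow> block option) protocol"
    where d: "1 \<le> d" "d \<le> max 1 (k div block_rows n s)"
    and P: "bandwidth_bounded \<beta> n P"
      "\<And>S T v. \<forall>i<s. small_matrix \<alpha> n k (S i) \<and> small_matrix \<alpha> n k (T i) \<Longrightarrow> v < n \<Longrightarrow>
        outputs_within n P (product_input n s d S T) R v (product_output n s d S T v)"
    unfolding products_computable_def by blast
  let ?q = "block_rows n s"
  have "reaches \<beta> n R (\<lambda>w v. (share n k s d (M w) v, share n k s d (M' w) v))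
       (\<lambda>w. share n k s d (\<lambda>i a b. \<exists>c<k. M w i a c \<and> M' w i c b))"
    for M M' :: "(nat \<times> nat) set \<Rightarrow> nat \<Rightarrow> nat \<Rightarrow> nat \<Rightarrow> bool"
  proof -
    define mat_of where "mat_of X i = mat k k (\<lambda>(a, b). of_bool (X i a b) :: int)"
      for X :: "nat \<Rightarrow> nat \<Rightarrow> nat \<Rightarrow> bool" and i
    have small: "small_matrix \<alpha> n k (mat_of X i)" for X i
      using \<open>n > 0\<close> by (auto simp: mat_of_def small_matrix_def)
    define f where "f w = product_input n s d (mat_of (M w)) (mat_of (M' w))" for w
    define g where "g w = product_output n s d (mat_of (M w)) (mat_of (M' w))" for w
    let ?blk = "\<lambda>X i x y. \<lambda>(a, b). if a < k \<and> b < k \<and> middle_digit ?q d a = x \<and>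
            middle_digit ?q d b = y then Some (of_bool (X i a b)) else None"
    have f: "f w v = (\<lambda>(i, x, y). if (i, x, y) \<in> labels_of n s v
        then Some (?blk (share n k s d (M w) v) i x y, ?blk (share n k s d (M' w) v) i x y) else None)"
      for w v
    proof -
      have "i < s" "owner n s d i a b = v"
        if "(i, middle_digit ?q d a, middle_digit ?q d b) \<in> labels_of n s v" for i a b
      proof -
        show "i < s" using that by (auto simp: labels_of_def Let_def)
        then show "owner n s d i a b = v" using that owner_label by blast
      qed
      then show ?thesis
        by (auto simp: f_def product_input_def matrix_block_def mat_of_def share_def fun_eq_iff)
    qed
    have g: "share n k s d (\<lambda>i a b. \<exists>c<k. M w i a c \<and> M' w i c b) v i a b \<longleftrightarrow>
        i < s \<and> a < k \<and> b < k \<and> owner n s d i a b = v \<and>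
        the (the (g w v (i, middle_digit ?q d a, middle_digit ?q d b)) (a, b)) \<noteq> 0" for w v i a b
    proof (cases "i < s \<and> a < k \<and> b < k \<and> owner n s d i a b = v")
      case True
      then have "the (the (g w v (i, middle_digit ?q d a, middle_digit ?q d b)) (a, b)) =
          (mat_of (M w) i * mat_of (M' w) i) $$ (a, b)"
        using owner_label[of i s n d a b v] by (simp add: g_def product_output_def matrix_block_def mat_of_def)
      also have "\<dots> \<noteq> 0 \<longleftrightarrow> (\<exists>c<k. M w i a c \<and> M' w i c b)"
        using True by (auto simp: mat_of_def scalar_prod_def card_eq_0_iff)
      finally show ?thesis using True by (simp add: share_def)
    qed (auto simp: share_def)
    \<comment> \<open>Vertices may answer in different rounds. As earlier views are prefixes of
      later ones, each vertex can replay them after \<open>R\<close> rounds and find its first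
      answer.\<close>
    define first where "first v i w = (LEAST r. decide P v i (take r w) \<noteq> None)" for v i w
    have "reaches \<beta> n R f g"
      unfolding reaches_def
    proof (intro exI[of _ "\<lparr>send = send P, decide = \<lambda>_ _ _. None\<rparr>"]
        exI[of _ "\<lambda>v i w. the (decide P v i (take (first v i w) w))"] conjI allI impI)
      show "bandwidth_bounded \<beta> n (\<lparr>send = send P, decide = \<lambda>_ _ _. None\<rparr> ::
        (label \<Rightarrow> (block \<times> block) option, unit) protocol)"
        using P(1) by (simp add: bandwidth_bounded_def)
    next
      fix w v assume "v < n"
      have view: "view_after n \<lparr>send = send P, decide = \<lambda>_ _ _. None :: unit option\<rparr> (f w) R v =
          view_after n P (f w) R v" (is "?V = ?W")
        by (rule view_after_cong) simp
      from P(2)[of "mat_of (M w)" "mat_of (M' w)", OF _ \<open>v < n\<close>] small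
      obtain r where r: "r \<le> R" "decide P v (f w v) (view_after n P (f w) r v) = Some (g w v)"
        "\<And>r'. r' < r \<Longrightarrow> decide P v (f w v) (view_after n P (f w) r' v) = None"
        unfolding outputs_within_def f_def g_def by blast
      have "first v (f w v) ?W = r"
        unfolding first_def
      proof (rule Least_equality)
        show "decide P v (f w v) (take r ?W) \<noteq> None"
          using r by (simp add: take_view_after)
        fix r' assume *: "decide P v (f w v) (take r' ?W) \<noteq> None"
        show "r \<le> r'"
        proof (rule ccontr)
          assume "\<not> r \<le> r'"
          with r(1) r(3)[of r'] * show False by (simp add: take_view_after)
        qed
      qed
      then show "the (decide P v (f w v) (take (first v (f w v) ?V) ?V)) = g w v"
        unfolding view using r by (simp add: take_view_after)
    qed
    then have "reaches \<beta> n R (\<lambda>w v. (share n k s d (M w) v, share n k s d (M' w) v)) g"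
      by (rule reaches_compose[where \<phi> = "\<lambda>v (X, X') (i, x, y). if (i, x, y) \<in> labels_of n s v
        then Some (?blk X i x y, ?blk X' i x y) else None"]) (simp add: f)
    then show ?thesis
      by (rule reaches_local[where \<phi> = "\<lambda>v _ x i a b. i < s \<and> a < k \<and> b < k \<and> owner n s d i a b = v \<and>
        the (the (x (i, middle_digit ?q d a, middle_digit ?q d b)) (a, b)) \<noteq> 0"])
        (simp add: g fun_eq_iff)
  qed
  with d that show ?thesis unfolding products_within_def by blast
qed

subsection \<open>Balance of the labels\<close>

text \<open>For a fixed middle digit, an index is determined by its leading part and its last digit.
  The bound on \<open>d\<close> limits the last digits to about \<open>k div q\<close>, so rounding
  cannot inflate a block by more than a constant factor.\<close>

lemma card_middle_digit:
  assumes "q > 0" "1 \<le> d" "d \<le> max 1 (k div q)"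
  shows "card {a. a < k \<and> middle_digit q d a = x} \<le> 2 * (k div q) + 1"
proof -
  let ?S = "{a. a < k \<and> middle_digit q d a = x}"
  have "inj_on (\<lambda>a. (a div (d * q), a mod d)) ?S"
  proof (rule inj_onI)
    fix a b assume *: "a \<in> ?S" "b \<in> ?S" "(a div (d * q), a mod d) = (b div (d * q), b mod d)"
    then have "a div d div q = b div d div q" "a div d mod q = b div d mod q"
      by (auto simp: div_mult2_eq middle_digit_def)
    then have "a div d = b div d" by (metis div_mult_mod_eq)
    with * show "a = b" by (metis div_mult_mod_eq prod.inject)
  qed
  moreover have "(\<lambda>a. (a div (d * q), a mod d)) ` ?S \<subseteq> {..k div (d * q)} \<times> {..<d}"
    using assms by (auto intro!: div_le_mono)
  ultimately have "card ?S \<le> card ({..k div (d * q)} \<times> {..<d})"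
    by (intro card_inj_on_le) auto
  also have "\<dots> = k div q div d * d + d"
    by (simp add: div_mult2_eq[symmetric] mult.commute)
  also have "\<dots> \<le> k div q + max 1 (k div q)" using assms by (intro add_mono) auto
  finally show ?thesis by simp
qed

text \<open>The labels of \<open>v\<close> are numbered by integers congruent to \<open>v\<close>
  modulo \<open>n\<close>. Hence they are separated by the quotients, which range up to
  \<open>s * q * q div n\<close>.\<close>

lemma labels_of_bound:
  assumes "n > 0" and q: "q = block_rows n s"
  shows "finite (labels_of n s v)" "card (labels_of n s v) \<le> s * q * q div n + 1"
proof -
  have "q > 0" using block_rows_pos q by simp
  define index where "index = (\<lambda>(i, x, y). (i * q + x) * q + y)"
  have "labels_of n s v \<subseteq> {..<s} \<times> {..<q} \<times> {..<q}"
    by (auto simp: labels_of_def Let_def q)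
  then show "finite (labels_of n s v)" by (rule finite_subset) simp
  have "inj_on (\<lambda>l. index l div n) (labels_of n s v)"
  proof (rule inj_onI)
    fix l l' assume l: "l \<in> labels_of n s v" "l' \<in> labels_of n s v" "index l div n = index l' div n"
    then have "index l mod n = index l' mod n" by (auto simp: labels_of_def index_def Let_def q)
    with l(3) have eq: "index l = index l'" by (metis div_mult_mod_eq)
    obtain i x y i' x' y' where ll: "l = (i, x, y)" "l' = (i', x', y')" by (metis prod_cases3)
    with l have less: "x < q" "y < q" "x' < q" "y' < q" by (auto simp: labels_of_def Let_def q)
    have "y = y'" "i * q + x = i' * q + x'"
      using arg_cong[OF eq, of "\<lambda>m. m mod q"] arg_cong[OF eq, of "\<lambda>m. m div q"] less
      by (auto simp: ll index_def)
    moreover from this(2) have "x = x'" "i = i'"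
      using arg_cong[of _ _ "\<lambda>m. m mod q"] arg_cong[of _ _ "\<lambda>m. m div q"] less
      by (metis mod_less mod_mult_self3, metis add.right_neutral div_less div_mult_self3 \<open>q > 0\<close> less_not_refl)
    ultimately show "l = l'" by (simp add: ll)
  qed
  moreover have "(\<lambda>l. index l div n) ` labels_of n s v \<subseteq> {..s * q * q div n}"
  proof
    fix m assume "m \<in> (\<lambda>l. index l div n) ` labels_of n s v"
    then obtain i x y where m: "m = ((i * q + x) * q + y) div n" "i < s" "x < q" "y < q"
      by (auto simp: labels_of_def Let_def index_def q)
    have "(i * q + x) * q + y \<le> (i * q + x) * q + q" using m by simp
    also have "\<dots> = (i * q + Suc x) * q" by (simp add: algebra_simps)
    also have "\<dots> \<le> (i * q + q) * q" using m by (intro mult_le_mono1 add_le_mono) auto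
    also have "\<dots> = Suc i * q * q" by (simp add: algebra_simps)
    also have "\<dots> \<le> s * q * q" using m by (intro mult_le_mono1) auto
    finally show "m \<in> {..s * q * q div n}" unfolding m by (simp add: div_le_mono)
  qed
  ultimately have "card (labels_of n s v) \<le> card {..s * q * q div n}"
    by (intro card_inj_on_le) auto
  then show "card (labels_of n s v) \<le> s * q * q div n + 1" by simp
qed

text \<open>Rounding down a number that is at least 1 loses at most a factor of 2, hence a factor of
  4 in the square.\<close>

lemma block_rows_bounds:
  assumes "1 \<le> s" "s \<le> n"
  shows "s * block_rows n s * block_rows n s \<le> n" "n \<le> 4 * (s * block_rows n s * block_rows n s)"
proof -
  define y where "y = sqrt (real n / real s)"
  define q where "q = block_rows n s"
  have "1 \<le> y" using assms by (simp add: y_def)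
  then have "1 \<le> nat \<lfloor>y\<rfloor>" by linarith
  then have "q = nat \<lfloor>y\<rfloor>" by (simp add: q_def block_rows_def y_def[symmetric] max_absorb2)
  with \<open>1 \<le> y\<close> have q: "real q = real_of_int \<lfloor>y\<rfloor>" by simp
  have "1 \<le> real q" using \<open>1 \<le> nat \<lfloor>y\<rfloor>\<close> \<open>q = nat \<lfloor>y\<rfloor>\<close> by simp
  with q have "real q \<le> y" "y \<le> 2 * real q" by linarith+
  then have "real q * real q \<le> y * y" "y * y \<le> (2 * real q) * (2 * real q)"
    using \<open>1 \<le> y\<close> by (intro mult_mono; simp)+
  moreover have "y * y = real n / real s" by (simp add: y_def)
  ultimately have "real s * (real q * real q) \<le> n" "n \<le> 4 * (real s * (real q * real q))"
    using assms by (auto simp: field_simps)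
  then have "real (s * q * q) \<le> real n" "real n \<le> real (4 * (s * q * q))" by (simp_all add: mult.assoc)
  then show "s * block_rows n s * block_rows n s \<le> n" "n \<le> 4 * (s * block_rows n s * block_rows n s)"
    unfolding q_def of_nat_le_iff .
qed

text \<open>Up to rounding, a vertex has \<open>s * q * q / n\<close> labels with
  \<open>k / q\<close> rows and columns each, in total \<open>s * k\<^sup>2 / n \<le> C * n\<close>
  entries. For \<open>s \<le> n\<close> there are at most 2 labels per vertex, and with
  \<open>K = k div q\<close> a block has at most \<open>8 * K\<^sup>2 + 2 \<le> 34 * C * n\<close>
  entries, whence \<open>68\<close>. For \<open>s > n\<close> each matrix is a single block.\<close>

lemma owner_load:
  assumes "n > 0" "1 \<le> k" "1 \<le> s" "s * k\<^sup>2 \<le> C * n\<^sup>2" "1 \<le> C"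
    and d: "1 \<le> d" "d \<le> max 1 (k div block_rows n s)"
  shows "card {(i, a, b). i < s \<and> a < k \<and> b < k \<and> owner n s d i a b = v} \<le> 68 * C * n"
proof -
  define q where "q = block_rows n s"
  have "q > 0" using block_rows_pos by (simp add: q_def)
  define A where "A x = {a. a < k \<and> middle_digit q d a = x}" for x
  define K where "K = k div q"
  have A: "finite (A x)" "card (A x) \<le> 2 * K + 1" for x
    using card_middle_digit[OF \<open>q > 0\<close>, of d k x] d by (auto simp: A_def q_def K_def)
  let ?B = "\<lambda>(i, x, y). {i} \<times> A x \<times> A y"
  have "{(i, a, b). i < s \<and> a < k \<and> b < k \<and> owner n s d i a b = v} \<subseteq> (\<Union>l\<in>labels_of n s v. ?B l)"
  proof clarify
    fix i a b assume *: "i < s" "a < k" "b < k" "v = owner n s d i a b"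
    then have "(i, middle_digit q d a, middle_digit q d b) \<in> labels_of n s v"
      using owner_label by (simp add: q_def)
    then show "(i, a, b) \<in> (\<Union>l\<in>labels_of n s (owner n s d i a b). ?B l)"
      using * by (auto simp: A_def intro!: bexI[of _ "(i, middle_digit q d a, middle_digit q d b)"])
  qed
  moreover have "finite (\<Union>l\<in>labels_of n s v. ?B l)"
    using labels_of_bound[OF \<open>n > 0\<close> q_def] A by auto
  ultimately have "card {(i, a, b). i < s \<and> a < k \<and> b < k \<and> owner n s d i a b = v}
      \<le> card (\<Union>l\<in>labels_of n s v. ?B l)" by (simp add: card_mono)
  also have "\<dots> \<le> (\<Sum>l\<in>labels_of n s v. card (?B l))"
    using labels_of_bound[OF \<open>n > 0\<close> q_def] by (intro card_UN_le) auto
  also have "\<dots> \<le> (\<Sum>l\<in>labels_of n s v. (2 * K + 1) * (2 * K + 1))"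
  proof (rule sum_mono)
    fix l :: label
    obtain i x y where "l = (i, x, y)" by (metis prod_cases3)
    then show "card (?B l) \<le> (2 * K + 1) * (2 * K + 1)"
      using mult_le_mono[OF A(2)[of x] A(2)[of y]] by (simp add: card_cartesian_product)
  qed
  also have "\<dots> \<le> (s * q * q div n + 1) * ((2 * K + 1) * (2 * K + 1))"
    using labels_of_bound(2)[OF \<open>n > 0\<close> q_def, of v] by (simp only: sum_constant of_nat_id mult_le_mono1)
  also have "\<dots> \<le> 68 * C * n"
  proof (cases "s \<le> n")
    case True
    note q = block_rows_bounds[OF assms(3) True, folded q_def]
    have "s * q * q div n \<le> 1" using q(1) \<open>n > 0\<close> by (metis div_le_mono div_self less_not_refl)
    have "K * q \<le> k" by (simp add: K_def)
    have "n * (K * K) \<le> 4 * (s * q * q) * (K * K)" using q(2) by (intro mult_le_mono1)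
    also have "\<dots> = 4 * (s * ((K * q) * (K * q)))" by (simp add: algebra_simps)
    also have "\<dots> \<le> 4 * (s * (k * k))" using \<open>K * q \<le> k\<close> by (intro mult_le_mono order_refl)
    also have "\<dots> \<le> n * (4 * C * n)" using assms(4) by (simp add: power2_eq_square algebra_simps)
    finally have K: "K * K \<le> 4 * C * n" using \<open>n > 0\<close> by simp
    have "4 * K \<le> 4 * (K * K) + 1" by (cases K) (auto simp: algebra_simps)
    moreover have "(2 * K + 1) * (2 * K + 1) = 4 * (K * K) + 4 * K + 1" by (simp add: algebra_simps)
    ultimately have "(2 * K + 1) * (2 * K + 1) \<le> 8 * (4 * C * n) + 2" using K by linarith
    moreover have "1 \<le> C * n" using assms by simp
    ultimately have "(2 * K + 1) * (2 * K + 1) \<le> 34 * (C * n)" by linarith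
    then have "(s * q * q div n + 1) * ((2 * K + 1) * (2 * K + 1)) \<le> 2 * (34 * (C * n))"
      using \<open>s * q * q div n \<le> 1\<close> by (intro mult_le_mono[of _ 2]) (simp, assumption)
    then show ?thesis by simp
  next
    case False
    then have "sqrt (real n / real s) < 1" by simp
    moreover have "0 \<le> sqrt (real n / real s)" by simp
    ultimately have "\<lfloor>sqrt (real n / real s)\<rfloor> = 0" by linarith
    then have "q = 1" by (simp add: q_def block_rows_def)
    have "1 \<le> s div n" using False \<open>n > 0\<close> by (simp add: Suc_le_eq div_greater_zero_iff)
    have "n * ((s div n + 1) * ((2 * k + 1) * (2 * k + 1))) \<le> n * ((2 * (s div n)) * ((3 * k) * (3 * k)))"
      using \<open>1 \<le> s div n\<close> \<open>1 \<le> k\<close> by (intro mult_le_mono order_refl) auto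
    also have "\<dots> = 18 * ((s div n * n) * (k * k))" by (simp add: algebra_simps)
    also have "\<dots> \<le> 18 * (s * (k * k))" by (intro mult_le_mono order_refl) simp
    also have "\<dots> \<le> n * (18 * C * n)" using assms(4) by (simp add: power2_eq_square algebra_simps)
    finally have "(s div n + 1) * ((2 * k + 1) * (2 * k + 1)) \<le> 18 * C * n"
      using nat_mult_le_cancel1[OF \<open>n > 0\<close>] by blast
    then show ?thesis by (simp add: \<open>q = 1\<close> K_def)
  qed
  finally show ?thesis .
qed

section \<open>Searching one batch of samples\<close>

text \<open>Cycles with a starting point and a direction, the same notion for directed and
  undirected graphs; samples hit sequences position by position.\<close>

definition cycle_sequences :: "nat \<Rightarrow> (nat \<times> nat) set \<Rightarrow> nat list set" where
  "cycle_sequences h E = {vs. length vs = h \<and> distinct vs \<and> closed_walk_edges vs \<subseteq> E}"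

text \<open>
  Sample \<open>i\<close> consists of the colouring \<open>\<gamma> i\<close> of the vertices and of one vertex \<open>V i c a\<close> for every
  colour \<open>c < h\<close> and every \<open>a < k\<close>; vertices sampled for a colour other than their own are ignored,
  so that every closed walk through the \<open>h\<close> colours is a cycle.
\<close>

definition layer ::
    "nat \<Rightarrow> (nat \<Rightarrow> nat \<Rightarrow> nat) \<Rightarrow> (nat \<Rightarrow> nat \<Rightarrow> nat \<Rightarrow> nat) \<Rightarrow>
     nat \<Rightarrow> (nat \<times> nat) set \<Rightarrow> nat \<Rightarrow> nat \<Rightarrow> nat \<Rightarrow> bool" where
  "layer h \<gamma> V c E i a b \<longleftrightarrow>
     (if Suc c = h
      then \<gamma> i (V i 0 a) = 0 \<and> \<gamma> i (V i c b) = c \<and> (V i c b, V i 0 a) \<in> E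
      else \<gamma> i (V i c a) = c \<and> \<gamma> i (V i (Suc c) b) = Suc c \<and> (V i c a, V i (Suc c) b) \<in> E)"

primrec chain ::
    "nat \<Rightarrow> nat \<Rightarrow> (nat \<Rightarrow> nat \<Rightarrow> nat) \<Rightarrow> (nat \<Rightarrow> nat \<Rightarrow> nat \<Rightarrow> nat) \<Rightarrow>
     nat \<Rightarrow> (nat \<times> nat) set \<Rightarrow> nat \<Rightarrow> nat \<Rightarrow> nat \<Rightarrow> bool" where
  "chain h k \<gamma> V 0 E i a b = layer h \<gamma> V 0 E i a b"
| "chain h k \<gamma> V (Suc c) E i a b \<longleftrightarrow>
     (\<exists>x<k. chain h k \<gamma> V c E i a x \<and> layer h \<gamma> V (Suc c) E i x b)"

definition sample_hits ::
    "nat \<Rightarrow> nat \<Rightarrow> (nat \<Rightarrow> nat \<Rightarrow> nat) \<Rightarrow> (nat \<Rightarrow> nat \<Rightarrow> nat \<Rightarrow> nat) \<Rightarrow> (nat \<times> nat) set \<Rightarrow> nat \<Rightarrow> bool" where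
  "sample_hits h k \<gamma> V E i \<longleftrightarrow>
     (\<exists>vs\<in>cycle_sequences h E. \<forall>c<h. vs ! c \<in> V i c ` {..<k} \<and> \<gamma> i (vs ! c) = c)"

lemma chain_iff:
  assumes "Suc c < h"
  shows "chain h k \<gamma> V c E i a b \<longleftrightarrow>
    (\<exists>f. f 0 = a \<and> f (Suc c) = b \<and> (\<forall>j. 0 < j \<and> j \<le> c \<longrightarrow> f j < k) \<and>
         (\<forall>j\<le>c. layer h \<gamma> V j E i (f j) (f (Suc j))))"
  using assms
proof (induction c arbitrary: b)
  case 0
  show ?case
  proof
    assume "chain h k \<gamma> V 0 E i a b"
    then show "\<exists>f. f 0 = a \<and> f (Suc 0) = b \<and> (\<forall>j. 0 < j \<and> j \<le> 0 \<longrightarrow> f j < k) \<and>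
        (\<forall>j\<le>0. layer h \<gamma> V j E i (f j) (f (Suc j)))"
      by (intro exI[of _ "\<lambda>j. if j = 0 then a else b"]) auto
  qed auto
next
  case (Suc c)
  show ?case
  proof
    assume "chain h k \<gamma> V (Suc c) E i a b"
    then obtain x f where "x < k" and layer: "layer h \<gamma> V (Suc c) E i x b"
      and f: "f 0 = a" "f (Suc c) = x" "\<forall>j. 0 < j \<and> j \<le> c \<longrightarrow> f j < k"
        "\<forall>j\<le>c. layer h \<gamma> V j E i (f j) (f (Suc j))"
      using Suc by auto
    then show "\<exists>f. f 0 = a \<and> f (Suc (Suc c)) = b \<and> (\<forall>j. 0 < j \<and> j \<le> Suc c \<longrightarrow> f j < k) \<and>
        (\<forall>j\<le>Suc c. layer h \<gamma> V j E i (f j) (f (Suc j)))"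
      by (intro exI[of _ "f(Suc (Suc c) := b)"]) (auto simp: le_Suc_eq)
  next
    assume "\<exists>f. f 0 = a \<and> f (Suc (Suc c)) = b \<and> (\<forall>j. 0 < j \<and> j \<le> Suc c \<longrightarrow> f j < k) \<and>
        (\<forall>j\<le>Suc c. layer h \<gamma> V j E i (f j) (f (Suc j)))"
    then obtain f where f: "f 0 = a" "f (Suc (Suc c)) = b" "\<forall>j. 0 < j \<and> j \<le> Suc c \<longrightarrow> f j < k"
        "\<forall>j\<le>Suc c. layer h \<gamma> V j E i (f j) (f (Suc j))" by blast
    then have "chain h k \<gamma> V c E i a (f (Suc c))"
      using Suc by (auto intro!: exI[of _ f])
    with f show "chain h k \<gamma> V (Suc c) E i a b" by auto
  qed
qed

lemma closed_walk_edges_subset_iff: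
  assumes "length vs = h" "h \<ge> 2"
  shows "closed_walk_edges vs \<subseteq> E \<longleftrightarrow>
    (\<forall>j. Suc j < h \<longrightarrow> (vs ! j, vs ! Suc j) \<in> E) \<and> (vs ! (h - 1), vs ! 0) \<in> E"
proof -
  have "(\<forall>j<h. (vs ! j, vs ! (Suc j mod h)) \<in> E) \<longleftrightarrow>
    (\<forall>j. Suc j < h \<longrightarrow> (vs ! j, vs ! Suc j) \<in> E) \<and> (vs ! (h - 1), vs ! 0) \<in> E" (is "?L \<longleftrightarrow> ?R")
  proof
    assume ?L
    then show ?R using \<open>h \<ge> 2\<close>
      by (auto dest: spec[of _ "h - 1"]) (metis Suc_lessD mod_less)
  next
    assume R: ?R
    show ?L
    proof (intro allI impI)
      fix j assume "j < h"
      then consider "Suc j < h" | "j = h - 1" by linarith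
      then show "(vs ! j, vs ! (Suc j mod h)) \<in> E"
        by cases (use R \<open>h \<ge> 2\<close> in auto)
    qed
  qed
  then show ?thesis using assms(1) by (auto simp: closed_walk_edges_def)
qed

text \<open>The chain at \<open>h - 2\<close> runs through the colours \<open>0\<close> to
  \<open>h - 1\<close>, and the last layer, whose rows belong to colour 0, returns to the start. The
  vertices are distinct because the colouring is a left inverse of the map from positions to
  vertices.\<close>

lemma chain_closes_iff:
  assumes "h \<ge> 2"
  shows "(\<exists>a<k. \<exists>b<k. chain h k \<gamma> V (h - 2) E i a b \<and> layer h \<gamma> V (h - 1) E i a b) \<longleftrightarrow>
    sample_hits h k \<gamma> V E i" (is "?L \<longleftrightarrow> ?R")
proof
  assume ?L
  then obtain a b f where ab: "a < k" "b < k" "layer h \<gamma> V (h - 1) E i a b"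
    and f: "f 0 = a" "f (Suc (h - 2)) = b" "\<forall>j. 0 < j \<and> j \<le> h - 2 \<longrightarrow> f j < k"
      "\<forall>j\<le>h - 2. layer h \<gamma> V j E i (f j) (f (Suc j))"
    using chain_iff[of "h - 2" h] assms by auto
  have h: "Suc (h - 2) = h - 1" using assms by simp
  have less: "f j < k" if j: "j < h" for j
  proof -
    consider "j = 0" | "0 < j" "j \<le> h - 2" | "j = Suc (h - 2)" using j assms by linarith
    then show ?thesis by cases (use f ab in auto)
  qed
  have last: "\<gamma> i (V i (h - 1) b) = h - 1" "(V i (h - 1) b, V i 0 a) \<in> E"
    using ab assms by (auto simp: layer_def)
  have steps: "\<gamma> i (V i j (f j)) = j" "(V i j (f j), V i (Suc j) (f (Suc j))) \<in> E" if "Suc j < h" for j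
    using f(4)[rule_format, of j] that by (auto simp: layer_def)
  have colour: "\<gamma> i (V i j (f j)) = j" if "j < h" for j
  proof -
    consider "Suc j < h" | "j = h - 1" using \<open>j < h\<close> by linarith
    then show ?thesis by cases (use steps last f h in auto)
  qed
  define vs where "vs = map (\<lambda>j. V i j (f j)) [0..<h]"
  have "inj_on (\<lambda>j. V i j (f j)) {0..<h}"
    by (rule inj_on_inverseI[of _ "\<gamma> i"]) (simp add: colour)
  then have "distinct vs" by (simp add: vs_def distinct_map)
  moreover have "closed_walk_edges vs \<subseteq> E"
    using assms steps last f h by (subst closed_walk_edges_subset_iff[of _ h]) (auto simp: vs_def)
  ultimately have "vs \<in> cycle_sequences h E" by (simp add: cycle_sequences_def vs_def)
  with colour less show ?R by (auto simp: sample_hits_def vs_def intro!: bexI[of _ vs])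
next
  assume ?R
  then obtain vs where "vs \<in> cycle_sequences h E" "\<forall>c<h. vs ! c \<in> V i c ` {..<k} \<and> \<gamma> i (vs ! c) = c"
    unfolding sample_hits_def by blast
  then have vs: "length vs = h" "closed_walk_edges vs \<subseteq> E"
    and hit: "\<forall>c<h. \<exists>a<k. vs ! c = V i c a" "\<And>c. c < h \<Longrightarrow> \<gamma> i (vs ! c) = c"
    by (auto simp: cycle_sequences_def image_iff)
  from hit(1) obtain f where f: "\<And>c. c < h \<Longrightarrow> f c < k" "\<And>c. c < h \<Longrightarrow> V i c (f c) = vs ! c"
    by metis
  have E: "\<And>j. Suc j < h \<Longrightarrow> (vs ! j, vs ! Suc j) \<in> E" "(vs ! (h - 1), vs ! 0) \<in> E"
    using vs(2) unfolding closed_walk_edges_subset_iff[OF vs(1) assms] by auto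
  have "layer h \<gamma> V j E i (f j) (f (Suc j))" if "j \<le> h - 2" for j
    using that assms f hit(2) E(1)[of j] by (simp add: layer_def)
  then have "chain h k \<gamma> V (h - 2) E i (f 0) (f (Suc (h - 2)))"
    using chain_iff[of "h - 2" h] assms f by (auto intro!: exI[of _ f])
  moreover have "layer h \<gamma> V (h - 1) E i (f 0) (f (h - 1))"
    using assms f hit(2) E(2) by (simp add: layer_def)
  moreover have "Suc (h - 2) = h - 1" using assms by simp
  ultimately show ?L using f(1)[of 0] f(1)[of "h - 1"] assms by auto
qed

text \<open>The last layer is stored transposed, with rows for colour 0: its entry
  \<open>(a, b)\<close> then has the same owner as the entry \<open>(a, b)\<close> of the chain. In
  every layer the row vertex is an end of the edge in question, so it knows the entry.\<close>

definition row_vertex :: "nat \<Rightarrow> (nat \<Rightarrow> nat \<Rightarrow> nat \<Rightarrow> nat) \<Rightarrow> nat \<Rightarrow> nat \<Rightarrow> nat \<Rightarrow> nat" where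
  "row_vertex h V c i a = V i (if Suc c = h then 0 else c) a"

lemma layer_incident:
  "layer h \<gamma> V c E i a b \<longleftrightarrow> layer h \<gamma> V c (incident_edges E (row_vertex h V c i a)) i a b"
  by (auto simp: layer_def incident_edges_def row_vertex_def)

text \<open>Every entry of every layer is a message from its row vertex to its owner, whether or not
  the edge exists. The demands are thus independent of \<open>E\<close>, as the routing
  requires.\<close>

lemma reaches_layers:
  assumes "\<beta> \<ge> 1" "n \<ge> 2" and V: "\<And>c i a. c < h \<Longrightarrow> i < s \<Longrightarrow> a < k \<Longrightarrow> V i c a < n"
    and out: "\<And>u. u < n \<Longrightarrow> card {(c, i, a, b). c < h \<and> i < s \<and> a < k \<and> b < k \<and> row_vertex h V c i a = u} \<le> \<Delta>"
    and "in": "\<And>v. v < n \<Longrightarrow> card {(c, i, a, b). c < h \<and> i < s \<and> a < k \<and> b < k \<and> owner n s d i a b = v} \<le> \<Delta>"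
    and T: "2 * \<Delta> \<le> n * T"
  shows "reaches \<beta> n (2 * T) incident_edges
    (\<lambda>E v c i a b. c < h \<and> share n k s d (layer h \<gamma> V c E) v i a b)"
proof -
  define J where "J = {..<h} \<times> {..<s} \<times> {..<k} \<times> {..<k}"
  define src where "src = (\<lambda>(c, i, a, b :: nat). row_vertex h V c i a)"
  define dst where "dst = (\<lambda>(c :: nat, i, a, b). owner n s d i a b)"
  have "reaches \<beta> n (2 * T) incident_edges
      (\<lambda>E v j. j \<in> J \<and> dst j = v \<and> (case j of (c, i, a, b) \<Rightarrow> layer h \<gamma> V c E i a b))"
  proof (rule reaches_route[where src = src and \<Delta> = \<Delta>
        and \<phi> = "\<lambda>(c, i, a, b) I. layer h \<gamma> V c I i a b"])
    show "finite J" by (simp add: J_def)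
    show "src j < n" if "j \<in> J" for j
      using that V by (auto simp: J_def src_def row_vertex_def)
    show "dst j < n" if "j \<in> J" for j
      using \<open>n \<ge> 2\<close> by (auto simp: dst_def owner_less split: prod.splits)
    show "card {j \<in> J. src j = u} \<le> \<Delta>" if "u < n" for u
    proof -
      have "{j \<in> J. src j = u} =
          {(c, i, a, b). c < h \<and> i < s \<and> a < k \<and> b < k \<and> row_vertex h V c i a = u}"
        by (auto simp: J_def src_def)
      with out[OF that] show ?thesis by simp
    qed
    show "card {j \<in> J. dst j = v} \<le> \<Delta>" if "v < n" for v
    proof -
      have "{j \<in> J. dst j = v} =
          {(c, i, a, b). c < h \<and> i < s \<and> a < k \<and> b < k \<and> owner n s d i a b = v}"
        by (auto simp: J_def dst_def)
      with "in"[OF that] show ?thesis by simp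
    qed
    show "(case j of (c, i, a, b) \<Rightarrow> layer h \<gamma> V c E i a b) =
        (case j of (c, i, a, b) \<Rightarrow> \<lambda>I. layer h \<gamma> V c I i a b) (incident_edges E (src j))" for E j
      unfolding src_def by (cases j) (simp add: layer_incident[symmetric])
  qed (use assms in auto)
  then show ?thesis
    by (rule reaches_local[where \<phi> = "\<lambda>v _ x c i a b. x (c, i, a, b)"])
       (auto simp: J_def dst_def share_def fun_eq_iff)
qed

lemma reaches_chain:
  assumes "products_within \<beta> n k s d R" "Suc c < h"
  shows "reaches \<beta> n (c * R) (\<lambda>E v c i a b. c < h \<and> share n k s d (layer h \<gamma> V c E) v i a b)
    (\<lambda>E. share n k s d (chain h k \<gamma> V c E))" (is "reaches _ _ _ ?f _")
  using assms(2)
proof (induction c)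
  case 0
  show ?case
    by (rule reaches_local[OF reaches_idle, where \<phi> = "\<lambda>v i _. i 0"])
       (use 0 in \<open>simp add: share_def fun_eq_iff\<close>)
next
  case (Suc c)
  then have "reaches \<beta> n (c * R) ?f (\<lambda>E. share n k s d (chain h k \<gamma> V c E))" by simp
  then have 1: "reaches \<beta> n (c * R) ?f
      (\<lambda>E v. (share n k s d (chain h k \<gamma> V c E) v, share n k s d (layer h \<gamma> V (Suc c) E) v))"
    by (rule reaches_local[where \<phi> = "\<lambda>v i x. (x, i (Suc c))"]) (use Suc.prems in \<open>simp add: fun_eq_iff\<close>)
  have 2: "reaches \<beta> n R
      (\<lambda>E v. (share n k s d (chain h k \<gamma> V c E) v, share n k s d (layer h \<gamma> V (Suc c) E) v))
      (\<lambda>E. share n k s d (\<lambda>i a b. \<exists>x<k. chain h k \<gamma> V c E i a x \<and> layer h \<gamma> V (Suc c) E i x b))"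
    using assms(1) unfolding products_within_def by blast
  have "(\<lambda>E. share n k s d (\<lambda>i a b. \<exists>x<k. chain h k \<gamma> V c E i a x \<and> layer h \<gamma> V (Suc c) E i x b)) =
      (\<lambda>E. share n k s d (chain h k \<gamma> V (Suc c) E))"
    by (simp add: fun_eq_iff share_def)
  with reaches_trans[OF 1 2] show ?case by (simp add: add.commute)
qed

text \<open>\<open>h - 2\<close> products suffice, since closing the walk is an entrywise
  conjunction and both entries lie at the same owner.\<close>

lemma reaches_batch:
  assumes "h \<ge> 2" and "products_within \<beta> n k s d R"
    and "reaches \<beta> n T incident_edges
      (\<lambda>E v c i a b. c < h \<and> share n k s d (layer h \<gamma> V c E) v i a b)" (is "reaches _ _ _ _ ?f")
  shows "reaches \<beta> n (T + (h - 2) * R) incident_edges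
    (\<lambda>E v. \<exists>i a b. share n k s d (chain h k \<gamma> V (h - 2) E) v i a b \<and>
                   share n k s d (layer h \<gamma> V (h - 1) E) v i a b)"
proof -
  have "reaches \<beta> n ((h - 2) * R) ?f (\<lambda>E. share n k s d (chain h k \<gamma> V (h - 2) E))"
    using reaches_chain[OF assms(2), of "h - 2" h] assms(1) by simp
  then have "reaches \<beta> n ((h - 2) * R) ?f
    (\<lambda>E v. \<exists>i a b. share n k s d (chain h k \<gamma> V (h - 2) E) v i a b \<and>
                   share n k s d (layer h \<gamma> V (h - 1) E) v i a b)"
    by (rule reaches_local[where \<phi> = "\<lambda>v f x. \<exists>i a b. x i a b \<and> f (h - 1) i a b"])
       (use assms(1) in simp)
  with assms(3) show ?thesis by (rule reaches_trans)
qed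

lemma share_found_iff:
  assumes "h \<ge> 2" "n > 0"
  shows "(\<exists>u<n. \<exists>i a b. share n k s d (chain h k \<gamma> V (h - 2) E) u i a b \<and>
                   share n k s d (layer h \<gamma> V (h - 1) E) u i a b) \<longleftrightarrow>
    (\<exists>i<s. sample_hits h k \<gamma> V E i)"
  unfolding chain_closes_iff[OF assms(1), symmetric] share_def
  using owner_less[OF \<open>n > 0\<close>] by blast

lemma reaches_any_batch:
  assumes "\<And>g. g < G \<Longrightarrow> reaches \<beta> n r f (b g)"
  shows "reaches \<beta> n (G * r) f (\<lambda>w v. \<exists>g<G. b g w v)"
  using assms
proof (induction G)
  case 0
  show ?case by (rule reaches_local[OF reaches_idle, where \<phi> = "\<lambda>_ _ _. False"]) simp
next
  case (Suc G)
  then have "reaches \<beta> n (G * r + r) f (\<lambda>w v. (\<exists>g<G. b g w v, b G w v))"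
    by (intro reaches_pair) auto
  then have "reaches \<beta> n (G * r + r) f (\<lambda>w v. \<exists>g<Suc G. b g w v)"
    by (rule reaches_local[where \<phi> = "\<lambda>_ _ x. fst x \<or> snd x"]) (auto simp: less_Suc_eq)
  then show ?case by (simp add: add.commute)
qed

section \<open>Counting samples\<close>

text \<open>Models \<open>m\<close> independent uniform choices from \<open>A\<close>; until the
  seed is drawn, probabilities are quotients of cardinalities.\<close>

definition lists_over :: "'a set \<Rightarrow> nat \<Rightarrow> 'a list set" where
  "lists_over A m = {xs. set xs \<subseteq> A \<and> length xs = m}"

lemma lists_over_0 [simp]: "lists_over A 0 = {[]}"
  by (auto simp: lists_over_def)

lemma lists_over_Suc: "lists_over A (Suc m) = (\<lambda>(x, xs). x # xs) ` (A \<times> lists_over A m)"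
  by (auto simp: lists_over_def length_Suc_conv image_iff)

lemma finite_lists_over: "finite A \<Longrightarrow> finite (lists_over A m)"
  unfolding lists_over_def by (rule finite_lists_length_eq)

lemma card_lists_over: "finite A \<Longrightarrow> card (lists_over A m) = card A ^ m"
  unfolding lists_over_def by (rule card_lists_length_eq)

lemma sum_lists_over_Suc:
  "sum f (lists_over A (Suc m)) = (\<Sum>xs\<in>lists_over A m. \<Sum>x\<in>A. f (x # xs))"
proof -
  have "inj_on (\<lambda>(x, xs). x # xs) (A \<times> lists_over A m)" by (auto simp: inj_on_def)
  then have "sum f (lists_over A (Suc m)) = (\<Sum>x\<in>A. \<Sum>xs\<in>lists_over A m. f (x # xs))"
    unfolding lists_over_Suc
    by (simp add: sum.reindex sum.cartesian_product case_prod_unfold)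
  also have "\<dots> = (\<Sum>xs\<in>lists_over A m. \<Sum>x\<in>A. f (x # xs))" by (rule sum.swap)
  finally show ?thesis .
qed

text \<open>Independence in counting form: the mean of a product over independent positions is the
  product of the means. It yields the exponential moment of the load.\<close>

lemma sum_prod_list:
  fixes \<phi> :: "'a \<Rightarrow> 'b :: comm_semiring_1"
  shows "(\<Sum>xs\<in>lists_over A m. prod_list (map \<phi> xs)) = (\<Sum>x\<in>A. \<phi> x) ^ m"
proof (induction m)
  case (Suc m)
  have "(\<Sum>xs\<in>lists_over A (Suc m). prod_list (map \<phi> xs)) =
      (\<Sum>xs\<in>lists_over A m. (\<Sum>x\<in>A. \<phi> x) * prod_list (map \<phi> xs))"
    by (simp add: sum_lists_over_Suc sum_distrib_right)
  then show ?case by (simp add: sum_distrib_left[symmetric] Suc)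
qed simp

lemma markov_count:
  fixes \<phi> :: "'a \<Rightarrow> real"
  assumes "finite A" "\<And>x. x \<in> A \<Longrightarrow> \<phi> x \<ge> 0" "\<And>x. x \<in> B \<Longrightarrow> \<phi> x \<ge> t" "B \<subseteq> A"
  shows "real (card B) * t \<le> sum \<phi> A"
proof -
  have "real (card B) * t = (\<Sum>x\<in>B. t)" by simp
  also have "\<dots> \<le> sum \<phi> B" using assms by (intro sum_mono) auto
  also have "\<dots> \<le> sum \<phi> A" using assms by (intro sum_mono2) auto
  finally show ?thesis .
qed

lemma exp_le_two_powr: "(y :: real) \<ge> 0 \<Longrightarrow> exp y \<le> 2 powr (2 * y)"
proof -
  assume "y \<ge> 0"
  have "1 \<le> 2 * ln (2 :: real)" using ln2_ge_two_thirds by simp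
  then have "y \<le> 2 * y * ln 2" using \<open>y \<ge> 0\<close> mult_left_mono[of 1 "2 * ln 2" y] by simp
  then show ?thesis by (simp add: powr_def)
qed

lemma exp_minus_le_two_powr: "(y :: real) \<ge> 0 \<Longrightarrow> exp (- y) \<le> 2 powr (- y)"
  using ln_le_minus_one[of "2 :: real"] mult_left_mono[of "ln 2" 1 y] by (simp add: powr_def)

subsection \<open>Hitting a set of sequences\<close>

text \<open>With \<open>p = card Y / n\<close>, Bernoulli's inequality gives
  \<open>(1 - p) ^ k * (1 + k * p) \<le> (1 - p\<^sup>2) ^ k \<le> 1\<close>, so \<open>Y\<close> is
  hit with probability at least \<open>k * p / (1 + k * p)\<close>. The denominator is at most 5
  because \<open>k * p \<le> k * x / n \<le> 4\<close>, and \<open>k * p\<close> is at least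
  \<open>card Y / (2 * x)\<close>; this is the origin of \<open>10\<close>.\<close>

lemma card_lists_meeting:
  fixes n k y :: nat and x :: real
  assumes "Y \<subseteq> {..<n}" "card Y \<le> x" "x > 0" "n > 0" "1 / 2 \<le> k * x / n" "k * x / n \<le> 4"
  shows "card Y / (10 * x) * real n ^ k \<le> card {V \<in> lists_over {..<n} k. set V \<inter> Y \<noteq> {}}"
proof -
  define p where "p = card Y / real n"
  have y: "card Y \<le> n" using card_mono[OF _ assms(1)] by simp
  have fin: "finite Y" using assms(1) finite_subset by blast
  have p: "0 \<le> p" "p \<le> 1" using y \<open>n > 0\<close> by (auto simp: p_def)
  have "{V \<in> lists_over {..<n} k. set V \<inter> Y \<noteq> {}} = lists_over {..<n} k - lists_over ({..<n} - Y) k"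
    by (auto simp: lists_over_def)
  moreover have "lists_over ({..<n} - Y) k \<subseteq> lists_over {..<n} k" by (auto simp: lists_over_def)
  moreover have "card ({..<n} - Y) = n - card Y" using assms(1) fin by (simp add: card_Diff_subset)
  ultimately have "real (card {V \<in> lists_over {..<n} k. set V \<inter> Y \<noteq> {}}) = real (n ^ k) - real ((n - card Y) ^ k)"
    by (simp add: card_Diff_subset finite_lists_over card_lists_over of_nat_diff power_mono)
  also have "\<dots> = real n ^ k - (real n * (1 - p)) ^ k"
  proof -
    have "real n * (1 - p) = real (n - card Y)" using y \<open>n > 0\<close> by (simp add: right_diff_distrib p_def)
    then show ?thesis unfolding of_nat_power by (simp only:)
  qed
  also have "\<dots> = real n ^ k * (1 - (1 - p) ^ k)"
    by (simp only: power_mult_distrib right_diff_distrib[of "real n ^ k"] mult_1_right)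
  also have "\<dots> \<ge> real n ^ k * (card Y / (10 * x))"
  proof (rule mult_left_mono)
    have "(1 - p) ^ k * (1 + k * p) \<le> (1 - p) ^ k * (1 + p) ^ k"
      using p by (intro mult_left_mono Bernoulli_inequality) auto
    also have "\<dots> = (1 - p\<^sup>2) ^ k" by (simp add: power_mult_distrib[symmetric] algebra_simps power2_eq_square)
    also have "\<dots> \<le> 1" using p by (intro power_le_one) (auto simp: power_le_one_iff abs_square_le_1)
    finally have "(1 - p) ^ k \<le> 1 / (1 + k * p)" using p by (simp add: pos_le_divide_eq add_pos_nonneg)
    moreover have "k * p \<le> 4" unfolding p_def times_divide_eq_right
      by (rule order_trans[OF _ assms(6)]) (use assms in \<open>auto intro!: divide_right_mono mult_left_mono\<close>)
    then have "card Y / (10 * x) * (1 + k * p) \<le> card Y / (10 * x) * 5"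
      using assms(3) by (intro mult_left_mono) auto
    moreover have "card Y / (10 * x) * 5 = (1 / 2) * (card Y / x)" by simp
    moreover have "\<dots> \<le> (k * x / n) * (card Y / x)" using assms(3,5) by (intro mult_right_mono) auto
    moreover have "\<dots> = k * p" using assms(3) by (simp add: p_def)
    ultimately have "card Y / (10 * x) * (1 + k * p) \<le> k * p" by linarith
    then have "card Y / (10 * x) \<le> k * p / (1 + k * p)" using p by (simp add: pos_le_divide_eq add_pos_nonneg)
    also have "\<dots> = 1 - 1 / (1 + k * p)" using p
      by (simp add: field_simps add_pos_nonneg add_nonneg_eq_0_iff)
    finally show "card Y / (10 * x) \<le> 1 - (1 - p) ^ k"
      using \<open>(1 - p) ^ k \<le> 1 / (1 + k * p)\<close> by linarith
  qed simp
  finally show ?thesis by (simp add: mult.commute)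
qed

definition meets :: "nat list list \<Rightarrow> nat list \<Rightarrow> bool" where
  "meets = list_all2 (\<lambda>V v. v \<in> set V)"

text \<open>
  The bound for single vertices is linear in the size of the set to be hit, so that it can be
  averaged over the samples for the remaining positions.
\<close>

lemma card_meeting_lists:
  fixes \<theta> :: real
  assumes "finite F" "finite X" "\<theta> \<ge> 0"
    and single: "\<And>Y. Y \<subseteq> X \<Longrightarrow> \<theta> * card Y \<le> card {V \<in> F. set V \<inter> Y \<noteq> {}}"
    and "Q \<subseteq> lists_over X h"
  shows "\<theta> ^ h * card Q \<le> card {Vs \<in> lists_over F h. \<exists>vs\<in>Q. meets Vs vs}"
  using assms(5)
proof (induction h arbitrary: Q)
  case 0
  then have "Q = {} \<or> Q = {[]}" by auto
  then show ?case
  proof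
    assume "Q = {[]}"
    moreover have "{Vs \<in> lists_over F 0. \<exists>vs\<in>{[]}. meets Vs vs} = {[]}" by (auto simp: meets_def)
    ultimately show ?thesis by simp
  qed simp
next
  case (Suc h)
  define tails where "tails v = {vs. v # vs \<in> Q}" for v
  \<comment> \<open>What the first list has to hit once the remaining lists are \<open>Vs\<close>.
    The pairs of \<open>v\<close> and \<open>Vs\<close> are counted in two ways: for each
    \<open>v\<close> by the induction hypothesis, for each \<open>Vs\<close> by
    \<open>single\<close>.\<close>
  define heads where "heads Vs = {v \<in> X. \<exists>vs\<in>tails v. meets Vs vs}" for Vs
  have finL: "finite (lists_over F h)" by (rule finite_lists_over[OF assms(1)])
  have tails: "tails v \<subseteq> lists_over X h" for v
    using Suc.prems by (force simp: tails_def lists_over_def)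
  have Q: "Q = (\<Union>v\<in>X. (#) v ` tails v)"
  proof (intro equalityI subsetI)
    fix x assume x: "x \<in> Q"
    with Suc.prems have "set x \<subseteq> X" "length x = Suc h" by (auto simp: lists_over_def)
    then obtain v vs where "x = v # vs" "v \<in> X" by (cases x) auto
    with x show "x \<in> (\<Union>v\<in>X. (#) v ` tails v)" by (auto simp: tails_def)
  qed (auto simp: tails_def)
  have "card Q = (\<Sum>v\<in>X. card ((#) v ` tails v))"
    unfolding Q using finite_subset[OF tails finite_lists_over[OF assms(2)]]
    by (intro card_UN_disjoint) (auto simp: assms(2))
  also have "\<dots> = (\<Sum>v\<in>X. card (tails v))" by (intro sum.cong card_image) auto
  finally have card_Q: "card Q = (\<Sum>v\<in>X. card (tails v))" .
  have "\<theta> ^ Suc h * card Q = \<theta> * (\<Sum>v\<in>X. \<theta> ^ h * card (tails v))"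
    unfolding card_Q by (simp add: sum_distrib_left mult.assoc)
  also have "\<dots> \<le> \<theta> * (\<Sum>v\<in>X. real (card {Vs \<in> lists_over F h. \<exists>vs\<in>tails v. meets Vs vs}))"
    using Suc.IH[OF tails] assms(3) by (intro mult_left_mono sum_mono) auto
  also have "(\<Sum>v\<in>X. real (card {Vs \<in> lists_over F h. \<exists>vs\<in>tails v. meets Vs vs})) =
      (\<Sum>v\<in>X. \<Sum>Vs\<in>lists_over F h. if \<exists>vs\<in>tails v. meets Vs vs then 1 else 0)"
    using finL by (intro sum.cong refl) (simp add: sum.If_cases Int_def)
  also have "\<dots> = (\<Sum>Vs\<in>lists_over F h. \<Sum>v\<in>X. if \<exists>vs\<in>tails v. meets Vs vs then 1 else 0)"
    by (rule sum.swap)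
  also have "\<dots> = (\<Sum>Vs\<in>lists_over F h. real (card (heads Vs)))"
    using assms(2) by (intro sum.cong refl) (simp add: sum.If_cases Int_def heads_def)
  also have "\<theta> * \<dots> = (\<Sum>Vs\<in>lists_over F h. \<theta> * card (heads Vs))" by (simp add: sum_distrib_left)
  also have "\<dots> \<le> (\<Sum>Vs\<in>lists_over F h. real (card {V \<in> F. set V \<inter> heads Vs \<noteq> {}}))"
    by (intro sum_mono single) (auto simp: heads_def)
  also have "\<dots> = (\<Sum>Vs\<in>lists_over F h. \<Sum>V\<in>F. if set V \<inter> heads Vs \<noteq> {} then 1 else 0)"
    using assms(1) by (intro sum.cong refl) (simp add: sum.If_cases Int_def)
  also have "\<dots> = (\<Sum>Vs\<in>lists_over F h. \<Sum>V\<in>F. if \<exists>vs\<in>Q. meets (V # Vs) vs then 1 else 0)"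
  proof (intro sum.cong refl if_cong)
    fix V Vs
    show "set V \<inter> heads Vs \<noteq> {} \<longleftrightarrow> (\<exists>vs\<in>Q. meets (V # Vs) vs)"
    proof
      assume "\<exists>vs\<in>Q. meets (V # Vs) vs"
      then obtain v vs where "v # vs \<in> Q" "v \<in> set V" "meets Vs vs"
        by (auto simp: meets_def list_all2_Cons1)
      moreover from this(1) have "v \<in> X" using Suc.prems by (auto simp: lists_over_def)
      ultimately show "set V \<inter> heads Vs \<noteq> {}" by (auto simp: heads_def tails_def)
    qed (auto simp: heads_def tails_def meets_def)
  qed
  also have "\<dots> = (\<Sum>Vs\<in>lists_over F (Suc h). if \<exists>vs\<in>Q. meets Vs vs then 1 else 0)"
    by (rule sum_lists_over_Suc[symmetric])
  also have "\<dots> = card {Vs \<in> lists_over F (Suc h). \<exists>vs\<in>Q. meets Vs vs}"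
    using finite_lists_over[OF assms(1)] by (simp add: sum.If_cases Int_def)
  finally show ?case .
qed

text \<open>Prescribing the colours of \<open>h\<close> distinct vertices leaves
  \<open>h ^ (n - h)\<close> colourings; \<open>D\<close> gives the colours still allowed at each
  vertex.\<close>

lemma card_colourings:
  assumes "distinct vs" "length vs = h" "set vs \<subseteq> {..<n}" "h > 0"
  shows "real h ^ n / real h ^ h \<le> card {\<gamma> \<in> {..<n} \<rightarrow>\<^sub>E {..<h}. \<forall>c<h. \<gamma> (vs ! c) = c}"
proof -
  define D where "D v = (if v \<in> set vs then {inv_into {..<h} ((!) vs) v} else {..<h})" for v
  have "inj_on ((!) vs) {..<h}" using assms by (auto simp: inj_on_def nth_eq_iff_index_eq)
  then have inv: "inv_into {..<h} ((!) vs) (vs ! c) = c" if "c < h" for c using that by simp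
  have set: "v \<in> set vs \<longleftrightarrow> (\<exists>c<h. v = vs ! c)" for v using assms(2) by (auto simp: in_set_conv_nth)
  have "h \<le> n"
    using card_mono[OF _ assms(3)] assms(1,2) by (simp add: distinct_card)
  have "Pi\<^sub>E {..<n} D \<subseteq> {\<gamma> \<in> {..<n} \<rightarrow>\<^sub>E {..<h}. \<forall>c<h. \<gamma> (vs ! c) = c}"
  proof
    fix \<gamma> assume \<gamma>: "\<gamma> \<in> Pi\<^sub>E {..<n} D"
    have "D v \<subseteq> {..<h}" for v using inv set by (auto simp: D_def)
    with \<gamma> have "\<gamma> \<in> {..<n} \<rightarrow>\<^sub>E {..<h}" by (auto simp: PiE_iff)
    moreover have "\<gamma> (vs ! c) = c" if "c < h" for c
    proof -
      have "vs ! c \<in> set vs" using that assms(2) by simp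
      then have "\<gamma> (vs ! c) \<in> D (vs ! c)" using \<gamma> assms(3) by (auto simp: PiE_iff)
      then show ?thesis using inv[OF that] \<open>vs ! c \<in> set vs\<close> by (simp add: D_def)
    qed
    ultimately show "\<gamma> \<in> {\<gamma> \<in> {..<n} \<rightarrow>\<^sub>E {..<h}. \<forall>c<h. \<gamma> (vs ! c) = c}" by simp
  qed
  moreover have "finite ({..<n} \<rightarrow>\<^sub>E {..<h})" by (simp add: finite_PiE)
  ultimately have "card (Pi\<^sub>E {..<n} D) \<le> card {\<gamma> \<in> {..<n} \<rightarrow>\<^sub>E {..<h}. \<forall>c<h. \<gamma> (vs ! c) = c}"
    by (intro card_mono) auto
  moreover have "card (Pi\<^sub>E {..<n} D) = h ^ (n - h)"
  proof -
    have "card (Pi\<^sub>E {..<n} D) = (\<Prod>v<n. if v \<in> set vs then 1 else h)"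
      unfolding D_def by (subst card_PiE) (auto intro!: prod.cong)
    also have "\<dots> = h ^ card ({..<n} - set vs)" by (simp add: prod.If_cases Diff_eq)
    also have "card ({..<n} - set vs) = n - h"
      using assms by (simp add: card_Diff_subset distinct_card)
    finally show ?thesis .
  qed
  moreover have "real h ^ n = real h ^ (n - h) * real h ^ h"
    using \<open>h \<le> n\<close> by (simp add: power_add[symmetric])
  then have "real h ^ n / real h ^ h = real (h ^ (n - h))" using \<open>h > 0\<close> by simp
  ultimately show ?thesis by simp
qed

subsection \<open>The probability of a hit\<close>

definition random_samples :: "nat \<Rightarrow> nat \<Rightarrow> nat \<Rightarrow> ((nat \<Rightarrow> nat) \<times> nat list list) set" where
  "random_samples n h k = ({..<n} \<rightarrow>\<^sub>E {..<h}) \<times> lists_over (lists_over {..<n} k) h"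

definition good_sample :: "nat \<Rightarrow> nat list set \<Rightarrow> (nat \<Rightarrow> nat) \<times> nat list list \<Rightarrow> bool" where
  "good_sample h Q = (\<lambda>(\<gamma>, Vs). \<exists>vs\<in>Q. meets Vs vs \<and> (\<forall>c<h. \<gamma> (vs ! c) = c))"

lemma finite_random_samples: "finite (random_samples n h k)"
  by (simp add: random_samples_def finite_PiE finite_lists_over)

lemma card_random_samples: "card (random_samples n h k) = h ^ n * (n ^ k) ^ h"
  by (simp add: random_samples_def card_cartesian_product card_PiE card_lists_over finite_lists_over)

lemma random_sample_nth:
  assumes "\<omega> \<in> lists_over (random_samples n h k) T" "i < length \<omega>"
  shows "length (snd (\<omega> ! i)) = h"
    and "c < h \<Longrightarrow> length (snd (\<omega> ! i) ! c) = k"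
    and "c < h \<Longrightarrow> a < k \<Longrightarrow> snd (\<omega> ! i) ! c ! a < n"
proof -
  have "set \<omega> \<subseteq> random_samples n h k" using assms(1) unfolding lists_over_def by simp
  with nth_mem[OF assms(2)] have "\<omega> ! i \<in> random_samples n h k" by blast
  then have "snd (\<omega> ! i) \<in> lists_over (lists_over {..<n} k) h"
    unfolding random_samples_def by (rule mem_Times_iff[THEN iffD1, THEN conjunct2])
  then have Vs: "set (snd (\<omega> ! i)) \<subseteq> lists_over {..<n} k" "length (snd (\<omega> ! i)) = h"
    unfolding lists_over_def[of "lists_over {..<n} k" h] by simp_all
  then show "length (snd (\<omega> ! i)) = h" by simp
  have V: "snd (\<omega> ! i) ! c \<in> lists_over {..<n} k" if "c < h"
    using Vs(1) nth_mem[of c "snd (\<omega> ! i)"] that unfolding Vs(2) by blast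
  show "length (snd (\<omega> ! i) ! c) = k" if "c < h"
    using V[OF that] by (simp add: lists_over_def)
  show "snd (\<omega> ! i) ! c ! a < n" if "c < h" "a < k"
  proof -
    have "length (snd (\<omega> ! i) ! c) = k" "set (snd (\<omega> ! i) ! c) \<subseteq> {..<n}"
      using V[OF that(1)] by (simp_all add: lists_over_def)
    moreover from this(1) have "snd (\<omega> ! i) ! c ! a \<in> set (snd (\<omega> ! i) ! c)" using that(2) by simp
    ultimately show ?thesis by blast
  qed
qed

text \<open>The factor \<open>(10 * x) ^ h\<close> comes from hitting some sequence of
  \<open>Q\<close>. For each family of lists that does so, one sequence that is hit gets fixed, and
  at least a fraction \<open>1 / h ^ h\<close> of the colourings suits it.\<close>

lemma card_good_samples:
  fixes n h k :: nat and x :: real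
  assumes "h > 0" "n > 0" "X \<subseteq> {..<n}" "x = card X" "x > 0" "1 / 2 \<le> k * x / n" "k * x / n \<le> 4"
    and Q: "Q \<subseteq> lists_over X h" "\<And>vs. vs \<in> Q \<Longrightarrow> distinct vs"
  shows "card Q / ((10 * real h) ^ h * x ^ h) * card (random_samples n h k) \<le>
    card {r \<in> random_samples n h k. good_sample h Q r}"
proof -
  define C where "C = {..<n} \<rightarrow>\<^sub>E {..<h}"
  define L where "L = lists_over (lists_over {..<n} k) h"
  have fin: "finite C" "finite L" "finite X"
    using finite_subset[OF assms(3)] by (simp_all add: C_def L_def finite_PiE finite_lists_over)
  define \<theta> where "\<theta> = real n ^ k / (10 * x)"
  have hits: "\<theta> ^ h * card Q \<le> card {Vs \<in> L. \<exists>vs\<in>Q. meets Vs vs}"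
    unfolding L_def
  proof (rule card_meeting_lists[OF _ fin(3) _ _ Q(1)])
    show "\<theta> * card Y \<le> card {V \<in> lists_over {..<n} k. set V \<inter> Y \<noteq> {}}" if "Y \<subseteq> X" for Y
      using card_lists_meeting[of Y n x k] that assms card_mono[OF fin(3) that] by (simp add: \<theta>_def mult.commute)
  qed (use assms in \<open>auto simp: \<theta>_def finite_lists_over\<close>)
  have "(real h ^ n / real h ^ h) * card {Vs \<in> L. \<exists>vs\<in>Q. meets Vs vs} =
      (\<Sum>Vs\<in>L. if \<exists>vs\<in>Q. meets Vs vs then real h ^ n / real h ^ h else 0)"
    using fin by (simp add: sum.If_cases Int_def)
  also have "\<dots> \<le> (\<Sum>Vs\<in>L. real (card {\<gamma> \<in> C. good_sample h Q (\<gamma>, Vs)}))"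
  proof (rule sum_mono)
    fix Vs
    show "(if \<exists>vs\<in>Q. meets Vs vs then real h ^ n / real h ^ h else 0) \<le>
        real (card {\<gamma> \<in> C. good_sample h Q (\<gamma>, Vs)})"
    proof (cases "\<exists>vs\<in>Q. meets Vs vs")
      case True
      then obtain vs where vs: "vs \<in> Q" "meets Vs vs" by blast
      then have "distinct vs" "vs \<in> lists_over X h" using Q by auto
      then have "distinct vs" "length vs = h" "set vs \<subseteq> {..<n}"
        using assms(3) unfolding lists_over_def by auto
      then have "real h ^ n / real h ^ h \<le> card {\<gamma> \<in> C. \<forall>c<h. \<gamma> (vs ! c) = c}"
        unfolding C_def by (rule card_colourings) (rule assms)
      also have "\<dots> \<le> card {\<gamma> \<in> C. good_sample h Q (\<gamma>, Vs)}"
        unfolding of_nat_le_iff by (rule card_mono) (use fin vs in \<open>auto simp: good_sample_def\<close>)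
      finally show ?thesis using True by simp
    qed simp
  qed
  also have "\<dots> = card (SIGMA Vs:L. {\<gamma> \<in> C. good_sample h Q (\<gamma>, Vs)})"
    using fin by simp
  also have "\<dots> = card {r \<in> random_samples n h k. good_sample h Q r}"
    unfolding of_nat_eq_iff
    by (rule bij_betw_same_card[of "\<lambda>(Vs, \<gamma>). (\<gamma>, Vs)"])
       (auto simp: bij_betw_def inj_on_def random_samples_def C_def L_def image_iff)
  finally have "(real h ^ n / real h ^ h) * (\<theta> ^ h * card Q) \<le>
      card {r \<in> random_samples n h k. good_sample h Q r}"
    using mult_left_mono[OF hits, of "real h ^ n / real h ^ h"] by simp
  also have "(real h ^ n / real h ^ h) * (\<theta> ^ h * card Q) =
      card Q / ((10 * real h) ^ h * x ^ h) * card (random_samples n h k)"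
    by (simp add: \<theta>_def card_random_samples power_mult_distrib power_divide mult_ac)
  finally show ?thesis .
qed

lemma card_all_bad:
  fixes p :: real
  assumes "finite A" "p * card A \<le> card {r \<in> A. P r}"
  shows "card {\<omega> \<in> lists_over A T. \<forall>r\<in>set \<omega>. \<not> P r} \<le> exp (- p * T) * card (lists_over A T)"
proof -
  have "{\<omega> \<in> lists_over A T. \<forall>r\<in>set \<omega>. \<not> P r} = lists_over (A - {r \<in> A. P r}) T"
    by (auto simp: lists_over_def)
  then have "real (card {\<omega> \<in> lists_over A T. \<forall>r\<in>set \<omega>. \<not> P r}) = real (card A - card {r \<in> A. P r}) ^ T"
    using assms(1) by (simp add: card_lists_over card_Diff_subset)
  also have "real (card A - card {r \<in> A. P r}) = real (card A) - card {r \<in> A. P r}"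
    using assms(1) by (intro of_nat_diff card_mono) auto
  also have "(real (card A) - card {r \<in> A. P r}) ^ T \<le> (exp (- p) * card A) ^ T"
  proof (rule power_mono)
    have "real (card A) - card {r \<in> A. P r} \<le> (1 + - p) * card A" using assms(2) by (simp add: algebra_simps)
    also have "\<dots> \<le> exp (- p) * card A" by (intro mult_right_mono exp_ge_add_one_self) auto
    finally show "real (card A) - card {r \<in> A. P r} \<le> exp (- p) * card A" .
    show "0 \<le> real (card A) - card {r \<in> A. P r}" using assms(1) by (simp add: card_mono)
  qed
  also have "\<dots> = exp (- p * T) * card (lists_over A T)"
    using assms(1) by (simp add: power_mult_distrib card_lists_over exp_of_nat_mult[symmetric] mult.commute)
  finally show ?thesis .
qed

subsection \<open>The load of a vertex\<close>

text \<open>Occurrences count with multiplicity: a vertex sampled at several positions has to send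
  rows for each of them.\<close>

definition sample_load :: "nat \<Rightarrow> nat \<Rightarrow> ((nat \<Rightarrow> nat) \<times> nat list list) list \<Rightarrow> nat \<Rightarrow> nat" where
  "sample_load h k \<omega> u = card {(i, c, a). i < length \<omega> \<and> c < h \<and> a < k \<and> snd (\<omega> ! i) ! c ! a = u}"

lemma prod_list_map_nth: "prod_list (map f xs) = (\<Prod>i<length xs. f (xs ! i))" for f :: "'a \<Rightarrow> 'b :: comm_monoid_mult"
  by (simp add: prod.list_conv_set_nth lessThan_atLeast0)

lemma prod_two_if:
  "finite A \<Longrightarrow> (\<Prod>x\<in>A. if P x then 2 else 1) = (2 :: real) ^ card {x \<in> A. P x}"
  by (simp add: prod.If_cases Int_def)

lemma sum_if_two: "finite A \<Longrightarrow> (\<Sum>x\<in>A. if x \<in> B then 2 else 1 :: real) = card A + card (A \<inter> B)"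
proof -
  assume "finite A"
  have "(\<Sum>x\<in>A. if x \<in> B then 2 else 1 :: real) = (\<Sum>x\<in>A. 1 + (if x \<in> B then 1 else 0))"
    by (intro sum.cong) auto
  also have "\<dots> = card A + card (A \<inter> B)" using \<open>finite A\<close> by (simp add: sum.distrib sum.If_cases)
  finally show ?thesis .
qed

text \<open>\<open>2 ^ sample_load\<close> is a product over the independent positions
  \<open>(i, c, a)\<close>, with factor 2 where \<open>u\<close> is drawn and 1 elsewhere; each
  position contributes a mean of \<open>(n + 1) / n\<close>.\<close>

lemma sum_two_power_load:
  assumes "u < n"
  shows "(\<Sum>\<omega>\<in>lists_over (random_samples n h k) T. (2 :: real) ^ sample_load h k \<omega> u) =
    (real h ^ n * ((real n + 1) ^ k) ^ h) ^ T"
proof -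
  define \<phi> where "\<phi> x = (if x \<in> {u} then 2 else 1 :: real)" for x
  have \<phi>: "(\<Sum>x<n. \<phi> x) = real n + 1"
    unfolding \<phi>_def using assms by (subst sum_if_two) (auto simp: Int_absorb1)
  have V: "(\<Sum>V\<in>lists_over {..<n} k. prod_list (map \<phi> V)) = (real n + 1) ^ k"
    by (simp only: sum_prod_list \<phi>)
  have "(\<Sum>r\<in>random_samples n h k. prod_list (map (\<lambda>V. prod_list (map \<phi> V)) (snd r))) =
      (\<Sum>\<gamma>\<in>{..<n} \<rightarrow>\<^sub>E {..<h}. \<Sum>Vs\<in>lists_over (lists_over {..<n} k) h.
        prod_list (map (\<lambda>V. prod_list (map \<phi> V)) Vs))"
    unfolding random_samples_def sum.cartesian_product by (simp add: case_prod_unfold)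
  also have "\<dots> = real h ^ n * ((real n + 1) ^ k) ^ h"
    by (simp add: sum_prod_list \<phi> card_PiE)
  finally have r: "(\<Sum>r\<in>random_samples n h k. prod_list (map (\<lambda>V. prod_list (map \<phi> V)) (snd r))) =
      real h ^ n * ((real n + 1) ^ k) ^ h" .
  have "2 ^ sample_load h k \<omega> u =
      prod_list (map (\<lambda>r. prod_list (map (\<lambda>V. prod_list (map \<phi> V)) (snd r))) \<omega>)"
    if \<omega>: "\<omega> \<in> lists_over (random_samples n h k) T" for \<omega>
  proof -
    have len: "length (snd (\<omega> ! i)) = h" "c < h \<Longrightarrow> length (snd (\<omega> ! i) ! c) = k"
      if "i < length \<omega>" for i c
      using random_sample_nth[OF \<omega> that] by auto
    have "prod_list (map (\<lambda>r. prod_list (map (\<lambda>V. prod_list (map \<phi> V)) (snd r))) \<omega>) =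
        (\<Prod>i<length \<omega>. \<Prod>c<h. \<Prod>a<k. if snd (\<omega> ! i) ! c ! a = u then 2 else 1)"
      unfolding prod_list_map_nth by (intro prod.cong) (auto simp: len \<phi>_def)
    also have "\<dots> = (\<Prod>(i, c, a)\<in>{..<length \<omega>} \<times> {..<h} \<times> {..<k}. if snd (\<omega> ! i) ! c ! a = u then 2 else 1)"
      by (simp add: prod.cartesian_product)
    also have "\<dots> = (\<Prod>x\<in>{..<length \<omega>} \<times> {..<h} \<times> {..<k}.
        if (\<lambda>(i, c, a). snd (\<omega> ! i) ! c ! a = u) x then 2 else 1)"
      by (intro prod.cong) auto
    also have "\<dots> = 2 ^ card {x \<in> {..<length \<omega>} \<times> {..<h} \<times> {..<k}. (\<lambda>(i, c, a). snd (\<omega> ! i) ! c ! a = u) x}"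
      by (rule prod_two_if) simp
    also have "{x \<in> {..<length \<omega>} \<times> {..<h} \<times> {..<k}. (\<lambda>(i, c, a). snd (\<omega> ! i) ! c ! a = u) x} =
        {(i, c, a). i < length \<omega> \<and> c < h \<and> a < k \<and> snd (\<omega> ! i) ! c ! a = u}" by auto
    finally show ?thesis by (simp add: sample_load_def)
  qed
  then have "(\<Sum>\<omega>\<in>lists_over (random_samples n h k) T. (2 :: real) ^ sample_load h k \<omega> u) =
      (\<Sum>\<omega>\<in>lists_over (random_samples n h k) T.
        prod_list (map (\<lambda>r. prod_list (map (\<lambda>V. prod_list (map \<phi> V)) (snd r))) \<omega>))"
    by (intro sum.cong) auto
  also have "\<dots> = (real h ^ n * ((real n + 1) ^ k) ^ h) ^ T"
    unfolding sum_prod_list r ..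
  finally show ?thesis .
qed

text \<open>A Chernoff bound: the mean load is \<open>y = k * h * T / n\<close>, the exponential
  moment is at most \<open>exp y \<le> 2 powr (2 * y)\<close>, and Markov's inequality at
  \<open>2 * y + L\<close> leaves \<open>(1 / 2) ^ L\<close>. The condition is multiplied by
  \<open>n\<close> to stay within the naturals.\<close>

lemma card_overloaded:
  assumes "u < n"
  shows "card {\<omega> \<in> lists_over (random_samples n h k) T. n * sample_load h k \<omega> u > 2 * k * h * T + n * L}
    \<le> (1 / 2) ^ L * card (lists_over (random_samples n h k) T)"
proof -
  let ?\<Omega> = "lists_over (random_samples n h k) T"
  let ?B = "{\<omega> \<in> ?\<Omega>. n * sample_load h k \<omega> u > 2 * k * h * T + n * L}"
  define y where "y = real (k * h * T) / real n"
  have "n > 0" using assms by simp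
  have y: "y \<ge> 0" by (simp add: y_def)
  have fin: "finite ?\<Omega>" by (simp add: finite_lists_over finite_random_samples)
  have "real (card ?B) * 2 powr (2 * y + L) \<le> (\<Sum>\<omega>\<in>?\<Omega>. (2 :: real) ^ sample_load h k \<omega> u)"
  proof (rule markov_count[OF fin])
    fix \<omega> assume "\<omega> \<in> ?B"
    then have "real (2 * k * h * T + n * L) \<le> real (n * sample_load h k \<omega> u)"
      unfolding of_nat_le_iff by simp
    then have "2 * y + L \<le> sample_load h k \<omega> u"
      using \<open>n > 0\<close> by (simp add: y_def field_simps)
    then show "2 powr (2 * y + L) \<le> (2 :: real) ^ sample_load h k \<omega> u"
      by (subst powr_realpow[symmetric]) auto
  qed auto
  also have "\<dots> = (real h ^ n * ((real n * (1 + 1 / n)) ^ k) ^ h) ^ T"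
    unfolding sum_two_power_load[OF assms] using \<open>n > 0\<close> by (simp add: distrib_left)
  also have "\<dots> = card ?\<Omega> * (1 + 1 / n) ^ (k * h * T)"
    by (simp add: card_lists_over finite_random_samples card_random_samples power_mult_distrib power_mult mult.assoc)
  also have "\<dots> \<le> card ?\<Omega> * exp (1 / n) ^ (k * h * T)"
    by (intro mult_left_mono power_mono exp_ge_add_one_self) auto
  also have "exp (1 / n) ^ (k * h * T) = exp y" by (simp add: y_def exp_of_nat_mult[symmetric])
  also have "card ?\<Omega> * exp y \<le> card ?\<Omega> * 2 powr (2 * y)"
    by (intro mult_left_mono exp_le_two_powr y) simp
  finally have "real (card ?B) * 2 powr L * 2 powr (2 * y) \<le> card ?\<Omega> * 2 powr (2 * y)"
    by (simp add: powr_add mult_ac)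
  then have "real (card ?B) * 2 powr L \<le> card ?\<Omega>" by simp
  then show ?thesis by (simp add: powr_realpow power_one_over field_simps)
qed

subsection \<open>Few shared random bits suffice\<close>

text \<open>
  Newman's argument: a random assignment of samples to seeds works for all inputs at once, so that
  one such assignment can be built into the algorithm and only the seed has to be shared.
\<close>

lemma seeds_exist:
  fixes \<epsilon> \<theta> :: real
  assumes fin: "finite S" "finite \<Omega>" "finite I" and "\<Omega> \<noteq> {}"
    and B: "\<And>i. i \<in> I \<Longrightarrow> B i \<subseteq> \<Omega>" "\<And>i. i \<in> I \<Longrightarrow> card (B i) \<le> \<epsilon> * card \<Omega>"
    and small: "card I * exp (\<epsilon> * card S) < 2 powr \<theta>"
  shows "\<exists>t\<in>S \<rightarrow>\<^sub>E \<Omega>. \<forall>i\<in>I. card {\<sigma> \<in> S. t \<sigma> \<in> B i} \<le> \<theta>"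
proof -
  let ?F = "S \<rightarrow>\<^sub>E \<Omega>"
  define bad where "bad i = {t \<in> ?F. card {\<sigma> \<in> S. t \<sigma> \<in> B i} > \<theta>}" for i
  have finF: "finite ?F" using fin by (intro finite_PiE) auto
  have card_F: "card ?F = card \<Omega> ^ card S" using fin by (simp add: card_PiE)
  have pos: "0 < real (card ?F)" using fin \<open>\<Omega> \<noteq> {}\<close> by (simp add: card_F card_gt_0_iff)
  \<comment> \<open>For a random assignment the seeds fall into \<open>B i\<close> independently, so
    the exponential moment of the number of bad seeds factorises. The assumption
    \<open>small\<close> then covers the union over \<open>I\<close>.\<close>
  have bad: "card (bad i) * 2 powr \<theta> \<le> card ?F * exp (\<epsilon> * card S)" if "i \<in> I" for i
  proof -
    have "card (bad i) * 2 powr \<theta> \<le> (\<Sum>t\<in>?F. (2 :: real) ^ card {\<sigma> \<in> S. t \<sigma> \<in> B i})"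
      by (rule markov_count[OF finF]) (auto simp: bad_def powr_realpow[symmetric] less_imp_le)
    also have "\<dots> = (\<Sum>t\<in>?F. \<Prod>\<sigma>\<in>S. if t \<sigma> \<in> B i then 2 else 1)"
      using fin by (simp add: prod_two_if)
    also have "\<dots> = (\<Prod>\<sigma>\<in>S. \<Sum>x\<in>\<Omega>. if x \<in> B i then 2 else 1)"
      using fin by (subst prod_sum_PiE) auto
    also have "\<dots> = (card \<Omega> + card (B i)) ^ card S"
      using fin B(1)[OF that] by (simp add: sum_if_two Int_absorb1)
    also have "\<dots> \<le> (card \<Omega> * exp \<epsilon>) ^ card S"
    proof -
      have "card \<Omega> + real (card (B i)) \<le> card \<Omega> * (1 + \<epsilon>)"
        using B(2)[OF that] by (simp add: algebra_simps)
      also have "\<dots> \<le> card \<Omega> * exp \<epsilon>" by (intro mult_left_mono exp_ge_add_one_self) simp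
      finally show ?thesis by (simp add: power_mono)
    qed
    also have "\<dots> = card ?F * exp (\<epsilon> * card S)"
      by (simp add: card_F power_mult_distrib exp_of_nat_mult[symmetric] mult.commute)
    finally show ?thesis .
  qed
  have "card (\<Union>i\<in>I. bad i) * 2 powr \<theta> \<le> (\<Sum>i\<in>I. card (bad i)) * 2 powr \<theta>"
    using card_UN_le[OF fin(3)] by (intro mult_right_mono) (auto simp del: of_nat_sum)
  also have "\<dots> = (\<Sum>i\<in>I. card (bad i) * 2 powr \<theta>)" by (simp add: sum_distrib_right)
  also have "\<dots> \<le> (\<Sum>i\<in>I. card ?F * exp (\<epsilon> * card S))" by (intro sum_mono bad)
  also have "\<dots> = card ?F * (card I * exp (\<epsilon> * card S))" by simp
  also have "\<dots> < card ?F * 2 powr \<theta>" using small pos by (intro mult_strict_left_mono)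
  finally have "card (\<Union>i\<in>I. bad i) < card ?F" by simp
  moreover have "finite (\<Union>i\<in>I. bad i)" using fin(3) finF by (auto simp: bad_def)
  ultimately have "\<not> ?F \<subseteq> (\<Union>i\<in>I. bad i)" using card_mono leD by blast
  then obtain t where "t \<in> ?F" "\<forall>i\<in>I. t \<notin> bad i" by auto
  then show ?thesis by (intro bexI[of _ t]) (auto simp: bad_def not_less)
qed

section \<open>A phase of the algorithm\<close>

text \<open>The first two conditions concern \<open>\<omega>\<close> alone, so all vertices know
  beforehand whether they hold; if not, the phase fails without any communication. Batch
  \<open>g\<close> uses the samples \<open>g * s\<close> to \<open>g * s + s - 1\<close>.\<close>

definition phase_found ::
    "nat \<Rightarrow> nat \<Rightarrow> nat \<Rightarrow> nat \<Rightarrow> nat \<Rightarrow> nat \<Rightarrow> ((nat \<Rightarrow> nat) \<times> nat list list) list \<Rightarrow>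
     (nat \<times> nat) set \<Rightarrow> bool" where
  "phase_found h n k s G L \<omega> E \<longleftrightarrow>
     \<omega> \<in> lists_over (random_samples n h k) (G * s) \<and>
     (\<forall>u<n. n * sample_load h k \<omega> u \<le> 2 * k * h * (G * s) + n * L) \<and>
     (\<exists>g<G. \<exists>i<s. sample_hits h k (\<lambda>i. fst (\<omega> ! (g * s + i)))
        (\<lambda>i c a. snd (\<omega> ! (g * s + i)) ! c ! a) E i)"

lemma phase_found_sound: "phase_found h n k s G L \<omega> E \<Longrightarrow> cycle_sequences h E \<noteq> {}"
  by (auto simp: phase_found_def sample_hits_def)

lemma batch_index_less: "g < G \<Longrightarrow> i < s \<Longrightarrow> g * s + i < G * (s :: nat)"
proof -
  assume "g < G" "i < s"
  then have "g * s + i < Suc g * s" by simp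
  also have "\<dots> \<le> G * s" using \<open>g < G\<close> by (intro mult_le_mono1) simp
  finally show ?thesis .
qed

text \<open>Each occurrence of \<open>u\<close> in the samples asks for a row of \<open>k\<close>
  entries. Colour 0 supplies the rows of both the first and the last layer, so \<open>c\<close> is
  kept in the injection at the price of a factor \<open>h\<close>.\<close>

lemma row_load:
  assumes "\<omega> \<in> lists_over (random_samples n h k) (G * s)" "g < G" "h > 0"
  shows "card {(c, i, a, b). c < h \<and> i < s \<and> a < k \<and> b < k \<and>
      row_vertex h (\<lambda>i c a. snd (\<omega> ! (g * s + i)) ! c ! a) c i a = u} \<le> h * k * sample_load h k \<omega> u"
    (is "card ?A \<le> _")
proof -
  define row where "row c = (if Suc c = h then 0 else c)" for c
  let ?B = "{(i, c, a). i < length \<omega> \<and> c < h \<and> a < k \<and> snd (\<omega> ! i) ! c ! a = u}"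
  let ?f = "\<lambda>(c, i, a, b). (c, b, g * s + i, row c, a)"
  have len: "length \<omega> = G * s" using assms(1) by (simp add: lists_over_def)
  have fin: "finite ?B"
    by (rule finite_subset[of _ "{..<length \<omega>} \<times> {..<h} \<times> {..<k}"]) auto
  have "inj_on ?f ?A" by (auto simp: inj_on_def)
  moreover have "?f ` ?A \<subseteq> {..<h} \<times> {..<k} \<times> ?B"
    using \<open>h > 0\<close> batch_index_less[OF \<open>g < G\<close>] by (auto simp: len row_def row_vertex_def)
  ultimately have "card ?A \<le> card ({..<h} \<times> {..<k} \<times> ?B)"
    using fin by (intro card_inj_on_le) auto
  also have "\<dots> = h * k * sample_load h k \<omega> u"
    by (simp add: card_cartesian_product sample_load_def)
  finally show ?thesis .
qed

text \<open>The load condition together with \<open>s * k\<^sup>2 \<le> C * n\<^sup>2\<close> and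
  \<open>k \<le> n\<close> bounds the entries a vertex sends by
  \<open>n * h * (2 * h * G * C + L)\<close>, and \<open>owner_load\<close> bounds those it receives
  by \<open>68 * C * h * n\<close>; \<open>\<Delta>\<close> dominates both. The \<open>Suc\<close>
  is the broadcast of the result.\<close>

lemma reaches_sample_phase:
  assumes "\<beta> \<ge> 1" "n \<ge> 2" "h \<ge> 2" "1 \<le> k" "k \<le> n" "1 \<le> s" "1 \<le> C" "s * k\<^sup>2 \<le> C * n\<^sup>2"
    and d: "1 \<le> d" "d \<le> max 1 (k div block_rows n s)"
    and products: "products_within \<beta> n k s d R"
  shows "reaches \<beta> n (Suc (G * (2 * (2 * h * (68 * C + 2 * h * G * C + L)) + (h - 2) * R)))
    incident_edges (\<lambda>E v. phase_found h n k s G L \<omega> E)"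
proof (cases "\<omega> \<in> lists_over (random_samples n h k) (G * s) \<and>
     (\<forall>u<n. n * sample_load h k \<omega> u \<le> 2 * k * h * (G * s) + n * L)")
  case False
  then have "\<not> phase_found h n k s G L \<omega> E" for E unfolding phase_found_def by blast
  then show ?thesis
    by (intro reaches_local[OF reaches_idle, where \<phi> = "\<lambda>_ _ _. False"]) simp
next
  case True
  then have \<omega>: "\<omega> \<in> lists_over (random_samples n h k) (G * s)" by simp
  define T where "T = 2 * h * (68 * C + 2 * h * G * C + L)"
  define \<Delta> where "\<Delta> = n * h * (68 * C + 2 * h * G * C + L)"
  define \<gamma> where "\<gamma> g i = fst (\<omega> ! (g * s + i))" for g i
  define V where "V g i c a = snd (\<omega> ! (g * s + i)) ! c ! a" for g i c a
  have "n > 0" "h > 0" using assms by auto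
  have len: "length \<omega> = G * s" using \<omega> by (simp add: lists_over_def)
  have layers: "reaches \<beta> n (2 * T) incident_edges
      (\<lambda>E v c i a b. c < h \<and> share n k s d (layer h (\<gamma> g) (V g) c E) v i a b)" if "g < G" for g
  proof (rule reaches_layers[where \<Delta> = \<Delta>])
    show "V g i c a < n" if "c < h" "i < s" "a < k" for c i a
      unfolding V_def using random_sample_nth(3)[OF \<omega>] that batch_index_less[OF \<open>g < G\<close>] len by simp
  next
    fix u assume "u < n"
    have "n * (h * k * sample_load h k \<omega> u) = h * k * (n * sample_load h k \<omega> u)" by (simp add: mult_ac)
    also have "\<dots> \<le> h * k * (2 * k * h * (G * s) + n * L)"
      using True \<open>u < n\<close> by (intro mult_le_mono2) auto
    also have "\<dots> = h * (2 * h * G * (s * k\<^sup>2) + n * L * k)"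
      by (simp add: algebra_simps power2_eq_square)
    also have "\<dots> \<le> h * (2 * h * G * (C * n\<^sup>2) + n * L * n)"
      using assms by (intro mult_le_mono2 add_le_mono) auto
    also have "\<dots> \<le> n * \<Delta>"
      by (simp add: \<Delta>_def algebra_simps power2_eq_square)
    finally have "h * k * sample_load h k \<omega> u \<le> \<Delta>" using nat_mult_le_cancel1[OF \<open>n > 0\<close>] by blast
    with row_load[OF \<omega> \<open>g < G\<close> \<open>h > 0\<close>, of u]
    show "card {(c, i, a, b). c < h \<and> i < s \<and> a < k \<and> b < k \<and> row_vertex h (V g) c i a = u} \<le> \<Delta>"
      unfolding V_def by linarith
  next
    fix v
    have "{(c, i, a, b). c < h \<and> i < s \<and> a < k \<and> b < k \<and> owner n s d i a b = v} =
        {..<h} \<times> {(i, a, b). i < s \<and> a < k \<and> b < k \<and> owner n s d i a b = v}" by auto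
    then have "card {(c, i, a, b). c < h \<and> i < s \<and> a < k \<and> b < k \<and> owner n s d i a b = v} =
        h * card {(i, a, b). i < s \<and> a < k \<and> b < k \<and> owner n s d i a b = v}"
      by (simp add: card_cartesian_product)
    also have "\<dots> \<le> h * (68 * C * n)"
      using owner_load[OF \<open>n > 0\<close>] assms by (intro mult_le_mono2) auto
    also have "\<dots> \<le> \<Delta>" by (simp add: \<Delta>_def algebra_simps)
    finally show "card {(c, i, a, b). c < h \<and> i < s \<and> a < k \<and> b < k \<and> owner n s d i a b = v} \<le> \<Delta>" .
  next
    show "2 * \<Delta> \<le> n * T" by (simp add: \<Delta>_def T_def algebra_simps)
  qed (use assms in auto)
  let ?b = "\<lambda>g E v. \<exists>i a b. share n k s d (chain h k (\<gamma> g) (V g) (h - 2) E) v i a b \<and>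
                   share n k s d (layer h (\<gamma> g) (V g) (h - 1) E) v i a b"
  have "reaches \<beta> n (G * (2 * T + (h - 2) * R)) incident_edges (\<lambda>E v. \<exists>g<G. ?b g E v)"
    by (intro reaches_any_batch reaches_batch[OF \<open>h \<ge> 2\<close> products] layers)
  then have "reaches \<beta> n (Suc (G * (2 * T + (h - 2) * R))) incident_edges
      (\<lambda>E v. \<exists>u<n. \<exists>g<G. ?b g E u)"
    by (rule reaches_broadcast_any[OF assms(1,2)])
  moreover have "(\<exists>u<n. \<exists>g<G. ?b g E u) \<longleftrightarrow> phase_found h n k s G L \<omega> E" for E
  proof -
    have "(\<exists>u<n. \<exists>g<G. ?b g E u) \<longleftrightarrow> (\<exists>g<G. \<exists>u<n. ?b g E u)" by blast
    also have "\<dots> \<longleftrightarrow> (\<exists>g<G. \<exists>i<s. sample_hits h k (\<gamma> g) (V g) E i)"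
      unfolding share_found_iff[OF \<open>h \<ge> 2\<close> \<open>n > 0\<close>] ..
    also have "\<dots> \<longleftrightarrow> phase_found h n k s G L \<omega> E"
      using True unfolding phase_found_def \<gamma>_def[abs_def] V_def[abs_def] by blast
    finally show ?thesis .
  qed
  ultimately show ?thesis unfolding T_def by simp
qed

lemma good_sample_hits:
  assumes \<omega>: "\<omega> \<in> lists_over (random_samples n h k) (G * s)" and "r \<in> set \<omega>"
    and "good_sample h (cycle_sequences h E) r"
  shows "\<exists>g<G. \<exists>i<s. sample_hits h k (\<lambda>i. fst (\<omega> ! (g * s + i)))
        (\<lambda>i c a. snd (\<omega> ! (g * s + i)) ! c ! a) E i"
proof -
  have len: "length \<omega> = G * s" using \<omega> by (simp add: lists_over_def)
  from assms(2) obtain j where j: "j < G * s" "r = \<omega> ! j" by (auto simp: in_set_conv_nth len)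
  then have "s > 0" by (cases s) auto
  from assms(3) obtain vs where vs: "vs \<in> cycle_sequences h E" "meets (snd r) vs"
    "\<And>c. c < h \<Longrightarrow> fst r (vs ! c) = c"
    by (auto simp: good_sample_def split: prod.splits)
  have eq: "j div s * s + j mod s = j" by simp
  have "sample_hits h k (\<lambda>i. fst (\<omega> ! (j div s * s + i)))
        (\<lambda>i c a. snd (\<omega> ! (j div s * s + i)) ! c ! a) E (j mod s)"
    unfolding sample_hits_def
  proof (intro bexI[OF _ vs(1)] allI impI conjI)
    fix c assume c: "c < h"
    show "fst (\<omega> ! (j div s * s + j mod s)) (vs ! c) = c" unfolding eq j(2)[symmetric] by (rule vs(3)[OF c])
    have len_r: "length (snd r) = h" "length (snd r ! c) = k"
      using random_sample_nth(1,2)[OF \<omega>, of j] c j len by auto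
    then have "vs ! c \<in> set (snd r ! c)"
      using vs(2) c by (auto simp: meets_def list_all2_conv_all_nth)
    then show "vs ! c \<in> (\<lambda>a. snd (\<omega> ! (j div s * s + j mod s)) ! c ! a) ` {..<k}"
      unfolding eq j(2)[symmetric] using len_r by (metis image_eqI in_set_conv_nth lessThan_iff)
  qed
  moreover have "j div s < G" using j by (simp add: less_mult_imp_div_less)
  ultimately show ?thesis using \<open>s > 0\<close> by (meson mod_less_divisor)
qed

section \<open>Failure probability of a phase\<close>

definition cycle_vertices :: "nat \<Rightarrow> (nat \<times> nat) set \<Rightarrow> nat set" where
  "cycle_vertices h E = (\<Union>vs\<in>cycle_sequences h E. set vs)"

text \<open>The intended parameters satisfy \<open>n \<le> k * x \<le> 2 * n\<close> and
  \<open>x ^ h \<le> 2 * h * s * q\<close> for \<open>q\<close> sequences. Each bound is relaxed by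
  a factor of 2, so that the representative of their class is covered.\<close>

definition suitable :: "nat \<Rightarrow> nat \<Rightarrow> nat \<Rightarrow> nat \<Rightarrow> (nat \<times> nat) set \<Rightarrow> bool" where
  "suitable h n k s E \<longleftrightarrow> E \<subseteq> {..<n} \<times> {..<n} \<and> cycle_sequences h E \<noteq> {} \<and>
     (let x = real (card (cycle_vertices h E)) in
      1 / 2 \<le> k * x / n \<and> k * x / n \<le> 4 \<and> x ^ h \<le> 4 * h * s * card (cycle_sequences h E))"

lemma cycle_sequences_vertices:
  assumes "E \<subseteq> {..<n} \<times> {..<n}" "h \<ge> 2"
  shows "cycle_vertices h E \<subseteq> {..<n}" "cycle_sequences h E \<subseteq> lists_over (cycle_vertices h E) h"
    "finite (cycle_sequences h E)"
proof -
  show "cycle_vertices h E \<subseteq> {..<n}"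
  proof
    fix v assume "v \<in> cycle_vertices h E"
    then obtain vs where "v \<in> set vs" "length vs = h" "closed_walk_edges vs \<subseteq> E"
      by (auto simp: cycle_vertices_def cycle_sequences_def)
    then obtain j where "j < length vs" "v = vs ! j" "closed_walk_edges vs \<subseteq> E"
      by (auto simp: in_set_conv_nth)
    then have "(v, vs ! (Suc j mod length vs)) \<in> E" by (auto simp: closed_walk_edges_def)
    with assms(1) show "v \<in> {..<n}" by auto
  qed
  moreover show sub: "cycle_sequences h E \<subseteq> lists_over (cycle_vertices h E) h"
    by (auto simp: cycle_vertices_def lists_over_def cycle_sequences_def)
  ultimately show "finite (cycle_sequences h E)"
    using finite_subset[OF sub] finite_lists_over[OF finite_subset] by blast
qed

text \<open>A phase fails only if one of the \<open>n\<close> vertices is overloaded or none of the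
  \<open>G * s\<close> samples is good. A sample is good with probability at least \<open>p\<close>,
  and \<open>suitable\<close> gives \<open>p * s \<ge> 1 / \<kappa>\<close>.\<close>

lemma card_phase_failures:
  assumes "n \<ge> 2" "h \<ge> 2" "k \<ge> 1" and E: "suitable h n k s E"
  defines "\<kappa> \<equiv> 4 * real h * (10 * real h) ^ h"
  shows "card {\<omega> \<in> lists_over (random_samples n h k) (G * s). \<not> phase_found h n k s G L \<omega> E} \<le>
    (n * (1 / 2) ^ L + exp (- (G / \<kappa>))) * card (lists_over (random_samples n h k) (G * s))"
proof -
  let ?\<Omega> = "lists_over (random_samples n h k) (G * s)"
  define Q where "Q = cycle_sequences h E"
  define X where "X = cycle_vertices h E"
  define x where "x = real (card X)"
  let ?over = "\<lambda>u. {\<omega> \<in> ?\<Omega>. n * sample_load h k \<omega> u > 2 * k * h * (G * s) + n * L}"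
  let ?miss = "{\<omega> \<in> ?\<Omega>. \<forall>r\<in>set \<omega>. \<not> good_sample h Q r}"
  have E': "E \<subseteq> {..<n} \<times> {..<n}" "Q \<noteq> {}" "1 / 2 \<le> k * x / n" "k * x / n \<le> 4"
    "x ^ h \<le> 4 * h * s * card Q"
    using E by (auto simp: suitable_def Let_def Q_def X_def x_def)
  note QX = cycle_sequences_vertices[OF E'(1) \<open>h \<ge> 2\<close>, folded Q_def X_def]
  have fin: "finite ?\<Omega>" by (simp add: finite_lists_over finite_random_samples)
  have "x > 0"
  proof (rule ccontr)
    assume "\<not> x > 0"
    then have "x = 0" by (simp add: x_def)
    with E'(3) show False by simp
  qed
  have "\<kappa> > 0" using \<open>h \<ge> 2\<close> by (simp add: \<kappa>_def)
  have "{\<omega> \<in> ?\<Omega>. \<not> phase_found h n k s G L \<omega> E} \<subseteq> (\<Union>u<n. ?over u) \<union> ?miss"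
  proof
    fix \<omega> assume \<omega>: "\<omega> \<in> {\<omega> \<in> ?\<Omega>. \<not> phase_found h n k s G L \<omega> E}"
    show "\<omega> \<in> (\<Union>u<n. ?over u) \<union> ?miss"
    proof (rule ccontr)
      assume *: "\<omega> \<notin> (\<Union>u<n. ?over u) \<union> ?miss"
      with \<omega> obtain r where "r \<in> set \<omega>" "good_sample h Q r" by blast
      then have "\<exists>g<G. \<exists>i<s. sample_hits h k (\<lambda>i. fst (\<omega> ! (g * s + i)))
        (\<lambda>i c a. snd (\<omega> ! (g * s + i)) ! c ! a) E i"
        using \<omega> unfolding Q_def by (intro good_sample_hits) auto
      moreover have "\<forall>u<n. n * sample_load h k \<omega> u \<le> 2 * k * h * (G * s) + n * L"
        using \<omega> * by (auto simp: not_less)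
      ultimately show False using \<omega> unfolding phase_found_def by blast
    qed
  qed
  then have "card {\<omega> \<in> ?\<Omega>. \<not> phase_found h n k s G L \<omega> E} \<le> card ((\<Union>u<n. ?over u) \<union> ?miss)"
    using fin by (intro card_mono) auto
  also have "\<dots> \<le> card (\<Union>u<n. ?over u) + card ?miss" by (rule card_Un_le)
  also have "\<dots> \<le> (\<Sum>u<n. card (?over u)) + card ?miss"
    by (intro add_mono card_UN_le) auto
  finally have "card {\<omega> \<in> ?\<Omega>. \<not> phase_found h n k s G L \<omega> E} \<le> (\<Sum>u<n. card (?over u)) + card ?miss" .
  then have "real (card {\<omega> \<in> ?\<Omega>. \<not> phase_found h n k s G L \<omega> E}) \<le>
      real ((\<Sum>u<n. card (?over u)) + card ?miss)" by (simp only: of_nat_le_iff)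
  also have "\<dots> = (\<Sum>u<n. real (card (?over u))) + real (card ?miss)" by simp
  also have "\<dots> \<le> (\<Sum>u<n. (1 / 2) ^ L * card ?\<Omega>) + exp (- (G / \<kappa>)) * card ?\<Omega>"
  proof (intro add_mono sum_mono card_overloaded)
    define p where "p = card Q / ((10 * real h) ^ h * x ^ h)"
    have "p * card (random_samples n h k) \<le> card {r \<in> random_samples n h k. good_sample h Q r}"
      unfolding p_def
      by (rule card_good_samples) (use assms E' QX \<open>x > 0\<close> in \<open>auto simp: x_def Q_def cycle_sequences_def\<close>)
    then have "card ?miss \<le> exp (- p * (G * s)) * card ?\<Omega>"
      by (intro order_trans[OF card_all_bad[OF finite_random_samples]]) auto
    also have "\<dots> \<le> exp (- (G / \<kappa>)) * card ?\<Omega>"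
    proof (intro mult_right_mono)
      have "1 \<le> 4 * h * s * card Q / x ^ h" using E'(5) \<open>x > 0\<close> by (simp add: le_divide_eq)
      then have "G / \<kappa> * 1 \<le> G / \<kappa> * (4 * h * s * card Q / x ^ h)"
        using \<open>\<kappa> > 0\<close> by (intro mult_left_mono) auto
      also have "\<dots> = p * (G * s)"
        using \<open>h \<ge> 2\<close> by (simp add: p_def \<kappa>_def field_simps)
      finally show "exp (- p * (G * s)) \<le> exp (- (G / \<kappa>))" by simp
    qed simp
    finally show "real (card ?miss) \<le> exp (- (G / \<kappa>)) * card ?\<Omega>" .
  qed auto
  also have "\<dots> = (n * (1 / 2) ^ L + exp (- (G / \<kappa>))) * card ?\<Omega>" by (simp add: algebra_simps)
  finally show ?thesis .
qed

section \<open>The algorithm\<close>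

text \<open>
  A class consists of the pairs of parameters that agree up to a factor of \<open>2\<close>. It is represented
  by its cheapest member, so that no monotonicity of the costs is needed.
\<close>

lemma cheap_representatives:
  fixes cost :: "nat \<times> nat \<Rightarrow> nat"
  assumes "n \<le> 2 ^ l"
  shows "\<exists>Z. finite Z \<and> card Z \<le> (l + 1) * (h * l + 1) \<and> (\<forall>(k, s)\<in>Z. 1 \<le> k \<and> k \<le> n \<and> 1 \<le> s) \<and>
    (\<forall>k s. 1 \<le> k \<and> k \<le> n \<and> 1 \<le> s \<and> s \<le> n ^ h \<longrightarrow>
      (\<exists>(k', s')\<in>Z. cost (k', s') \<le> cost (k, s) \<and> k' \<le> 2 * k \<and> k \<le> 2 * k' \<and> s \<le> 2 * s'))"
proof -
  define cls where "cls = (\<lambda>(i, j) (k, s). (2 :: nat) ^ i \<le> k \<and> k < 2 ^ (i + 1) \<and>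
    (2 :: nat) ^ j \<le> s \<and> s < 2 ^ (j + 1) \<and> 1 \<le> k \<and> k \<le> n \<and> 1 \<le> s \<and> s \<le> n ^ h)"
  define keys where "keys = {ij \<in> {..l} \<times> {..h * l}. \<exists>z. cls ij z}"
  define rep where "rep ij = arg_min cost (cls ij)" for ij
  have rep: "cls ij (rep ij)" "cost (rep ij) \<le> cost z" if "cls ij z" for ij z
  proof -
    have *: "cls ij (rep ij) \<and> (\<forall>y. cls ij y \<longrightarrow> cost (rep ij) \<le> cost y)"
      unfolding rep_def by (rule arg_min_nat_lemma[where P = "cls ij" and k = z and m = cost, OF that])
    show "cls ij (rep ij)" using * by (rule conjunct1)
    show "cost (rep ij) \<le> cost z" using that by (rule *[THEN conjunct2, THEN spec, THEN mp])
  qed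
  define Z where "Z = rep ` keys"
  have "card Z \<le> card ({..l} \<times> {..h * l})"
    unfolding Z_def by (rule order_trans[OF card_image_le card_mono]) (auto simp: keys_def)
  then have "card Z \<le> (l + 1) * (h * l + 1)" by simp
  moreover have "finite Z" by (simp add: Z_def keys_def)
  moreover have "1 \<le> k \<and> k \<le> n \<and> 1 \<le> s" if "(k, s) \<in> Z" for k s
  proof -
    from that obtain ij z where "(k, s) = rep ij" "cls ij z" by (auto simp: Z_def keys_def)
    with rep(1)[of ij z] have "cls ij (k, s)" by simp
    then show ?thesis by (auto simp: cls_def split: prod.splits)
  qed
  moreover have "\<exists>(k', s')\<in>Z. cost (k', s') \<le> cost (k, s) \<and> k' \<le> 2 * k \<and> k \<le> 2 * k' \<and> s \<le> 2 * s'"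
    if ks: "1 \<le> k" "k \<le> n" "1 \<le> s" "s \<le> n ^ h" for k s
  proof -
    obtain i j where ij: "2 ^ i \<le> k" "k < 2 ^ (i + 1)" "2 ^ j \<le> s" "s < 2 ^ (j + 1)"
      using ex_power_ivl1[of 2 k] ex_power_ivl1[of 2 s] ks by auto
    then have cls: "cls (i, j) (k, s)" using ks by (simp add: cls_def)
    have "(2 :: nat) ^ i \<le> 2 ^ l" using ij(1) ks(2) assms by linarith
    moreover have "(2 :: nat) ^ j \<le> 2 ^ (h * l)"
    proof -
      have "n ^ h \<le> (2 ^ l) ^ h" using assms by (rule power_mono) simp
      also have "((2 :: nat) ^ l) ^ h = 2 ^ (h * l)" by (simp add: power_mult[symmetric] mult.commute)
      finally show ?thesis using ij(3) ks(4) by linarith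
    qed
    ultimately have "(i, j) \<in> keys" using cls unfolding keys_def by auto
    moreover have "cls (i, j) (rep (i, j))" "cost (rep (i, j)) \<le> cost (k, s)" using rep[OF cls] by auto
    moreover obtain k' s' where z: "rep (i, j) = (k', s')" by (cases "rep (i, j)")
    ultimately have "(k', s') \<in> Z" "cost (k', s') \<le> cost (k, s)" "cls (i, j) (k', s')"
      by (auto simp: Z_def intro: rev_image_eqI)
    moreover from this(3) have "k' \<le> 2 * k \<and> k \<le> 2 * k' \<and> s \<le> 2 * s'"
      using ij by (auto simp: cls_def)
    ultimately show ?thesis by blast
  qed
  ultimately show ?thesis by (intro exI[of _ Z]) auto
qed

section \<open>Parameters for a failure probability of at most \<open>n ^ (-e)\<close>\<close>

definition log_ceil :: "nat \<Rightarrow> nat" where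
  "log_ceil n = nat \<lceil>log 2 (real n)\<rceil>"

text \<open>The constant 3 arises from \<open>log 2 n + 1 \<le> 2 * log 2 n\<close> and
  \<open>ln 2 \<ge> 2 / 3\<close>.\<close>

lemma log_ceil:
  assumes "n \<ge> 2"
  shows "n \<le> 2 ^ log_ceil n" "1 \<le> log_ceil n" "log_ceil n \<le> 3 * ln n"
proof -
  have 1: "1 \<le> log 2 n" using assms by (simp add: le_log_iff)
  then have l: "log 2 n \<le> log_ceil n" "log_ceil n \<le> log 2 n + 1" by (simp_all add: log_ceil_def)
  then have "real n \<le> 2 powr log_ceil n" using assms by (simp add: log_le_iff)
  then have "real n \<le> real (2 ^ log_ceil n)" by (simp add: powr_realpow)
  then show "n \<le> 2 ^ log_ceil n" by (simp only: of_nat_le_iff)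
  from 1 l(1) have "1 \<le> real (log_ceil n)" by linarith
  then show "1 \<le> log_ceil n" by simp
  have "2 * ln n \<le> 3 * ln 2 * ln n"
    using ln2_ge_two_thirds assms by (intro mult_right_mono) auto
  then have "2 * log 2 n \<le> 3 * ln n" by (simp add: log_def field_simps)
  with 1 l show "log_ceil n \<le> 3 * ln n" by linarith
qed

text \<open>There are at least \<open>16 * n ^ (e + 2)\<close> seeds: even the fraction
  \<open>n ^ (-e)\<close> of them that may fail exceeds \<open>n\<^sup>2\<close> by a factor of 16,
  which pays for the union bound over all \<open>2 ^ n\<^sup>2\<close> edge sets.\<close>

definition seed_length :: "nat \<Rightarrow> nat \<Rightarrow> nat" where
  "seed_length e n = (e + 2) * log_ceil n + 4"

text \<open>At least one good sample is expected in \<open>4 * h * (10 * h) ^ h\<close> batches;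
  \<open>e * log_ceil n + 4\<close> times as many miss with probability at most
  \<open>1 / (16 * n ^ e)\<close>.\<close>

definition batches :: "nat \<Rightarrow> nat \<Rightarrow> nat \<Rightarrow> nat" where
  "batches h e n = 4 * h * (10 * h) ^ h * (e * log_ceil n + 4)"

text \<open>Makes the probability of an overload at most
  \<open>n * (1 / 2) ^ slack e n \<le> 1 / (16 * n ^ e)\<close>.\<close>

definition slack :: "nat \<Rightarrow> nat \<Rightarrow> nat" where
  "slack e n = (e + 1) * log_ceil n + 4"

abbreviation found :: "nat \<Rightarrow> nat \<Rightarrow> nat \<Rightarrow> nat \<Rightarrow> nat \<Rightarrow> ((nat \<Rightarrow> nat) \<times> nat list list) list \<Rightarrow>
     (nat \<times> nat) set \<Rightarrow> bool" where
  "found h e n k s \<equiv> phase_found h n k s (batches h e n) (slack e n)"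

lemma card_bool_lists: "card {bs :: bool list. length bs = m} = 2 ^ m" "finite {bs :: bool list. length bs = m}"
  using card_lists_length_eq[of "UNIV :: bool set" m] finite_lists_length_eq[of "UNIV :: bool set" m] by auto

text \<open>The two sources of failure add up to at most \<open>\<epsilon>\<close>, so at most
  \<open>\<theta> / 8\<close> bad seeds are expected for a given graph, and \<open>\<theta>\<close>
  are tolerated. The requirement of \<open>seeds_exist\<close> becomes
  \<open>n\<^sup>2 + \<theta> / 4 < \<theta>\<close>, which follows from
  \<open>\<theta> \<ge> 16 * n\<^sup>2\<close>.\<close>

lemma seeds_for_phase:
  assumes "n \<ge> 2" "h \<ge> 2" "k \<ge> 1"
  shows "\<exists>t. \<forall>E. suitable h n k s E \<longrightarrow>
    card {\<sigma> :: bool list. length \<sigma> = seed_length e n \<and> \<not> found h e n k s (t \<sigma>) E} \<le> 2 ^ seed_length e n / real n ^ e"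
proof -
  let ?l = "log_ceil n" and ?G = "batches h e n" and ?L = "slack e n"
  define S where "S = {\<sigma> :: bool list. length \<sigma> = seed_length e n}"
  define \<Omega> where "\<Omega> = lists_over (random_samples n h k) (?G * s)"
  define B where "B E = {\<omega> \<in> \<Omega>. \<not> found h e n k s \<omega> E}" for E
  define \<epsilon> where "\<epsilon> = 1 / (8 * real n ^ e)"
  define \<theta> where "\<theta> = 2 ^ seed_length e n / real n ^ e"
  have n: "real n \<le> 2 ^ ?l" using log_ceil(1)[OF assms(1)] of_nat_le_iff[of n "2 ^ ?l", where ?'a = real] by simp
  have S: "finite S" "card S = 2 ^ seed_length e n" unfolding S_def by (rule card_bool_lists)+
  have \<Omega>: "finite \<Omega>" by (simp add: \<Omega>_def finite_lists_over finite_random_samples)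
  have "card \<Omega> > 0"
    using assms by (simp add: \<Omega>_def card_lists_over finite_random_samples card_random_samples)
  then have "\<Omega> \<noteq> {}" by auto
  let ?I = "{E. suitable h n k s E}"
  have sub: "?I \<subseteq> Pow ({..<n} \<times> {..<n})" by (auto simp: suitable_def)
  then have I: "finite ?I" by (rule finite_subset) simp
  have "card ?I \<le> card (Pow ({..<n} \<times> {..<n}))" using sub by (intro card_mono) auto
  also have "\<dots> = 2 ^ n\<^sup>2" by (simp add: card_Pow card_cartesian_product power2_eq_square)
  finally have "real (card ?I) \<le> real (2 ^ n\<^sup>2)" by (simp only: of_nat_le_iff)
  then have card_I: "real (card ?I) \<le> 2 powr n\<^sup>2" by (simp add: powr_realpow[symmetric])
  have pow: "real n ^ e \<le> 2 ^ (e * ?l)" using power_mono[OF n, of e] by (simp add: power_mult[symmetric] mult.commute)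
  have "real n ^ e * real n ^ 2 * 16 \<le> 2 ^ (e * ?l) * 2 ^ (2 * ?l) * 16"
    using pow power_mono[OF n, of 2] by (intro mult_mono) (simp_all add: power_mult[symmetric] mult.commute)
  also have "\<dots> = 2 ^ seed_length e n" by (simp add: seed_length_def power_add algebra_simps)
  finally have \<theta>: "16 * real n ^ 2 \<le> \<theta>" using assms by (simp add: \<theta>_def le_divide_eq mult_ac)
  have fail: "card (B E) \<le> \<epsilon> * card \<Omega>" if "suitable h n k s E" for E
  proof -
    let ?\<kappa> = "4 * real h * (10 * real h) ^ h"
    have "?\<kappa> > 0" using assms by simp
    have "real n * (1 / 2) ^ ?L \<le> 2 ^ ?l * (1 / 2) ^ ?L" using n by (intro mult_right_mono) auto
    also have "\<dots> = 1 / (16 * 2 ^ (e * ?l))" by (simp add: slack_def power_add power_one_over field_simps)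
    finally have 1: "real n * (1 / 2) ^ ?L \<le> 1 / (16 * 2 ^ (e * ?l))" .
    have "real ?G = ?\<kappa> * real (e * ?l + 4)" by (simp add: batches_def)
    then have "?G / ?\<kappa> = real (e * ?l + 4)" using \<open>?\<kappa> > 0\<close> by (metis less_irrefl nonzero_mult_div_cancel_left)
    then have "exp (- (?G / ?\<kappa>)) \<le> 2 powr (- real (e * ?l + 4))"
      using exp_minus_le_two_powr[of "real (e * ?l + 4)"] by simp
    also have "\<dots> = 1 / 2 powr (real (e * ?l + 4))" by (rule powr_minus_divide)
    also have "\<dots> = 1 / (16 * 2 ^ (e * ?l))" by (subst powr_realpow) (simp_all add: power_add)
    finally have 2: "exp (- (?G / ?\<kappa>)) \<le> 1 / (16 * 2 ^ (e * ?l))" .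
    have "real n * (1 / 2) ^ ?L + exp (- (?G / ?\<kappa>)) \<le> 1 / (8 * 2 ^ (e * ?l))" using 1 2 by simp
    also have "\<dots> \<le> \<epsilon>" unfolding \<epsilon>_def using pow assms by (intro divide_left_mono) auto
    finally have "(real n * (1 / 2) ^ ?L + exp (- (?G / ?\<kappa>))) * card \<Omega> \<le> \<epsilon> * card \<Omega>"
      by (intro mult_right_mono) auto
    with card_phase_failures[OF assms that, of ?G ?L] show ?thesis unfolding B_def \<Omega>_def by linarith
  qed
  have "\<exists>t\<in>S \<rightarrow>\<^sub>E \<Omega>. \<forall>E\<in>?I. card {\<sigma> \<in> S. t \<sigma> \<in> B E} \<le> \<theta>"
  proof (rule seeds_exist[OF S(1) \<Omega> I \<open>\<Omega> \<noteq> {}\<close>])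
    have "\<epsilon> * card S = \<theta> / 8" by (simp add: \<epsilon>_def \<theta>_def S)
    moreover have "0 \<le> \<theta>" by (simp add: \<theta>_def)
    then have "exp (\<theta> / 8) \<le> 2 powr (\<theta> / 4)" using exp_le_two_powr[of "\<theta> / 8"] by simp
    ultimately have "card ?I * exp (\<epsilon> * card S) \<le> 2 powr n\<^sup>2 * 2 powr (\<theta> / 4)"
      using card_I by (intro mult_mono) auto
    also have "\<dots> = 2 powr (n\<^sup>2 + \<theta> / 4)" by (simp add: powr_add)
    also have "\<dots> < 2 powr \<theta>"
    proof -
      have "0 < real n ^ 2" using assms by simp
      then have "real (n\<^sup>2) + \<theta> / 4 < \<theta>" using \<theta> unfolding of_nat_power by linarith
      then show ?thesis by (intro powr_less_mono) auto
    qed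
    finally show "card ?I * exp (\<epsilon> * card S) < 2 powr \<theta>" .
  qed (use fail in \<open>auto simp: B_def\<close>)
  then obtain t where t: "t \<in> S \<rightarrow>\<^sub>E \<Omega>" "\<And>E. suitable h n k s E \<Longrightarrow> card {\<sigma> \<in> S. t \<sigma> \<in> B E} \<le> \<theta>"
    by blast
  have "{\<sigma> \<in> S. t \<sigma> \<in> B E} = {\<sigma> :: bool list. length \<sigma> = seed_length e n \<and> \<not> found h e n k s (t \<sigma>) E}" for E
    using t(1) by (auto simp: B_def S_def)
  with t(2) show ?thesis unfolding \<theta>_def by (intro exI[of _ t]) auto
qed

definition overhead :: "nat \<Rightarrow> nat \<Rightarrow> nat \<Rightarrow> nat" where
  "overhead h e n = Suc (batches h e n * (4 * h * (68 + 2 * h * batches h e n + slack e n) + h))"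

text \<open>\<open>C\<close> and \<open>R\<close> are the two arguments of the \<open>max\<close> in
  \<open>MM\<close>, so both are bounded by it, and \<open>C \<ge> 1\<close> absorbs the rounds that
  depend on neither. \<open>overhead\<close> collects the resulting factor.\<close>

lemma reaches_phase:
  assumes "\<beta> \<ge> 1" "n \<ge> 2" "h \<ge> 2" "1 \<le> k" "k \<le> n" "1 \<le> s"
  shows "reaches \<beta> n (overhead h e n * MM \<beta> \<alpha> n k s) (\<lambda>(E, \<sigma>) v. (incident_edges E v, \<sigma>))
    (\<lambda>w v. case w of (E, \<sigma>) \<Rightarrow> found h e n k s (t \<sigma>) E)"
proof -
  define C where "C = nat \<lceil>real s * (real k)\<^sup>2 / (real n)\<^sup>2\<rceil>"
  define R where "R = (LEAST R. products_computable \<beta> \<alpha> n k s R)"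
  have M: "MM \<beta> \<alpha> n k s = max C R" by (simp add: MM_def C_def R_def)
  have "0 < real s * (real k)\<^sup>2 / (real n)\<^sup>2" using assms by simp
  then have "1 \<le> C" unfolding C_def by linarith
  have "real s * (real k)\<^sup>2 / (real n)\<^sup>2 \<le> C" unfolding C_def by linarith
  then have "real (s * k\<^sup>2) \<le> real (C * n\<^sup>2)" using assms by (simp add: divide_le_eq)
  then have sk: "s * k\<^sup>2 \<le> C * n\<^sup>2" by (simp only: of_nat_le_iff)
  have "products_computable \<beta> \<alpha> n k s R"
    unfolding R_def by (rule LeastI_ex) (rule products_computable_exists[OF assms(1,2)])
  then obtain d where d: "1 \<le> d" "d \<le> max 1 (k div block_rows n s)" "products_within \<beta> n k s d R"
    by (rule products_within) (use assms in auto)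
  let ?G = "batches h e n" and ?L = "slack e n"
  have "2 * (2 * h * (68 * C + 2 * h * ?G * C + ?L)) + (h - 2) * R \<le>
      (4 * h * (68 + 2 * h * ?G + ?L) + h) * max C R"
  proof -
    have "?L * 1 \<le> ?L * max C R" using \<open>1 \<le> C\<close> by (intro mult_le_mono2) simp
    moreover have "(68 + 2 * h * ?G) * C \<le> (68 + 2 * h * ?G) * max C R" by (intro mult_le_mono2) simp
    ultimately have "(68 + 2 * h * ?G) * C + ?L * 1 \<le> (68 + 2 * h * ?G) * max C R + ?L * max C R"
      by (intro add_le_mono)
    then have "68 * C + 2 * h * ?G * C + ?L \<le> (68 + 2 * h * ?G + ?L) * max C R"
      by (simp only: add_mult_distrib mult_1_right)
    then have "4 * h * (68 * C + 2 * h * ?G * C + ?L) + (h - 2) * R \<le>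
        4 * h * ((68 + 2 * h * ?G + ?L) * max C R) + h * max C R"
      by (intro add_le_mono mult_le_mono) auto
    also have "\<dots> = (4 * h * (68 + 2 * h * ?G + ?L) + h) * max C R"
      by (simp only: add_mult_distrib mult.assoc)
    finally show ?thesis by simp
  qed
  then have "?G * (2 * (2 * h * (68 * C + 2 * h * ?G * C + ?L)) + (h - 2) * R) \<le>
      ?G * ((4 * h * (68 + 2 * h * ?G + ?L) + h) * max C R)" by (rule mult_le_mono2)
  moreover have "1 \<le> max C R" using \<open>1 \<le> C\<close> by simp
  ultimately have "Suc (?G * (2 * (2 * h * (68 * C + 2 * h * ?G * C + ?L)) + (h - 2) * R)) \<le>
      overhead h e n * max C R"
    unfolding overhead_def mult_Suc mult.assoc by linarith
  then have "reaches \<beta> n (overhead h e n * MM \<beta> \<alpha> n k s) incident_edges (\<lambda>E v. found h e n k s (t \<sigma>) E)" for \<sigma>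
    unfolding M
    by (intro reaches_mono[OF reaches_sample_phase[OF assms \<open>1 \<le> C\<close> sk d]])
  from reaches_public[of \<beta> n _ incident_edges "\<lambda>\<sigma> E v. found h e n k s (t \<sigma>) E", OF this]
  show ?thesis by (simp add: case_prod_unfold)
qed

lemma reaches_seed:
  assumes "\<beta> \<ge> 1" "n \<ge> 2"
  shows "reaches \<beta> n m (\<lambda>(E, \<omega>). graph_input E \<omega>)
    (\<lambda>(E, \<omega>) v. (incident_edges E v, map ((!) (\<omega> 0)) [0..<m]))"
  by (rule reaches_local[OF reaches_exchange[OF assms, of m _ "\<lambda>r u i v. snd i ! r"],
        where \<phi> = "\<lambda>v i x. (fst i, map (\<lambda>r. x r 0) [0..<m])"])
     (use assms in \<open>auto simp: graph_input_def\<close>)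

text \<open>Separates combinatorics from probability: chance only enters through a set
  \<open>B\<close> of bad strings of vertex 0. \<open>B\<close> may depend on the graph and on
  \<open>k\<close> and \<open>s\<close>, whereas the protocol may not.\<close>

definition detects_cycles ::
    "nat \<Rightarrow> nat \<Rightarrow> nat \<Rightarrow> nat \<Rightarrow> nat \<Rightarrow> ((nat \<times> nat) set \<times> bool list, bool) protocol \<Rightarrow> bool" where
  "detects_cycles h \<beta> \<alpha> e n P \<longleftrightarrow> bandwidth_bounded \<beta> n P \<and>
    (\<exists>R. \<forall>E \<omega>. terminates_within n P (graph_input E \<omega>) R) \<and>
    (\<forall>E \<omega> v R. cycle_sequences h E = {} \<longrightarrow> v < n \<longrightarrow> \<not> outputs_within n P (graph_input E \<omega>) R v True) \<and>
    (\<forall>E k s. E \<subseteq> {..<n} \<times> {..<n} \<and> cycle_sequences h E \<noteq> {} \<and> 1 \<le> k \<and> k \<le> n \<and> 1 \<le> s \<and> s \<le> n ^ h \<and>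
       n \<le> k * card (cycle_vertices h E) \<and> k * card (cycle_vertices h E) \<le> 2 * n \<and>
       card (cycle_vertices h E) ^ h \<le> 2 * h * s * card (cycle_sequences h E) \<longrightarrow>
       (\<exists>B. card {\<sigma> \<in> B. length \<sigma> = seed_length e n} \<le> 2 ^ seed_length e n / real n ^ e \<and>
         (\<forall>\<omega> v. length (\<omega> 0) = seed_length e n \<and> \<omega> 0 \<notin> B \<and> v < n \<longrightarrow>
           outputs_within n P (graph_input E \<omega>) (seed_length e n +
             (log_ceil n + 1) * (h * log_ceil n + 1) * (overhead h e n * MM \<beta> \<alpha> n k s)) v True)))"

text \<open>If \<open>(k, s)\<close> fits the graph, its representative \<open>(k', s')\<close> is
  \<open>suitable\<close> and costs no more. The phases before it cost at most as much each, so the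
  number of phases times the cost of \<open>(k, s)\<close> bounds the time.\<close>

lemma cycle_detection_protocol:
  assumes "\<beta> \<ge> 1" "n \<ge> 2" "h \<ge> 2"
  shows "\<exists>P. detects_cycles h \<beta> \<alpha> e n P"
proof -
  let ?l = "log_ceil n" and ?m = "seed_length e n" and ?\<Lambda> = "overhead h e n"
  let ?seed = "\<lambda>\<omega> :: nat \<Rightarrow> bool list. map ((!) (\<omega> 0)) [0..<?m]"
  define cost where "cost = (\<lambda>(k, s). MM \<beta> \<alpha> n (real k) (real s))"
  from cheap_representatives[OF log_ceil(1)[OF \<open>n \<ge> 2\<close>], of h cost] obtain Z where
    Z: "finite Z" "card Z \<le> (?l + 1) * (h * ?l + 1)" "\<forall>(k, s)\<in>Z. 1 \<le> k \<and> k \<le> n \<and> 1 \<le> s"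
    and cover: "\<And>k s. 1 \<le> k \<Longrightarrow> k \<le> n \<Longrightarrow> 1 \<le> s \<Longrightarrow> s \<le> n ^ h \<Longrightarrow>
      \<exists>(k', s')\<in>Z. cost (k', s') \<le> cost (k, s) \<and> k' \<le> 2 * k \<and> k \<le> 2 * k' \<and> s \<le> 2 * s'"
    by blast
  \<comment> \<open>One table per pair of parameters, fixed for all graphs. The same seed is used in
    all phases; no independence is lost, since the success of a single phase is enough.\<close>
  define t where "t k s = (SOME t. \<forall>E. suitable h n k s E \<longrightarrow>
    card {\<sigma> :: bool list. length \<sigma> = ?m \<and> \<not> found h e n k s (t \<sigma>) E} \<le> 2 ^ ?m / real n ^ e)" for k s
  have t: "card {\<sigma> :: bool list. length \<sigma> = ?m \<and> \<not> found h e n k s (t k s \<sigma>) E} \<le> 2 ^ ?m / real n ^ e"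
    if "1 \<le> k" "suitable h n k s E" for k s E
    using someI_ex[OF seeds_for_phase[OF assms(2,3) that(1)], of s e] that(2) unfolding t_def by blast
  define b where "b = (\<lambda>(k, s) (E, \<sigma>). found h e n k s (t k s \<sigma>) E)"
  from finite_distinct_list[OF Z(1)] obtain zs0 where zs0: "set zs0 = Z" "distinct zs0" by blast
  define zs where "zs = sort_key (\<lambda>z. ?\<Lambda> * cost z) zs0"
  have zs: "set zs = Z" "length zs = card Z" "sorted (map (\<lambda>z. ?\<Lambda> * cost z) zs)"
    using zs0 distinct_card[OF zs0(2)] by (simp_all add: zs_def)
  let ?f = "\<lambda>(E, \<sigma>) v. (incident_edges E v, \<sigma> :: bool list)"
  have phase: "\<forall>z\<in>set zs. reaches \<beta> n (?\<Lambda> * cost z) ?f (\<lambda>w v. b z w)"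
  proof
    fix z assume "z \<in> set zs"
    obtain k s where z: "z = (k, s)" by (cases z)
    with \<open>z \<in> set zs\<close> Z(3) have "1 \<le> k" "k \<le> n" "1 \<le> s" by (auto simp: zs)
    from reaches_phase[OF assms this, of e \<alpha> "t k s"] show "reaches \<beta> n (?\<Lambda> * cost z) ?f (\<lambda>w v. b z w)"
      by (simp add: z cost_def b_def case_prod_unfold)
  qed
  from phases_protocol[OF phase zs(3)]
  obtain Q :: "((nat \<times> nat) set \<times> bool list, bool) protocol" where Q0: "bandwidth_bounded \<beta> n Q"
    "\<forall>w. \<forall>v<n. (\<forall>z\<in>set zs. b z w \<longrightarrow>
        outputs_within n Q (?f w) (length zs * (?\<Lambda> * cost z)) v True) \<and>
      ((\<forall>z\<in>set zs. \<not> b z w) \<longrightarrow>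
        outputs_within n Q (?f w) (sum_list (map (\<lambda>z. ?\<Lambda> * cost z) zs)) v False)"
    by (elim exE conjE) (rule that)
  have Q: "bandwidth_bounded \<beta> n Q"
    "v < n \<Longrightarrow> z \<in> set zs \<Longrightarrow> b z w \<Longrightarrow>
        outputs_within n Q (?f w) (length zs * (?\<Lambda> * cost z)) v True"
    "v < n \<Longrightarrow> (\<forall>z\<in>set zs. \<not> b z w) \<Longrightarrow>
        outputs_within n Q (?f w) (sum_list (map (\<lambda>z. ?\<Lambda> * cost z) zs)) v False" for w v z
    using Q0(1) Q0(2)[rule_format, of v w] by simp_all
  from reaches_seed[OF assms(1,2), of ?m]
  obtain P0 :: "(_, unit) protocol" and out where P0: "bandwidth_bounded \<beta> n P0"
    "\<And>w v. v < n \<Longrightarrow> out v ((\<lambda>(E, \<omega>). graph_input E \<omega>) w v)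
       (view_after n P0 ((\<lambda>(E, \<omega>). graph_input E \<omega>) w) ?m v) =
      (\<lambda>(E, \<omega>) v. (incident_edges E v, ?seed \<omega>)) w v"
    by (rule reachesE) (rule that)
  define P where "P = sequential ?m out P0 Q"
  have out: "outputs_within n P (graph_input E \<omega>) (?m + R) v y"
    if "outputs_within n Q (?f (E, ?seed \<omega>)) R v y" "v < n" for E \<omega> R v y
    unfolding P_def
    by (rule outputs_sequential[where inp' = "?f (E, ?seed \<omega>)"]) (use that P0(2)[of _ "(E, \<omega>)"] in auto)
  show ?thesis unfolding detects_cycles_def
  proof (rule exI[of _ P], intro conjI allI impI)
    show "bandwidth_bounded \<beta> n P" unfolding P_def by (rule bandwidth_sequential[OF P0(1) Q(1)])
    let ?sum = "sum_list (map (\<lambda>z. ?\<Lambda> * cost z) zs)"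
    show "\<exists>R. \<forall>E \<omega>. terminates_within n P (graph_input E \<omega>) R"
    proof (intro exI allI)
      fix E \<omega>
      show "terminates_within n P (graph_input E \<omega>) (?m + (length zs * ?sum + ?sum))"
        unfolding terminates_within_def
      proof (intro allI impI)
        fix v assume v: "v < n"
        show "\<exists>y. outputs_within n P (graph_input E \<omega>) (?m + (length zs * ?sum + ?sum)) v y"
        proof (cases "\<exists>z\<in>set zs. b z (E, ?seed \<omega>)")
          case True
          then obtain z where z: "z \<in> set zs" "b z (E, ?seed \<omega>)" by blast
          then have "?\<Lambda> * cost z \<le> ?sum" by (intro member_le_sum_list) auto
          then have "length zs * (?\<Lambda> * cost z) \<le> length zs * ?sum + ?sum"
            by (intro trans_le_add1 mult_le_mono2)
          from outputs_within_mono[OF Q(2)[OF v z] this] show ?thesis using out v by blast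
        next
          case False
          then have "outputs_within n Q (?f (E, ?seed \<omega>)) ?sum v False" using Q(3) v by blast
          from outputs_within_mono[OF this, of "length zs * ?sum + ?sum"] show ?thesis
            using out v by (metis le_add2)
        qed
      qed
    qed
  next
    fix E \<omega> v R assume "cycle_sequences h E = {}" "v < n"
    then have "\<forall>z\<in>set zs. \<not> b z (E, ?seed \<omega>)"
      using phase_found_sound by (auto simp: b_def split: prod.splits)
    then have no: "outputs_within n P (graph_input E \<omega>) (?m + sum_list (map (\<lambda>z. ?\<Lambda> * cost z) zs)) v False"
      using out Q(3) \<open>v < n\<close> by blast
    show "\<not> outputs_within n P (graph_input E \<omega>) R v True"
    proof
      assume "outputs_within n P (graph_input E \<omega>) R v True"
      from outputs_within_unique[OF this no] show False by simp
    qed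
  next
    fix E k s
    let ?x = "card (cycle_vertices h E)" and ?q = "card (cycle_sequences h E)"
    assume *: "E \<subseteq> {..<n} \<times> {..<n} \<and> cycle_sequences h E \<noteq> {} \<and> 1 \<le> k \<and> k \<le> n \<and> 1 \<le> s \<and> s \<le> n ^ h \<and>
       n \<le> k * ?x \<and> k * ?x \<le> 2 * n \<and> ?x ^ h \<le> 2 * h * s * ?q"
    then obtain k' s' where z: "(k', s') \<in> Z" "cost (k', s') \<le> cost (k, s)"
      "k' \<le> 2 * k" "k \<le> 2 * k'" "s \<le> 2 * s'"
      using cover[of k s] by auto
    have "1 \<le> k'" using Z(3) z(1) by auto
    have "k * ?x \<le> 2 * (k' * ?x)" "k' * ?x \<le> 2 * (k * ?x)"
      using mult_le_mono1[OF z(4), of ?x] mult_le_mono1[OF z(3), of ?x] by (simp_all only: mult.assoc)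
    with * have "n \<le> 2 * (k' * ?x)" "k' * ?x \<le> 4 * n" by linarith+
    then have "real n \<le> real (2 * (k' * ?x))" "real (k' * ?x) \<le> real (4 * n)" by (simp_all only: of_nat_le_iff)
    then have k': "1 / 2 \<le> k' * real ?x / n" "k' * real ?x / n \<le> 4"
      using \<open>n \<ge> 2\<close> by (simp_all add: field_simps)
    have "2 * h * s * ?q \<le> 4 * h * s' * ?q"
      using mult_le_mono[OF mult_le_mono2[OF z(5), of "2 * h"], of ?q ?q] by (simp add: mult_ac)
    then have "?x ^ h \<le> 4 * h * s' * ?q" using * by linarith
    then have "real (?x ^ h) \<le> real (4 * h * s' * ?q)" by (simp only: of_nat_le_iff)
    then have suit: "suitable h n k' s' E"
      unfolding suitable_def Let_def using * k' by simp
    show "\<exists>B. card {\<sigma> \<in> B. length \<sigma> = ?m} \<le> 2 ^ ?m / real n ^ e \<and>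
         (\<forall>\<omega> v. length (\<omega> 0) = ?m \<and> \<omega> 0 \<notin> B \<and> v < n \<longrightarrow>
           outputs_within n P (graph_input E \<omega>)
             (?m + (?l + 1) * (h * ?l + 1) * (?\<Lambda> * MM \<beta> \<alpha> n k s)) v True)"
    proof (intro exI[of _ "{\<sigma> :: bool list. \<not> found h e n k' s' (t k' s' \<sigma>) E}"] conjI allI impI)
      have "{\<sigma> \<in> {\<sigma> :: bool list. \<not> found h e n k' s' (t k' s' \<sigma>) E}. length \<sigma> = ?m} =
          {\<sigma> :: bool list. length \<sigma> = ?m \<and> \<not> found h e n k' s' (t k' s' \<sigma>) E}" by auto
      then show "card {\<sigma> \<in> {\<sigma> :: bool list. \<not> found h e n k' s' (t k' s' \<sigma>) E}. length \<sigma> = ?m} \<le> 2 ^ ?m / real n ^ e"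
        using t[OF \<open>1 \<le> k'\<close> suit] by simp
      fix \<omega> :: "nat \<Rightarrow> bool list" and v
      assume \<omega>: "length (\<omega> 0) = ?m \<and> \<omega> 0 \<notin> {\<sigma> :: bool list. \<not> found h e n k' s' (t k' s' \<sigma>) E} \<and> v < n"
      then have "?seed \<omega> = \<omega> 0" using map_nth[of "\<omega> 0"] by simp
      with \<omega> have "b (k', s') (E, ?seed \<omega>)" by (simp add: b_def)
      then have "outputs_within n P (graph_input E \<omega>) (?m + length zs * (?\<Lambda> * cost (k', s'))) v True"
        using out Q(2) z(1) zs(1) \<omega> by blast
      moreover have "length zs * (?\<Lambda> * cost (k', s')) \<le> (?l + 1) * (h * ?l + 1) * (?\<Lambda> * cost (k, s))"
        unfolding zs(2) using Z(2) z(2) by (intro mult_le_mono) auto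
      ultimately show "outputs_within n P (graph_input E \<omega>)
          (?m + (?l + 1) * (h * ?l + 1) * (?\<Lambda> * MM \<beta> \<alpha> n k s)) v True"
        by (elim outputs_within_mono) (simp add: cost_def)
    qed
  qed
qed

text \<open>Fewer than 2 vertices carry no sequence of \<open>h \<ge> 2\<close> distinct ones, so
  the constant answer is right. This case is separate because messages are empty here.\<close>

lemma trivial_detection_protocol:
  assumes "n < 2" "h \<ge> 2"
  shows "detects_cycles h \<beta> \<alpha> e n \<lparr>send = \<lambda>_ _ _ _. [], decide = \<lambda>_ _ _. Some False\<rparr>"
    (is "detects_cycles h \<beta> \<alpha> e n ?P")
proof -
  have out: "outputs_within n ?P inp 0 v False" for inp v by (simp add: outputs_within_def)
  have no: "\<not> outputs_within n ?P inp R v True" for inp R v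
    using outputs_within_unique[OF out[of inp v], of R True] by auto
  have none: "cycle_sequences h E = {}" if "E \<subseteq> {..<n} \<times> {..<n}" for E
  proof (rule ccontr)
    assume "cycle_sequences h E \<noteq> {}"
    then obtain vs where "vs \<in> cycle_sequences h E" by blast
    with cycle_sequences_vertices[OF that \<open>h \<ge> 2\<close>] have "set vs \<subseteq> {..<n}" "distinct vs" "length vs = h"
      by (auto simp: cycle_vertices_def cycle_sequences_def)
    then show False using card_mono[of "{..<n}" "set vs"] assms by (simp add: distinct_card)
  qed
  have "\<exists>R. \<forall>E \<omega>. terminates_within n ?P (graph_input E \<omega>) R"
    using out unfolding terminates_within_def by blast
  with no none show ?thesis unfolding detects_cycles_def
    by (auto simp: bandwidth_bounded_def)
qed

lemma detects_cycles_success: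
  assumes "detects_cycles h \<beta> \<alpha> e n P" "E \<subseteq> {..<n} \<times> {..<n}" "cycle_sequences h E \<noteq> {}"
    "1 \<le> k" "k \<le> n" "1 \<le> s" "s \<le> n ^ h"
    "n \<le> k * card (cycle_vertices h E)" "k * card (cycle_vertices h E) \<le> 2 * n"
    "card (cycle_vertices h E) ^ h \<le> 2 * h * s * card (cycle_sequences h E)"
  obtains B where "card {\<sigma> \<in> B. length \<sigma> = seed_length e n} \<le> 2 ^ seed_length e n / real n ^ e"
    and "\<And>\<omega> v. length (\<omega> 0) = seed_length e n \<Longrightarrow> \<omega> 0 \<notin> B \<Longrightarrow> v < n \<Longrightarrow>
      outputs_within n P (graph_input E \<omega>) (seed_length e n +
        (log_ceil n + 1) * (h * log_ceil n + 1) * (overhead h e n * MM \<beta> \<alpha> n k s)) v True"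
proof -
  have "\<exists>B. card {\<sigma> \<in> B. length \<sigma> = seed_length e n} \<le> 2 ^ seed_length e n / real n ^ e \<and>
         (\<forall>\<omega> v. length (\<omega> 0) = seed_length e n \<and> \<omega> 0 \<notin> B \<and> v < n \<longrightarrow>
           outputs_within n P (graph_input E \<omega>) (seed_length e n +
             (log_ceil n + 1) * (h * log_ceil n + 1) * (overhead h e n * MM \<beta> \<alpha> n k s)) v True)"
    using assms(1) unfolding detects_cycles_def
    by (elim conjE allE[of _ E] allE[of _ k] allE[of _ s]) (use assms(2-) in simp)
  with that show ?thesis by blast
qed

text \<open>With \<open>l = log_ceil n\<close> the number of phases is of order
  \<open>l\<^sup>2\<close>. So is \<open>overhead\<close>, because the routing time of each of the
  batches is bounded by the load of all of them. Together this gives the exponent 4.\<close>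

lemma running_time_polylog:
  "\<exists>K0. \<forall>n M. n \<ge> 2 \<longrightarrow> M \<ge> 1 \<longrightarrow> seed_length e n +
     (log_ceil n + 1) * (h * log_ceil n + 1) * (overhead h e n * M) \<le> K0 * log_ceil n ^ 4 * M"
proof -
  define g where "g = 4 * h * (10 * h) ^ h * (e + 4)"
  define w where "w = 68 + 2 * h * g + e + 5"
  define b where "b = g * (4 * h * w + h) + 1"
  have "seed_length e n + (log_ceil n + 1) * (h * log_ceil n + 1) * (overhead h e n * M) \<le>
      (e + 6 + 2 * (h + 1) * b) * log_ceil n ^ 4 * M" if "n \<ge> 2" "M \<ge> 1" for n M
  proof -
    define l where "l = log_ceil n"
    have "1 \<le> l" using log_ceil(2)[OF that(1)] by (simp add: l_def)
    have "e * l + 4 \<le> (e + 4) * l" "slack e n \<le> (e + 5) * l" "seed_length e n \<le> (e + 6) * l"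
      using \<open>1 \<le> l\<close> by (simp_all add: slack_def seed_length_def l_def[symmetric] algebra_simps)
    have G: "batches h e n \<le> g * l"
      unfolding batches_def g_def l_def[symmetric] mult.assoc
      by (intro mult_le_mono2) (use \<open>e * l + 4 \<le> (e + 4) * l\<close> in simp)
    have "68 + 2 * h * batches h e n + slack e n \<le> 68 * l + 2 * h * (g * l) + (e + 5) * l"
      using \<open>1 \<le> l\<close> \<open>slack e n \<le> (e + 5) * l\<close> G by (intro add_le_mono mult_le_mono2) auto
    also have "\<dots> = w * l" by (simp add: w_def algebra_simps)
    finally have *: "4 * h * (68 + 2 * h * batches h e n + slack e n) + h \<le> 4 * h * (w * l) + h * l"
      using \<open>1 \<le> l\<close> by (intro add_le_mono mult_le_mono2) auto
    have "batches h e n * (4 * h * (68 + 2 * h * batches h e n + slack e n) + h) + 1 \<le>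
        g * l * (4 * h * (w * l) + h * l) + l * l"
      using \<open>1 \<le> l\<close> by (intro add_le_mono[OF mult_le_mono[OF G *]]) simp
    also have "\<dots> = b * l\<^sup>2" by (simp add: b_def algebra_simps power2_eq_square)
    finally have "overhead h e n \<le> b * l\<^sup>2" by (simp add: overhead_def)
    then have "(l + 1) * (h * l + 1) * (overhead h e n * M) \<le> (2 * l) * ((h + 1) * l) * (b * l\<^sup>2 * M)"
      using \<open>1 \<le> l\<close> by (intro mult_le_mono) auto
    also have "\<dots> = 2 * (h + 1) * b * l ^ 4 * M"
      by (simp add: power2_eq_square power4_eq_xxxx algebra_simps)
    finally have 1: "(l + 1) * (h * l + 1) * (overhead h e n * M) \<le> 2 * (h + 1) * b * l ^ 4 * M" .
    have "l ^ 1 \<le> l ^ 4" using \<open>1 \<le> l\<close> by (intro power_increasing) auto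
    then have "(e + 6) * l * 1 \<le> (e + 6) * l ^ 4 * M" using that(2) by (intro mult_le_mono) auto
    with \<open>seed_length e n \<le> (e + 6) * l\<close> have "seed_length e n \<le> (e + 6) * l ^ 4 * M" by linarith
    with 1 have "seed_length e n + (l + 1) * (h * l + 1) * (overhead h e n * M) \<le>
        (e + 6) * l ^ 4 * M + 2 * (h + 1) * b * l ^ 4 * M" by linarith
    also have "\<dots> = (e + 6 + 2 * (h + 1) * b) * l ^ 4 * M" by (simp only: add_mult_distrib)
    finally show ?thesis unfolding l_def .
  qed
  then show ?thesis by blast
qed

text \<open>The \<open>LEAST\<close> in \<open>MM\<close> sees its parameters only after rounding,
  so just the first argument of \<open>max\<close> changes. There \<open>k \<le> 2 * z\<close>,
  \<open>s \<le> y + 1\<close> and \<open>z \<le> n\<close> give at most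
  \<open>4 * M + 4 \<le> 8 * M\<close>.\<close>

lemma MM_rounding:
  fixes x n \<alpha> \<beta> :: nat and y :: real
  assumes "1 \<le> x" "x \<le> n" "y > 0"
  defines "M \<equiv> MM \<beta> \<alpha> n (real n / real x) y"
  shows "MM \<beta> \<alpha> n (real (nat \<lceil>real n / real x\<rceil>)) (real (nat \<lceil>y\<rceil>)) \<le> 8 * M" "1 \<le> M"
proof -
  define k where "k = nat \<lceil>real n / real x\<rceil>"
  define s where "s = nat \<lceil>y\<rceil>"
  define R where "R = (LEAST R. products_computable \<beta> \<alpha> n k s R)"
  define z where "z = real n / real x"
  have n: "1 \<le> real n" "1 \<le> real x" "real x \<le> real n" using assms by auto
  then have z: "1 \<le> z" "z \<le> n" by (simp_all add: z_def field_simps)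
  have M: "M = max (nat \<lceil>y * z\<^sup>2 / (real n)\<^sup>2\<rceil>) R"
    by (simp add: M_def MM_def R_def k_def s_def z_def)
  have "0 < y * z\<^sup>2 / (real n)\<^sup>2" using assms z n by simp
  then show "1 \<le> M" unfolding M by linarith
  have yz: "y * z\<^sup>2 / (real n)\<^sup>2 \<le> M" unfolding M by linarith
  have k: "real k \<le> 2 * z" and s: "real s \<le> y + 1"
    using z assms(3) by (simp_all add: k_def s_def z_def[symmetric]) linarith+
  have "real s * (real k)\<^sup>2 \<le> (y + 1) * (2 * z)\<^sup>2"
    using k s assms(3) z by (intro mult_mono power_mono) auto
  also have "\<dots> = 4 * (y * z\<^sup>2) + 4 * z\<^sup>2" by (simp add: algebra_simps power2_eq_square)
  also have "\<dots> \<le> 4 * (y * z\<^sup>2) + 4 * (real n)\<^sup>2" using z by (intro add_left_mono mult_left_mono power_mono) auto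
  finally have "real s * (real k)\<^sup>2 / (real n)\<^sup>2 \<le> (4 * (y * z\<^sup>2) + 4 * (real n)\<^sup>2) / (real n)\<^sup>2"
    by (rule divide_right_mono) simp
  also have "\<dots> = 4 * (y * z\<^sup>2 / (real n)\<^sup>2) + 4" using n by (simp add: add_divide_distrib)
  also have "\<dots> \<le> real (8 * M)" using yz \<open>1 \<le> M\<close> by simp
  finally have "nat \<lceil>real s * (real k)\<^sup>2 / (real n)\<^sup>2\<rceil> \<le> 8 * M" by linarith
  moreover have "R \<le> 8 * M" unfolding M by simp
  moreover have "MM \<beta> \<alpha> n (real k) (real s) = max (nat \<lceil>real s * (real k)\<^sup>2 / (real n)\<^sup>2\<rceil>) R"
    by (simp add: MM_def R_def)
  ultimately show "MM \<beta> \<alpha> n (real (nat \<lceil>real n / real x\<rceil>)) (real (nat \<lceil>y\<rceil>)) \<le> 8 * M"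
    unfolding k_def s_def by simp
qed

text \<open>The string of vertex 0 is uniformly distributed, being a component of a product
  distribution, so counting bad seeds bounds the probability.\<close>

lemma prob_seed:
  assumes "n > 0" and "card {\<sigma> \<in> B. length \<sigma> = m} \<le> 2 ^ m * (\<delta> :: real)"
  shows "1 - \<delta> \<le> measure_pmf.prob (coins n m) {\<omega>. length (\<omega> 0) = m \<and> \<omega> 0 \<notin> B}"
proof -
  let ?S = "{bs :: bool list. length bs = m}"
  have S: "finite ?S" "?S \<noteq> {}" using card_bool_lists[of m] by (auto intro: exI[of _ "replicate m True"])
  have seed: "map_pmf (\<lambda>\<omega>. \<omega> 0) (coins n m) = pmf_of_set ?S"
    using \<open>n > 0\<close> unfolding coins_def by (subst Pi_pmf_component) auto
  have "measure_pmf.prob (coins n m) {\<omega>. length (\<omega> 0) = m \<and> \<omega> 0 \<notin> B} =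
      measure_pmf.prob (map_pmf (\<lambda>\<omega>. \<omega> 0) (coins n m)) {\<sigma>. length \<sigma> = m \<and> \<sigma> \<notin> B}"
    by (simp add: vimage_def)
  also have "\<dots> = measure_pmf.prob (pmf_of_set ?S) {\<sigma>. length \<sigma> = m \<and> \<sigma> \<notin> B}"
    unfolding seed ..
  also have "\<dots> = card (?S - {\<sigma> \<in> B. length \<sigma> = m}) / card ?S"
    using S by (subst measure_pmf_of_set) (auto intro!: arg_cong[of _ _ card])
  also have "card (?S - {\<sigma> \<in> B. length \<sigma> = m}) = card ?S - card {\<sigma> \<in> B. length \<sigma> = m}"
    using S by (intro card_Diff_subset) (auto intro: finite_subset)
  also have "real (card ?S - card {\<sigma> \<in> B. length \<sigma> = m}) = real (card ?S) - card {\<sigma> \<in> B. length \<sigma> = m}"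
    using S by (intro of_nat_diff card_mono) auto
  also have "\<dots> / card ?S \<ge> 1 - \<delta>"
    using assms(2) by (simp add: card_bool_lists field_simps)
  finally show ?thesis .
qed

text \<open>\<open>y\<close> stands for \<open>x powr \<delta>\<close>. Besides its range, the only
  condition on it is the density bound that makes about \<open>y\<close> samples per batch
  sufficient, so that one statement serves both classes of graphs.\<close>

lemma cycle_detection_algorithm:
  fixes h \<beta> \<alpha> :: nat and c :: real
  assumes "h \<ge> 2" "\<beta> \<ge> 1" "c > 0"
  shows "\<exists>A m.
    (\<forall>n. bandwidth_bounded \<beta> n (A n) \<and> (\<exists>R. \<forall>E \<omega>. terminates_within n (A n) (graph_input E \<omega>) R)) \<and>
    (\<forall>n E. cycle_sequences h E = {} \<longrightarrow> never_outputs_True A m n E) \<and>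
    (\<exists>(K :: real) (p :: nat). \<forall>n E (y :: real).
       E \<subseteq> {..<n} \<times> {..<n} \<and> cycle_sequences h E \<noteq> {} \<and> 0 < y \<and> y \<le> real n ^ h \<and>
       real (card (cycle_vertices h E)) ^ h \<le> 2 * h * y * card (cycle_sequences h E) \<longrightarrow>
       detection_probability A m n E
         (nat \<lfloor>K * ln (real n) ^ p * real (MM \<beta> \<alpha> n (real n / real (card (cycle_vertices h E))) y)\<rfloor>)
       \<ge> 1 - 1 / real n powr c)"
proof -
  define e where "e = nat \<lceil>c\<rceil>"
  define m where "m = seed_length e"
  have "\<exists>P. detects_cycles h \<beta> \<alpha> e n P" for n
    using cycle_detection_protocol[OF assms(2) _ assms(1)] trivial_detection_protocol[OF _ assms(1)]
    by (cases "n < 2") (blast, simp)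
  then obtain A where A: "\<And>n. detects_cycles h \<beta> \<alpha> e n (A n)" by metis
  from running_time_polylog[of e h] obtain K0 where K0: "\<And>n M. n \<ge> 2 \<Longrightarrow> M \<ge> 1 \<Longrightarrow> seed_length e n +
     (log_ceil n + 1) * (h * log_ceil n + 1) * (overhead h e n * M) \<le> K0 * log_ceil n ^ 4 * M" by blast
  show ?thesis
  proof (rule exI[of _ A], rule exI[of _ m], intro conjI allI impI)
    fix n
    show "bandwidth_bounded \<beta> n (A n)" using A[of n] unfolding detects_cycles_def by (elim conjE)
    show "\<exists>R. \<forall>E \<omega>. terminates_within n (A n) (graph_input E \<omega>) R"
      using A[of n] unfolding detects_cycles_def by (elim conjE)
  next
    fix n E assume "cycle_sequences h E = {}"
    then show "never_outputs_True A m n E"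
      using A[of n] unfolding detects_cycles_def never_outputs_True_def by blast
  next
    show "\<exists>(K :: real) (p :: nat). \<forall>n E (y :: real).
       E \<subseteq> {..<n} \<times> {..<n} \<and> cycle_sequences h E \<noteq> {} \<and> 0 < y \<and> y \<le> real n ^ h \<and>
       real (card (cycle_vertices h E)) ^ h \<le> 2 * h * y * card (cycle_sequences h E) \<longrightarrow>
       detection_probability A m n E
         (nat \<lfloor>K * ln (real n) ^ p * real (MM \<beta> \<alpha> n (real n / real (card (cycle_vertices h E))) y)\<rfloor>)
       \<ge> 1 - 1 / real n powr c"
    \<comment> \<open>\<open>648 = 81 * 8\<close>: the factor \<open>81 = 3 ^ 4\<close> replaces
      \<open>log_ceil n\<close> by \<open>ln n\<close>, and \<open>8\<close> accounts for rounding
      the parameters of \<open>MM\<close>.\<close>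
    proof (rule exI[of _ "real K0 * 648"], rule exI[of _ 4], intro allI impI, elim conjE)
      fix n E and y :: real
      assume E: "E \<subseteq> {..<n} \<times> {..<n}" "cycle_sequences h E \<noteq> {}" and y: "0 < y" "y \<le> real n ^ h"
        and xy: "real (card (cycle_vertices h E)) ^ h \<le> 2 * h * y * card (cycle_sequences h E)"
      define x where "x = card (cycle_vertices h E)"
      define q where "q = card (cycle_sequences h E)"
      define M where "M = MM \<beta> \<alpha> n (real n / real x) y"
      define k where "k = nat \<lceil>real n / real x\<rceil>"
      define s where "s = nat \<lceil>y\<rceil>"
      note X = cycle_sequences_vertices[OF E(1) \<open>h \<ge> 2\<close>]
      have "x \<le> n" using card_mono[OF _ X(1)] by (simp add: x_def)
      from E(2) obtain vs where "vs \<in> cycle_sequences h E" by blast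
      then have vs: "set vs \<subseteq> cycle_vertices h E" "card (set vs) = h"
        by (auto simp: cycle_vertices_def cycle_sequences_def distinct_card)
      have "h \<le> x" using card_mono[OF finite_subset[OF X(1)] vs(1)] vs(2) by (simp add: x_def)
      then have "1 \<le> x" "n \<ge> 2" using \<open>h \<ge> 2\<close> \<open>x \<le> n\<close> by auto
      have z: "1 \<le> real n / real x" "real n / real x \<le> n"
        using \<open>1 \<le> x\<close> \<open>x \<le> n\<close> by (simp_all add: field_simps)
      have k: "1 \<le> k" "k \<le> n" "n \<le> k * x" "k * x \<le> 2 * n"
      proof -
        show "1 \<le> k" "k \<le> n" using z unfolding k_def by linarith+
        have "real n / real x \<le> k" "real k \<le> 2 * (real n / real x)" using z unfolding k_def by linarith+
        then have "real n \<le> real (k * x)" "real (k * x) \<le> real (2 * n)"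
          using \<open>1 \<le> x\<close> by (simp_all add: field_simps)
        then show "n \<le> k * x" "k * x \<le> 2 * n" by (simp_all only: of_nat_le_iff)
      qed
      have s: "1 \<le> s" "y \<le> s" using y(1) unfolding s_def by linarith+
      have "y \<le> real_of_int (int (n ^ h))" using y(2) by simp
      then have "\<lceil>y\<rceil> \<le> int (n ^ h)" by (simp only: ceiling_le_iff)
      then have "s \<le> n ^ h" unfolding s_def by linarith
      have "real x ^ h \<le> 2 * h * y * q" using xy by (simp add: x_def q_def)
      also have "\<dots> \<le> 2 * h * real s * q" using s by (intro mult_right_mono mult_left_mono) auto
      finally have "real (x ^ h) \<le> real (2 * h * s * q)" by simp
      then have xs: "x ^ h \<le> 2 * h * s * q" by (simp only: of_nat_le_iff)
      obtain B where B: "card {\<sigma> \<in> B. length \<sigma> = m n} \<le> 2 ^ m n / real n ^ e"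
        "\<And>\<omega> v. length (\<omega> 0) = m n \<Longrightarrow> \<omega> 0 \<notin> B \<Longrightarrow> v < n \<Longrightarrow>
           outputs_within n (A n) (graph_input E \<omega>) (m n +
             (log_ceil n + 1) * (h * log_ceil n + 1) * (overhead h e n * MM \<beta> \<alpha> n k s)) v True"
        unfolding m_def
        by (rule detects_cycles_success[OF A E k(1,2) s(1) \<open>s \<le> n ^ h\<close> k(3,4)[unfolded x_def] xs[unfolded x_def q_def]])
          (rule that[unfolded m_def])
      let ?R = "nat \<lfloor>real K0 * 648 * ln (real n) ^ 4 * real M\<rfloor>"
      note M = MM_rounding[OF \<open>1 \<le> x\<close> \<open>x \<le> n\<close> y(1), where \<beta> = \<beta> and \<alpha> = \<alpha>, folded M_def k_def s_def]
      have "m n + (log_ceil n + 1) * (h * log_ceil n + 1) * (overhead h e n * MM \<beta> \<alpha> n k s) \<le>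
          m n + (log_ceil n + 1) * (h * log_ceil n + 1) * (overhead h e n * (8 * M))"
        using M(1) by (intro add_left_mono mult_le_mono2)
      also have "\<dots> \<le> K0 * log_ceil n ^ 4 * (8 * M)"
        unfolding m_def using M(2) \<open>n \<ge> 2\<close> by (intro K0) auto
      also have "\<dots> \<le> ?R"
      proof -
        have "real (log_ceil n) ^ 4 \<le> (3 * ln n) ^ 4"
          using log_ceil(3)[OF \<open>n \<ge> 2\<close>] by (intro power_mono) auto
        also have "\<dots> = 81 * ln n ^ 4" by (simp add: power_mult_distrib)
        finally have "real K0 * real (log_ceil n) ^ 4 * (8 * real M) \<le> real K0 * (81 * ln n ^ 4) * (8 * real M)"
          by (intro mult_right_mono mult_left_mono) auto
        then have "real (K0 * log_ceil n ^ 4 * (8 * M)) \<le> real K0 * 648 * ln (real n) ^ 4 * real M"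
          by (simp add: mult_ac)
        then show ?thesis by (simp only: le_nat_floor)
      qed
      finally have time: "m n + (log_ceil n + 1) * (h * log_ceil n + 1) * (overhead h e n * MM \<beta> \<alpha> n k s) \<le> ?R" .
      have "c \<le> real e" unfolding e_def by linarith
      then have "real n powr c \<le> real n powr real e" using \<open>n \<ge> 2\<close> by (intro powr_mono) auto
      then have "real n powr c \<le> real n ^ e" using \<open>n \<ge> 2\<close> by (simp add: powr_realpow)
      then have "1 / real n ^ e \<le> 1 / real n powr c" using \<open>n \<ge> 2\<close> by (intro divide_left_mono) auto
      then have "1 - 1 / real n powr c \<le> 1 - 1 / real n ^ e" by simp
      also have "\<dots> \<le> measure_pmf.prob (coins n (m n)) {\<omega>. length (\<omega> 0) = m n \<and> \<omega> 0 \<notin> B}"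
        using \<open>n \<ge> 2\<close> B(1) by (intro prob_seed) auto
      also have "\<dots> \<le> detection_probability A m n E ?R"
        unfolding detection_probability_def
      proof (rule measure_pmf.finite_measure_mono)
        show "{\<omega>. length (\<omega> 0) = m n \<and> \<omega> 0 \<notin> B} \<subseteq>
          {\<omega>. terminates_within n (A n) (graph_input E \<omega>) ?R \<and>
             (\<exists>v<n. outputs_within n (A n) (graph_input E \<omega>) ?R v True)}"
        proof
          fix \<omega> :: "nat \<Rightarrow> bool list" assume "\<omega> \<in> {\<omega>. length (\<omega> 0) = m n \<and> \<omega> 0 \<notin> B}"
          then have "outputs_within n (A n) (graph_input E \<omega>) ?R v True" if "v < n" for v
            using outputs_within_mono[OF B(2) time] that by blast
          moreover have "0 < n" using \<open>n \<ge> 2\<close> by simp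
          ultimately show "\<omega> \<in> {\<omega>. terminates_within n (A n) (graph_input E \<omega>) ?R \<and>
             (\<exists>v<n. outputs_within n (A n) (graph_input E \<omega>) ?R v True)}"
            unfolding terminates_within_def by blast
        qed
      qed simp
      finally show "1 - 1 / real n powr c \<le> detection_probability A m n E
         (nat \<lfloor>real K0 * 648 * ln (real n) ^ 4 * real (MM \<beta> \<alpha> n (real n / real (card (cycle_vertices h E))) y)\<rfloor>)"
        unfolding M_def x_def .
    qed
  qed
qed

section \<open>From vertex sequences to copies of cycles\<close>

lemma Field_closed_walk_edges: "vs \<noteq> [] \<Longrightarrow> Field (closed_walk_edges vs) = set vs"
proof (intro equalityI subsetI)
  fix v assume "vs \<noteq> []" "v \<in> set vs"
  then obtain i where "i < length vs" "v = vs ! i" by (auto simp: in_set_conv_nth)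
  then have "(v, vs ! (Suc i mod length vs)) \<in> closed_walk_edges vs" by (auto simp: closed_walk_edges_def)
  then show "v \<in> Field (closed_walk_edges vs)" by (rule FieldI1)
qed (auto simp: closed_walk_edges_def Field_def)

lemma directed_cycles_eq: "directed_cycles h E = closed_walk_edges ` cycle_sequences h E"
  by (auto simp: directed_cycles_def cycle_sequences_def)

lemma undirected_cycles_eq:
  "undirected_cycles h E = (\<lambda>vs. closed_walk_edges vs \<union> (closed_walk_edges vs)\<inverse>) ` cycle_sequences h E"
  by (auto simp: undirected_cycles_def cycle_sequences_def)

lemma covered_directed: "h > 0 \<Longrightarrow> covered_vertices (directed_cycles h E) = cycle_vertices h E"
  unfolding covered_vertices_def directed_cycles_eq cycle_vertices_def image_image
  by (intro SUP_cong refl Field_closed_walk_edges) (auto simp: cycle_sequences_def)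

lemma covered_undirected: "h > 0 \<Longrightarrow> covered_vertices (undirected_cycles h E) = cycle_vertices h E"
  unfolding covered_vertices_def undirected_cycles_eq cycle_vertices_def image_image
  by (intro SUP_cong refl) (auto simp: cycle_sequences_def Field_closed_walk_edges)

text \<open>\<open>a\<close> stands for \<open>2 * h * t\<close> or \<open>h * t\<close>, and the
  definition of \<open>\<delta>\<close> amounts to \<open>x ^ h = a * x powr \<delta>\<close>. Then
  \<open>a \<ge> 1\<close> keeps the number of samples below \<open>n ^ h\<close>, and
  \<open>a \<le> 2 * h * q\<close> makes it large enough.\<close>

lemma density_bounds:
  fixes a \<delta> :: real and x n h t q :: nat
  assumes "0 < x" "x \<le> n" "a \<ge> 1" "a \<le> 2 * h * q" and \<delta>: "real x powr (real h - \<delta>) = a"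
  shows "0 < real x powr \<delta>" "real x powr \<delta> \<le> real n ^ h" "real x ^ h \<le> 2 * h * (real x powr \<delta>) * q"
proof -
  show pos: "0 < real x powr \<delta>" using assms(1) by simp
  have "real x ^ h = real x powr (real h - \<delta>) * real x powr \<delta>"
    using assms(1) by (simp add: powr_add[symmetric] powr_realpow)
  then have eq: "real x ^ h = a * real x powr \<delta>" unfolding \<delta> .
  have "1 * real x powr \<delta> \<le> a * real x powr \<delta>" using assms(3) pos by (intro mult_right_mono) auto
  also have "\<dots> = real x ^ h" by (simp add: eq)
  also have "\<dots> \<le> real n ^ h" using assms(2) by (intro power_mono) auto
  finally show "real x powr \<delta> \<le> real n ^ h" by simp
  have "a * real x powr \<delta> \<le> (2 * h * q) * real x powr \<delta>" using assms(4) pos by (intro mult_right_mono) auto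
  then show "real x ^ h \<le> 2 * h * (real x powr \<delta>) * q" by (simp add: eq mult_ac)
qed

text \<open>Copies are images of vertex sequences under \<open>F\<close>, so \<open>t\<close> is at
  most the number of sequences, and the factor \<open>a \<le> 2 * h\<close> is covered by the
  constant in the density bound.\<close>

lemma cycle_detection_for_class:
  fixes h \<beta> \<alpha> :: nat and c a :: real
  assumes "h \<ge> 2" "\<beta> \<ge> 1" "c > 0" "1 \<le> a" "a \<le> 2 * h"
    and graph: "\<And>n E. graph n E \<Longrightarrow> E \<subseteq> {..<n} \<times> {..<n}"
    and cycles: "\<And>E. cycles E = F ` cycle_sequences h E" "\<And>E. covered_vertices (cycles E) = cycle_vertices h E"
  shows "\<exists>A m. randomized_algorithm \<beta> graph A m \<and>
        (\<forall>n E. graph n E \<and> cycles E = {} \<longrightarrow> never_outputs_True A m n E) \<and>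
        (\<exists>(K::real) (p::nat). \<forall>n E (t::nat) (x::nat) (\<delta>::real).
           graph n E \<and> t = card (cycles E) \<and> t \<ge> 1 \<and> x = card (covered_vertices (cycles E)) \<and>
           real x powr (real h - \<delta>) = a * real t \<longrightarrow>
           detection_probability A m n E
             (nat \<lfloor>K * ln (real n) ^ p * real (MM \<beta> \<alpha> n (real n / real x) (real x powr \<delta>))\<rfloor>)
           \<ge> 1 - 1 / real n powr c)"
proof -
  from cycle_detection_algorithm[OF assms(1-3), of \<alpha>] obtain A m K p where
    A: "\<forall>n. bandwidth_bounded \<beta> n (A n) \<and>
          (\<exists>R. \<forall>E \<omega>. terminates_within n (A n) (graph_input E \<omega>) R)"
       "\<forall>n E. cycle_sequences h E = {} \<longrightarrow> never_outputs_True A m n E" and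
    K: "\<forall>n E (y :: real).
       E \<subseteq> {..<n} \<times> {..<n} \<and> cycle_sequences h E \<noteq> {} \<and> 0 < y \<and> y \<le> real n ^ h \<and>
       real (card (cycle_vertices h E)) ^ h \<le> 2 * h * y * card (cycle_sequences h E) \<longrightarrow>
       detection_probability A m n E
         (nat \<lfloor>K * ln (real n) ^ p * real (MM \<beta> \<alpha> n (real n / real (card (cycle_vertices h E))) y)\<rfloor>)
       \<ge> 1 - 1 / real n powr c"
    by (elim exE conjE) (rule that)
  show ?thesis
  proof (rule exI[of _ A], rule exI[of _ m], intro conjI)
    show "randomized_algorithm \<beta> graph A m"
      unfolding randomized_algorithm_def using A(1) by blast
    show "\<forall>n E. graph n E \<and> cycles E = {} \<longrightarrow> never_outputs_True A m n E"
      using A(2) cycles(1) by simp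
    show "\<exists>(K::real) (p::nat). \<forall>n E (t::nat) (x::nat) (\<delta>::real).
           graph n E \<and> t = card (cycles E) \<and> t \<ge> 1 \<and> x = card (covered_vertices (cycles E)) \<and>
           real x powr (real h - \<delta>) = a * real t \<longrightarrow>
           detection_probability A m n E
             (nat \<lfloor>K * ln (real n) ^ p * real (MM \<beta> \<alpha> n (real n / real x) (real x powr \<delta>))\<rfloor>)
           \<ge> 1 - 1 / real n powr c"
    proof (rule exI[of _ K], rule exI[of _ p], intro allI impI, elim conjE)
      fix n E t x \<delta>
      assume "graph n E" and t: "t = card (cycles E)" "t \<ge> 1" and x: "x = card (covered_vertices (cycles E))"
        and \<delta>: "real x powr (real h - \<delta>) = a * real t"
      note E = graph[OF \<open>graph n E\<close>]
      note X = cycle_sequences_vertices[OF E \<open>h \<ge> 2\<close>]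
      have ne: "cycle_sequences h E \<noteq> {}" using t cycles(1) by auto
      have x': "x = card (cycle_vertices h E)" using x cycles(2) by simp
      have "x \<le> n" using card_mono[OF _ X(1)] x' by simp
      have "1 \<le> a * real t" using t(2) \<open>1 \<le> a\<close> mult_mono[of 1 a 1 "real t"] by simp
      have "0 < x"
      proof (rule ccontr)
        assume "\<not> 0 < x"
        then have "real x powr (real h - \<delta>) = 0" by simp
        with \<delta> \<open>1 \<le> a * real t\<close> show False by linarith
      qed
      have "t \<le> card (cycle_sequences h E)" unfolding t(1) cycles(1) by (rule card_image_le[OF X(3)])
      then have "a * real t \<le> 2 * h * card (cycle_sequences h E)"
        using \<open>a \<le> 2 * h\<close> \<open>1 \<le> a\<close> unfolding of_nat_mult[of "2 * h"] by (intro mult_mono) auto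
      note bounds = density_bounds[OF \<open>0 < x\<close> \<open>x \<le> n\<close> \<open>1 \<le> a * real t\<close> this \<delta>]
      show "1 - 1 / real n powr c \<le> detection_probability A m n E
             (nat \<lfloor>K * ln (real n) ^ p * real (MM \<beta> \<alpha> n (real n / real x) (real x powr \<delta>))\<rfloor>)"
        unfolding x' by (intro K[rule_format] conjI E ne bounds[unfolded x'])
    qed
  qed
qed

theorem theorem9:
  fixes h \<beta> \<alpha> :: nat and c :: real
  assumes "\<beta> \<ge> 1" and "c > 0"
  shows "
    (h \<ge> 3 \<longrightarrow>
      (\<exists>A m. randomized_algorithm \<beta> undirected_graph A m \<and>
        (\<forall>n E. undirected_graph n E \<and> undirected_cycles h E = {} \<longrightarrow> never_outputs_True A m n E) \<and>
        (\<exists>(K::real) (p::nat). \<forall>n E (t::nat) (x::nat) (\<delta>::real).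
           undirected_graph n E \<and>
           t = card (undirected_cycles h E) \<and> t \<ge> 1 \<and>
           x = card (covered_vertices (undirected_cycles h E)) \<and>
           real x powr (real h - \<delta>) = 2 * real h * real t \<longrightarrow>
           detection_probability A m n E
             (nat \<lfloor>K * ln (real n) ^ p * real (MM \<beta> \<alpha> n (real n / real x) (real x powr \<delta>))\<rfloor>)
           \<ge> 1 - 1 / real n powr c))) \<and>
    (h \<ge> 2 \<longrightarrow>
      (\<exists>A m. randomized_algorithm \<beta> directed_graph A m \<and>
        (\<forall>n E. directed_graph n E \<and> directed_cycles h E = {} \<longrightarrow> never_outputs_True A m n E) \<and>
        (\<exists>(K::real) (p::nat). \<forall>n E (t::nat) (x::nat) (\<delta>::real).
           directed_graph n E \<and>
           t = card (directed_cycles h E) \<and> t \<ge> 1 \<and>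
           x = card (covered_vertices (directed_cycles h E)) \<and>
           real x powr (real h - \<delta>) = real h * real t \<longrightarrow>
           detection_probability A m n E
             (nat \<lfloor>K * ln (real n) ^ p * real (MM \<beta> \<alpha> n (real n / real x) (real x powr \<delta>))\<rfloor>)
           \<ge> 1 - 1 / real n powr c)))"
proof (intro conjI impI)
  assume "h \<ge> 3"
  show "\<exists>A m. randomized_algorithm \<beta> undirected_graph A m \<and>
        (\<forall>n E. undirected_graph n E \<and> undirected_cycles h E = {} \<longrightarrow> never_outputs_True A m n E) \<and>
        (\<exists>(K::real) (p::nat). \<forall>n E (t::nat) (x::nat) (\<delta>::real).
           undirected_graph n E \<and>
           t = card (undirected_cycles h E) \<and> t \<ge> 1 \<and>
           x = card (covered_vertices (undirected_cycles h E)) \<and>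
           real x powr (real h - \<delta>) = 2 * real h * real t \<longrightarrow>
           detection_probability A m n E
             (nat \<lfloor>K * ln (real n) ^ p * real (MM \<beta> \<alpha> n (real n / real x) (real x powr \<delta>))\<rfloor>)
           \<ge> 1 - 1 / real n powr c)"
    by (rule cycle_detection_for_class[OF _ assms _ _ _ undirected_cycles_eq covered_undirected])
       (use \<open>h \<ge> 3\<close> in \<open>auto simp: undirected_graph_def directed_graph_def\<close>)
next
  assume "h \<ge> 2"
  show "\<exists>A m. randomized_algorithm \<beta> directed_graph A m \<and>
        (\<forall>n E. directed_graph n E \<and> directed_cycles h E = {} \<longrightarrow> never_outputs_True A m n E) \<and>
        (\<exists>(K::real) (p::nat). \<forall>n E (t::nat) (x::nat) (\<delta>::real).
           directed_graph n E \<and>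
           t = card (directed_cycles h E) \<and> t \<ge> 1 \<and>
           x = card (covered_vertices (directed_cycles h E)) \<and>
           real x powr (real h - \<delta>) = real h * real t \<longrightarrow>
           detection_probability A m n E
             (nat \<lfloor>K * ln (real n) ^ p * real (MM \<beta> \<alpha> n (real n / real x) (real x powr \<delta>))\<rfloor>)
           \<ge> 1 - 1 / real n powr c)"
    by (rule cycle_detection_for_class[OF _ assms _ _ _ directed_cycles_eq covered_directed])
       (use \<open>h \<ge> 2\<close> in \<open>auto simp: directed_graph_def\<close>)
qed

end
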